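(* Let $1\le p\le2$, $\frac1p+\frac1{p'}=1$. Consider either of the following two settings: (elliptic) $I=\mathbb{R}_+$, with functions on $I$ identified with even functions on $\mathbb{R}$; $T^tf(x)=\frac1\pi\int_{\mathbb{R}}f(\xi)\frac{t}{(\xi-x)^2+t^2}\,d\xi$ for $t>0$; $\mathcal{I}(f)(z)=\hat f(z)=\int_{\mathbb{R}}f(x)\cos(xz)\,dx$ (cosine transform); (parabolic) $I=\mathbb{R}$; $T^tf(x)=\int_{\mathbb{R}}f(\xi)\frac{e^{-(x-\xi)^2/(4b^2t)}}{2b\sqrt{\pi t}}\,d\xi$ for $t>0$ ($b>0$ fixed); $\mathcal{I}(f)(z)=\hat f(z)=\int_{\mathbb{R}}f(x)e^{-ixz}\,dx$ (Fourier transform). Let $K\subset L^p(I)$ be a bounded set and $\hat K=\{\hat f: f\in K\}\subset L^{p'}(I)$. If $K$ satisfies $\mathbf{P_a}$ in $L^p(I)$, then $\hat K$ satisfies $\mathbf{P_{b_1}}$ and $\mathbf{P_{b_2}}$ in $L^{p'}(I)$. On the other hand, if $K$ satisfies $\mathbf{P_{b_1}}$ in $L^p(I)$, then $\hat K$ satisfies $\mathbf{P_a}$ in $L^{p'}(I)$.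
   Context: $\mathcal{I}$ is extended from $L^1\cap L^p$ to a bounded operator $L^p\to L^{p'}$ (Hausdorff-Young). $T^0f=f$. $L^q(I)$ is with respect to Lebesgue measure, with the $L^\infty$ norm if $q=\infty$. The following properties of a set $S\subset L^q(I)$, $1\le q\le\infty$, are used, with $B_R=\{x\in I:|x|\le R\}$ and, for $a>0$, $M_{a,R}f(x)=\frac1a\int_0^aT^tf(x)\,dt$ for $|x|<R$, $M_{a,R}f(x)=0$ for $|x|\ge R$: $\mathbf{P_a}$: for all $\varepsilon>0$ there is $R>0$ such that $\|f\|_{L^q(I\setminus B_R)}<\varepsilon$ for all $f\in S$. $\mathbf{P_{b_1}}$: for all $\varepsilon,M_0>0$ there is $\delta>0$ such that $\|T^{t+h}f-T^tf\|_{L^q(I)}<\varepsilon$ for all $0\le t<M_0$, $|h|\le\delta$ with $t+h\ge0$, and all $f\in S$. $\mathbf{P_{b_2}}$: for all $\varepsilon,a,R>0$ there is $\delta>0$ such that $|M_{a,R}f(x+h)-M_{a,R}f(x)|<\varepsilon$ for all $|h|\le\delta$, all $x,x+h\in I$ with $|x|,|x+h|<R$, and all $f\in S$. *)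

theory Defs
  imports "HOL-Analysis.Analysis" "HOL-Probability.Essential_Supremum"
begin

text \<open>
  Elements of \<open>L\<^sup>q(I)\<close> are represented by complex functions on the real line of which only the values
  on \<open>I\<close> matter; every class has a Borel representative, so \<^const>\<open>lborel\<close> serves as Lebesgue measure.
  The exponent ranges over \<^typ>\<open>ennreal\<close>, with \<open>q = \<infinity>\<close> giving the essential supremum.
\<close>

definition Lq_norm :: "ennreal \<Rightarrow> real set \<Rightarrow> (real \<Rightarrow> complex) \<Rightarrow> ennreal" where
  "Lq_norm q I f =
     (if q = \<infinity> then esssup (restrict_space lborel I) (\<lambda>x. ennreal (norm (f x)))
      else let J = (\<integral>\<^sup>+x. ennreal (norm (f x) powr enn2real q) \<partial>restrict_space lborel I)
           in if J = \<infinity> then \<infinity> else ennreal (enn2real J powr (1 / enn2real q)))"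

definition Lq_space :: "ennreal \<Rightarrow> real set \<Rightarrow> (real \<Rightarrow> complex) set" where
  "Lq_space q I = {f \<in> borel_measurable (restrict_space lborel I). Lq_norm q I f < \<infinity>}"

definition Lq_bounded :: "ennreal \<Rightarrow> real set \<Rightarrow> (real \<Rightarrow> complex) set \<Rightarrow> bool" where
  "Lq_bounded q I S \<longleftrightarrow> (\<exists>C::real. \<forall>f\<in>S. Lq_norm q I f \<le> ennreal C)"

text \<open>
  A function \<open>f\<close> on \<open>[0,\<infinity>)\<close> is identified with the even function \<open>\<lambda>x. f \<bar>x\<bar>\<close> on the real line.
\<close>

definition poisson_semigroup :: "real \<Rightarrow> (real \<Rightarrow> complex) \<Rightarrow> real \<Rightarrow> complex" where
  "poisson_semigroup t f x =
     (if t = 0 then f x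
      else of_real (1 / pi) * (LINT \<xi>|lborel. f \<bar>\<xi>\<bar> * of_real (t / ((\<xi> - x)\<^sup>2 + t\<^sup>2))))"

definition cosine_integral :: "(real \<Rightarrow> complex) \<Rightarrow> real \<Rightarrow> complex" where
  "cosine_integral f z = (LINT x|lborel. f \<bar>x\<bar> * of_real (cos (x * z)))"

definition heat_semigroup :: "real \<Rightarrow> real \<Rightarrow> (real \<Rightarrow> complex) \<Rightarrow> real \<Rightarrow> complex" where
  "heat_semigroup b t f x =
     (if t = 0 then f x
      else (LINT \<xi>|lborel. f \<xi> *
              of_real (exp (- (x - \<xi>)\<^sup>2 / (4 * b\<^sup>2 * t)) / (2 * b * sqrt (pi * t)))))"

definition fourier_integral :: "(real \<Rightarrow> complex) \<Rightarrow> real \<Rightarrow> complex" where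
  "fourier_integral f z = (LINT x|lborel. f x * exp (- \<i> * of_real x * of_real z))"

text \<open>
  \<open>A\<close> is a bounded linear operator from \<open>L\<^sup>p(I)\<close> to \<open>L\<^sup>q(I)\<close> that agrees with the integral transform
  \<open>F\<close> on \<open>L\<^sup>1(I) \<inter> L\<^sup>p(I)\<close>. Equality in \<open>L\<^sup>q(I)\<close> is equality almost everywhere, so \<open>A\<close> is linear only
  up to null sets; together with boundedness this makes it well defined on classes.
\<close>

definition is_bounded_extension ::
    "ennreal \<Rightarrow> ennreal \<Rightarrow> real set \<Rightarrow> ((real \<Rightarrow> complex) \<Rightarrow> real \<Rightarrow> complex)
       \<Rightarrow> ((real \<Rightarrow> complex) \<Rightarrow> real \<Rightarrow> complex) \<Rightarrow> bool" where
  "is_bounded_extension p q I F A \<longleftrightarrow>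
     (\<forall>f\<in>Lq_space p I. A f \<in> Lq_space q I) \<and>
     (\<forall>f\<in>Lq_space p I. \<forall>g\<in>Lq_space p I. \<forall>c.
        AE x in restrict_space lborel I. A (\<lambda>y. c * f y + g y) x = c * A f x + A g x) \<and>
     (\<exists>C::real. \<forall>f\<in>Lq_space p I. Lq_norm q I (A f) \<le> ennreal C * Lq_norm p I f) \<and>
     (\<forall>f\<in>Lq_space 1 I \<inter> Lq_space p I. AE x in restrict_space lborel I. A f x = F f x)"

text \<open>
  Such an extension exists (for conjugate exponents with \<open>1 \<le> p \<le> 2\<close> and the two transforms above, by
  the Hausdorff--Young inequality) and is unique up to null sets, by density.
\<close>

definition extended_transform ::
    "ennreal \<Rightarrow> ennreal \<Rightarrow> real set \<Rightarrow> ((real \<Rightarrow> complex) \<Rightarrow> real \<Rightarrow> complex)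
       \<Rightarrow> (real \<Rightarrow> complex) \<Rightarrow> real \<Rightarrow> complex" where
  "extended_transform p q I F = (SOME A. is_bounded_extension p q I F A)"

definition time_mean ::
    "(real \<Rightarrow> (real \<Rightarrow> complex) \<Rightarrow> real \<Rightarrow> complex) \<Rightarrow> real \<Rightarrow> real
       \<Rightarrow> (real \<Rightarrow> complex) \<Rightarrow> real \<Rightarrow> complex" where
  "time_mean T a R f x =
     (if \<bar>x\<bar> < R then of_real (1 / a) * (LINT t:{0..a}|lborel. T t f x) else 0)"

definition property_Pa :: "ennreal \<Rightarrow> real set \<Rightarrow> (real \<Rightarrow> complex) set \<Rightarrow> bool" where
  "property_Pa q I S \<longleftrightarrow>
     (\<forall>\<epsilon>::real. \<epsilon> > 0 \<longrightarrow> (\<exists>R::real. R > 0 \<and>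
        (\<forall>f\<in>S. Lq_norm q (I - {x \<in> I. \<bar>x\<bar> \<le> R}) f < ennreal \<epsilon>)))"

definition property_Pb1 ::
    "ennreal \<Rightarrow> real set \<Rightarrow> (real \<Rightarrow> (real \<Rightarrow> complex) \<Rightarrow> real \<Rightarrow> complex)
       \<Rightarrow> (real \<Rightarrow> complex) set \<Rightarrow> bool" where
  "property_Pb1 q I T S \<longleftrightarrow>
     (\<forall>\<epsilon> M\<^sub>0::real. \<epsilon> > 0 \<longrightarrow> M\<^sub>0 > 0 \<longrightarrow> (\<exists>\<delta>::real. \<delta> > 0 \<and>
        (\<forall>t h. 0 \<le> t \<longrightarrow> t < M\<^sub>0 \<longrightarrow> \<bar>h\<bar> \<le> \<delta> \<longrightarrow> 0 \<le> t + h \<longrightarrow>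
           (\<forall>f\<in>S. Lq_norm q I (\<lambda>x. T (t + h) f x - T t f x) < ennreal \<epsilon>))))"

text \<open>
  This property is a pointwise statement about \<^const>\<open>time_mean\<close>; the exponent does not enter.
\<close>

definition property_Pb2 ::
    "real set \<Rightarrow> (real \<Rightarrow> (real \<Rightarrow> complex) \<Rightarrow> real \<Rightarrow> complex)
       \<Rightarrow> (real \<Rightarrow> complex) set \<Rightarrow> bool" where
  "property_Pb2 I T S \<longleftrightarrow>
     (\<forall>\<epsilon> a R::real. \<epsilon> > 0 \<longrightarrow> a > 0 \<longrightarrow> R > 0 \<longrightarrow> (\<exists>\<delta>::real. \<delta> > 0 \<and>
        (\<forall>x h. \<bar>h\<bar> \<le> \<delta> \<longrightarrow> x \<in> I \<longrightarrow> x + h \<in> I \<longrightarrow> \<bar>x\<bar> < R \<longrightarrow> \<bar>x + h\<bar> < R \<longrightarrow>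
           (\<forall>f\<in>S. norm (time_mean T a R f (x + h) - time_mean T a R f x) < \<epsilon>))))"

end

theory Submission
  imports Defs "HOL-Probability.Probability"
begin

text \<open>
  Both semigroups act as \<open>T\<^sup>t f(x) = \<integral> f(x - \<sigma>(t) u) k(u) du\<close> for an even probability density \<open>k\<close>, after
  even extension in the elliptic case, so Fubini gives \<open>T\<^sup>t f\<^sup>\<and> = (m\<^sub>t f)\<^sup>\<and>\<close> and \<open>(T\<^sup>t f)\<^sup>\<and> = m\<^sub>t f\<^sup>\<and>\<close> with
  \<open>m\<^sub>t(y)\<close> the characteristic function of \<open>k\<close> at \<open>\<sigma>(t) y\<close>. If the tails of \<open>K\<close> are uniformly small, \<open>f\<close> may be
  replaced by its truncation to a ball, on which \<open>m\<^sub>t\<close> is uniformly continuous in \<open>t\<close> and whose transform is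
  Lipschitz; the Hausdorff--Young inequality controls the errors. Conversely, \<open>1 - m\<^sub>t\<close> is bounded away from \<open>0\<close>
  outside a large ball, so there \<open>f\<^sup>\<and>\<close> is dominated by \<open>(f - T\<^sup>t f)\<^sup>\<and>\<close>. Of \<open>m\<^sub>t\<close> only continuity and decay are
  used, and no sharp constants are needed: the Hausdorff--Young inequality is obtained by real interpolation
  between the trivial bound and the Plancherel inequality.
\<close>

section \<open>Lebesgue norms\<close>

text \<open>Three points shape the development. First, \<open>extended_transform\<close> is a
  \<open>SOME\<close> term, so nothing is known about it until a bounded extension has been
  constructed; afterwards only boundedness, linearity up to null sets and agreement with the
  integral on integrable functions are available. Second, the elements of L^q are concrete functions
  while the transform is fixed only up to null sets, yet P_b2 is a pointwise statement. It is
  accessible because a convolution at positive time ignores null sets and obeys a sup bound of order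
  t^(-1/p'). Since p \<le> 2 gives p' \<ge> 2, this is at most 1 + t^(-1/2) up to constants, which
  is integrable at t = 0 and so survives the time average even for the Poisson scaling
  \<open>\<sigma> t = t\<close>. Third, truncation errors must be small uniformly in f, but sharp
  values do not matter. Hence the predicate \<open>Lq_le q M f c\<close> replaces the norm: it packs
  measurability and a real upper bound c, compares integrals of r-th powers directly, and lets
  constants such as 2 and 4 accumulate.\<close>

definition Lq_le :: "ennreal \<Rightarrow> real measure \<Rightarrow> (real \<Rightarrow> complex) \<Rightarrow> real \<Rightarrow> bool" where
  "Lq_le q M f c \<longleftrightarrow> f \<in> borel_measurable M \<and> 0 \<le> c \<and>
     (if q = \<infinity> then AE x in M. norm (f x) \<le> c
      else (\<integral>\<^sup>+x. ennreal (norm (f x) powr enn2real q) \<partial>M) \<le> ennreal (c powr enn2real q))"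

lemma exponent_cases [consumes 1, case_names infinite finite]:
  fixes q :: ennreal
  assumes "1 \<le> q"
  obtains "q = \<top>" | r where "q = ennreal r" "1 \<le> r"
  using assms by (cases q) auto

lemma Lq_le_top: "Lq_le \<top> M f c \<longleftrightarrow> f \<in> borel_measurable M \<and> 0 \<le> c \<and> (AE x in M. norm (f x) \<le> c)"
  by (simp add: Lq_le_def)

lemma Lq_le_ennreal:
  "0 \<le> r \<Longrightarrow> Lq_le (ennreal r) M f c \<longleftrightarrow> f \<in> borel_measurable M \<and> 0 \<le> c \<and>
     (\<integral>\<^sup>+x. ennreal (norm (f x) powr r) \<partial>M) \<le> ennreal (c powr r)"
  by (simp add: Lq_le_def)

lemma Lq_leD:
  assumes "Lq_le q M f c"
  shows Lq_le_measurable: "f \<in> borel_measurable M" and Lq_le_nonneg: "0 \<le> c"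
  using assms by (auto simp: Lq_le_def)

text \<open>Pointwise domination is the common source of the rules for scaling, enlarging the bound,
  changing a function on a null set and truncating, and of the multiplier estimates in both
  directions of the transfer.\<close>

lemma Lq_le_AE_mono:
  assumes "1 \<le> q" "Lq_le q M f c" and g: "g \<in> borel_measurable M" and "0 \<le> a"
    and le: "AE x in M. norm (g x) \<le> a * norm (f x)" and d: "a * c \<le> d"
  shows "Lq_le q M g d"
  using \<open>1 \<le> q\<close>
proof (cases rule: exponent_cases)
  case infinite
  have "AE x in M. norm (f x) \<le> c" using assms(2) infinite by (simp add: Lq_le_top)
  with le have "AE x in M. norm (g x) \<le> d"
    by eventually_elim (meson d order_trans mult_left_mono \<open>0 \<le> a\<close>)
  moreover have "0 \<le> d" using d assms(2) \<open>0 \<le> a\<close> by (auto simp: Lq_le_def intro: order_trans[OF mult_nonneg_nonneg])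
  ultimately show ?thesis using g infinite by (simp add: Lq_le_top)
next
  case (finite r)
  then have f [measurable]: "f \<in> borel_measurable M" and c: "0 \<le> c"
    and I: "(\<integral>\<^sup>+x. ennreal (norm (f x) powr r) \<partial>M) \<le> ennreal (c powr r)"
    using assms(2) by (auto simp: Lq_le_ennreal)
  have d0: "0 \<le> d" using d c \<open>0 \<le> a\<close> by (auto intro: order_trans[OF mult_nonneg_nonneg])
  have "(\<integral>\<^sup>+x. ennreal (norm (g x) powr r) \<partial>M) \<le> (\<integral>\<^sup>+x. ennreal (a powr r) * ennreal (norm (f x) powr r) \<partial>M)"
  proof (rule nn_integral_mono_AE)
    show "AE x in M. ennreal (norm (g x) powr r) \<le> ennreal (a powr r) * ennreal (norm (f x) powr r)"
      using le
    proof eventually_elim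
      case (elim x)
      then have "norm (g x) powr r \<le> (a * norm (f x)) powr r"
        using finite by (intro powr_mono2) auto
      then show ?case using \<open>0 \<le> a\<close> by (simp add: powr_mult ennreal_mult[symmetric])
    qed
  qed
  also have "\<dots> = ennreal (a powr r) * (\<integral>\<^sup>+x. ennreal (norm (f x) powr r) \<partial>M)"
    by (rule nn_integral_cmult) simp
  also have "\<dots> \<le> ennreal (a powr r) * ennreal (c powr r)" by (intro mult_left_mono I) simp
  also have "\<dots> = ennreal ((a * c) powr r)" using \<open>0 \<le> a\<close> c by (simp add: powr_mult ennreal_mult[symmetric])
  also have "\<dots> \<le> ennreal (d powr r)"
    using finite d \<open>0 \<le> a\<close> c by (intro ennreal_leI powr_mono2) auto
  finally show ?thesis using finite g d0 by (simp add: Lq_le_ennreal)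
qed

lemma Lq_le_mono: "1 \<le> q \<Longrightarrow> Lq_le q M f c \<Longrightarrow> c \<le> d \<Longrightarrow> Lq_le q M f d"
  by (rule Lq_le_AE_mono[where a=1 and f=f and c=c]) (auto dest: Lq_le_measurable)

lemma Lq_le_cong_AE:
  "1 \<le> q \<Longrightarrow> Lq_le q M f c \<Longrightarrow> g \<in> borel_measurable M \<Longrightarrow> AE x in M. g x = f x \<Longrightarrow> Lq_le q M g c"
  by (rule Lq_le_AE_mono[where a=1 and f=f and c=c]) auto

lemma Lq_le_cmult:
  "1 \<le> q \<Longrightarrow> Lq_le q M f c \<Longrightarrow> Lq_le q M (\<lambda>x. a * f x) (norm a * c)"
  by (rule Lq_le_AE_mono[where a="norm a" and f=f and c=c]) (auto dest: Lq_le_measurable simp: norm_mult)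

(* The factor 2 is not sharp, but it makes the pointwise estimate |u + v|^r <= 2^r (|u|^r + |v|^r) suffice. *)
lemma Lq_le_add:
  assumes "1 \<le> q" "Lq_le q M f c" "Lq_le q M g d"
  shows "Lq_le q M (\<lambda>x. f x + g x) (2 * (c + d))"
  using \<open>1 \<le> q\<close>
proof (cases rule: exponent_cases)
  case infinite
  have "AE x in M. norm (f x) \<le> c" "AE x in M. norm (g x) \<le> d" "0 \<le> c" "0 \<le> d"
    using assms infinite by (auto simp add: Lq_le_top)
  then have "AE x in M. norm (f x + g x) \<le> 2 * (c + d)"
    by (elim AE_mp, intro AE_I2) (smt (verit) norm_triangle_ineq)
  then show ?thesis using assms infinite by (auto simp add: Lq_le_top)
next
  case (finite r)
  then have [measurable]: "f \<in> borel_measurable M" "g \<in> borel_measurable M" and c: "0 \<le> c" "0 \<le> d"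
    and I: "(\<integral>\<^sup>+x. ennreal (norm (f x) powr r) \<partial>M) \<le> ennreal (c powr r)"
     "(\<integral>\<^sup>+x. ennreal (norm (g x) powr r) \<partial>M) \<le> ennreal (d powr r)"
    using assms(2,3) by (auto simp: Lq_le_ennreal)
  have *: "(u + v) powr r \<le> 2 powr r * (u powr r + v powr r)" if "0 \<le> u" "0 \<le> v" for u v :: real
  proof -
    have "(u + v) powr r \<le> (2 * max u v) powr r" using that finite by (intro powr_mono2) auto
    also have "\<dots> = 2 powr r * max u v powr r" using that by (simp add: powr_mult)
    also have "max u v powr r \<le> u powr r + v powr r" by (auto simp: max_def)
    finally show ?thesis by simp
  qed
  \<comment> \<open>Superadditivity of the r-th power for r \<ge> 1: write x^r = x x^(r-1), enlarge
    the second factor to (c + d)^(r-1) and sum over x = c and x = d.\<close>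
  have **: "c powr r + d powr r \<le> (c + d) powr r"
  proof (cases "c + d = 0")
    case True then show ?thesis using c by (simp add: add_nonneg_eq_0_iff)
  next
    case False
    have c1: "x powr r \<le> x * (c + d) powr (r - 1)" if "0 \<le> x" "x \<le> c + d" for x
    proof (cases "x = 0")
      case False
      then have "x powr r = x * x powr (r - 1)" using that by (simp add: powr_diff)
      also have "\<dots> \<le> x * (c + d) powr (r - 1)" using that finite by (intro mult_left_mono powr_mono2) auto
      finally show ?thesis .
    qed simp
    have "c powr r + d powr r \<le> c * (c + d) powr (r - 1) + d * (c + d) powr (r - 1)"
      using c by (intro add_mono c1) auto
    also have "\<dots> = (c + d) * (c + d) powr (r - 1)" by (simp add: algebra_simps)
    also have "\<dots> = (c + d) powr r" using c False by (simp add: powr_diff)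
    finally show ?thesis .
  qed
  have "(\<integral>\<^sup>+x. ennreal (norm (f x + g x) powr r) \<partial>M) \<le>
      (\<integral>\<^sup>+x. ennreal (2 powr r) * (ennreal (norm (f x) powr r) + ennreal (norm (g x) powr r)) \<partial>M)"
  proof (rule nn_integral_mono)
    fix x
    have "norm (f x + g x) powr r \<le> (norm (f x) + norm (g x)) powr r"
      using finite by (intro powr_mono2 norm_triangle_ineq) auto
    also note *[of "norm (f x)" "norm (g x)"]
    finally show "ennreal (norm (f x + g x) powr r) \<le> ennreal (2 powr r) * (ennreal (norm (f x) powr r) + ennreal (norm (g x) powr r))"
      by (simp add: ennreal_plus[symmetric] ennreal_mult[symmetric] del: ennreal_plus)
  qed
  also have "\<dots> = ennreal (2 powr r) * ((\<integral>\<^sup>+x. ennreal (norm (f x) powr r) \<partial>M) + (\<integral>\<^sup>+x. ennreal (norm (g x) powr r) \<partial>M))"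
    by (simp add: nn_integral_cmult nn_integral_add)
  also have "\<dots> \<le> ennreal (2 powr r) * (ennreal (c powr r) + ennreal (d powr r))"
    by (intro mult_left_mono add_mono I) simp
  also have "\<dots> = ennreal (2 powr r * (c powr r + d powr r))"
    by (simp add: ennreal_plus[symmetric] ennreal_mult[symmetric] del: ennreal_plus)
  also have "\<dots> \<le> ennreal (2 powr r * (c + d) powr r)"
    by (intro ennreal_leI mult_left_mono **) simp
  also have "\<dots> = ennreal ((2 * (c + d)) powr r)" using c by (subst powr_mult) auto
  finally show ?thesis using finite c by (simp add: Lq_le_ennreal)
qed

lemma Lq_le_diff:
  assumes "1 \<le> q" "Lq_le q M f c" "Lq_le q M g d"
  shows "Lq_le q M (\<lambda>x. f x - g x) (2 * (c + d))"
  using Lq_le_add[OF assms(1,2) Lq_le_cmult[OF assms(1,3), of "-1"]] by simp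

text \<open>Fatou's lemma for finite q; for q = \<infinity> the countably many exceptional sets have
  a null union. Thus a bound passes to limits that are only known almost everywhere.\<close>

lemma Lq_le_limit:
  assumes "1 \<le> q" and X: "\<And>k::nat. Lq_le q M (X k) c" and h: "h \<in> borel_measurable M"
    and lim: "AE x in M. (\<lambda>k. X k x) \<longlonglongrightarrow> h x"
  shows "Lq_le q M h c"
  using \<open>1 \<le> q\<close>
proof (cases rule: exponent_cases)
  case infinite
  have "AE x in M. \<forall>k. norm (X k x) \<le> c" using X infinite by (simp add: AE_all_countable Lq_le_top)
  with lim have "AE x in M. norm (h x) \<le> c"
    by eventually_elim (rule tendsto_upperbound[OF tendsto_norm], auto)
  then show ?thesis using h X[of 0] infinite by (simp add: Lq_le_top)
next
  case (finite r)
  have [measurable]: "X k \<in> borel_measurable M" for k using X Lq_le_measurable by blast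
  have "(\<integral>\<^sup>+x. ennreal (norm (h x) powr r) \<partial>M) = (\<integral>\<^sup>+x. liminf (\<lambda>k. ennreal (norm (X k x) powr r)) \<partial>M)"
  proof (rule nn_integral_cong_AE)
    show "AE x in M. ennreal (norm (h x) powr r) = liminf (\<lambda>k. ennreal (norm (X k x) powr r))"
      using lim
    proof eventually_elim
      case (elim x)
      have "(\<lambda>k. ennreal (norm (X k x) powr r)) \<longlonglongrightarrow> ennreal (norm (h x) powr r)"
        using finite elim by (intro tendsto_ennrealI tendsto_powr2 tendsto_norm tendsto_const) auto
      then show ?case by (intro lim_imp_Liminf[symmetric]) auto
    qed
  qed
  also have "\<dots> \<le> liminf (\<lambda>k. \<integral>\<^sup>+x. ennreal (norm (X k x) powr r) \<partial>M)"
    by (rule nn_integral_liminf) simp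
  also have "\<dots> \<le> liminf (\<lambda>k. ennreal (c powr r))"
    using X finite by (intro Liminf_mono eventuallyI) (simp add: Lq_le_ennreal)
  also have "\<dots> = ennreal (c powr r)" by (simp add: Liminf_const)
  finally show ?thesis using X[of 0] finite h by (simp add: Lq_le_ennreal)
qed

lemma Lq_le_imp_zero:
  assumes "1 \<le> q" and X: "\<And>e. 0 < e \<Longrightarrow> Lq_le q M f e"
  shows "AE x in M. f x = 0"
proof -
  have f [measurable]: "f \<in> borel_measurable M" using X[of 1] by (auto dest: Lq_le_measurable)
  show ?thesis
    using \<open>1 \<le> q\<close>
  proof (cases rule: exponent_cases)
    case infinite
    have "AE x in M. \<forall>k. norm (f x) \<le> inverse (real (Suc k))"
      using X infinite by (simp add: AE_all_countable Lq_le_top)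
    then show ?thesis
    proof eventually_elim
      case (elim x)
      have "norm (f x) \<le> 0"
        by (rule LIMSEQ_le_const[OF LIMSEQ_inverse_real_of_nat]) (use elim in auto)
      then show ?case by simp
    qed
  next
    case (finite r)
    have "(\<integral>\<^sup>+x. ennreal (norm (f x) powr r) \<partial>M) \<le> 0 + ennreal e" if "0 < e" for e :: real
      \<comment> \<open>The radius e^(1/r) is chosen so that its r-th power is e.\<close>
      using X[of "e powr (1/r)"] that finite by (simp add: Lq_le_ennreal powr_powr)
    then have "(\<integral>\<^sup>+x. ennreal (norm (f x) powr r) \<partial>M) = 0"
      using ennreal_le_epsilon[of 0 "\<integral>\<^sup>+x. ennreal (norm (f x) powr r) \<partial>M"] by simp
    then have "AE x in M. ennreal (norm (f x) powr r) = 0"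
      by (subst (asm) nn_integral_0_iff_AE) auto
    then show ?thesis by eventually_elim auto
  qed
qed

text \<open>The bridge between the extended-real norm and real bounds. The sign condition on c
  matters because \<open>ennreal\<close> sends negative reals to 0.\<close>

lemma Lq_norm_le_iff:
  assumes "1 \<le> q" "f \<in> borel_measurable (restrict_space lborel I)" "0 \<le> c"
  shows "Lq_norm q I f \<le> ennreal c \<longleftrightarrow> Lq_le q (restrict_space lborel I) f c"
  using \<open>1 \<le> q\<close>
proof (cases rule: exponent_cases)
  case infinite
  have "esssup (restrict_space lborel I) (\<lambda>x. ennreal (norm (f x))) \<le> ennreal c \<longleftrightarrow>
     (AE x in restrict_space lborel I. norm (f x) \<le> c)"
  proof
    assume *: "esssup (restrict_space lborel I) (\<lambda>x. ennreal (norm (f x))) \<le> ennreal c"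
    show "AE x in restrict_space lborel I. norm (f x) \<le> c"
      using esssup_AE[of "\<lambda>x. ennreal (norm (f x))" "restrict_space lborel I"]
      by eventually_elim (use * assms in \<open>auto dest: order_trans\<close>)
  next
    assume "AE x in restrict_space lborel I. norm (f x) \<le> c"
    then show "esssup (restrict_space lborel I) (\<lambda>x. ennreal (norm (f x))) \<le> ennreal c"
      using assms by (intro esssup_I) auto
  qed
  then show ?thesis using assms infinite by (simp add: Lq_norm_def Lq_le_top)
next
  case (finite r)
  let ?J = "\<integral>\<^sup>+x. ennreal (norm (f x) powr r) \<partial>restrict_space lborel I"
  have eq: "Lq_norm q I f = (if ?J = \<infinity> then \<infinity> else ennreal (enn2real ?J powr (1 / r)))"
    using finite by (simp add: Lq_norm_def Let_def)
  show ?thesis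
  proof (cases ?J)
    case (real j)
    have "(j powr (1/r) \<le> c) \<longleftrightarrow> (j \<le> c powr r)"
    proof
      assume "j powr (1/r) \<le> c"
      then have "(j powr (1/r)) powr r \<le> c powr r" using finite by (intro powr_mono2) auto
      then show "j \<le> c powr r" using finite real by (simp add: powr_powr)
    next
      assume "j \<le> c powr r"
      then have "j powr (1/r) \<le> (c powr r) powr (1/r)" using finite real by (intro powr_mono2) auto
      then show "j powr (1/r) \<le> c" using finite assms by (simp add: powr_powr)
    qed
    then show ?thesis using finite assms real eq by (simp add: Lq_le_ennreal)
  next
    case top
    then show ?thesis using finite assms eq by (simp add: Lq_le_ennreal top_unique)
  qed
qed

lemma Lq_spaceE:
  assumes "1 \<le> q" "f \<in> Lq_space q I"
  obtains c where "Lq_le q (restrict_space lborel I) f c" "Lq_norm q I f = ennreal c"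
proof -
  have f: "f \<in> borel_measurable (restrict_space lborel I)" "Lq_norm q I f < \<infinity>"
    using assms by (auto simp: Lq_space_def)
  then obtain c where c: "Lq_norm q I f = ennreal c" "0 \<le> c" by (cases "Lq_norm q I f") auto
  show ?thesis using that[of c] c Lq_norm_le_iff[OF assms(1) f(1), of c] by simp
qed

lemma Lq_spaceI: "1 \<le> q \<Longrightarrow> Lq_le q (restrict_space lborel I) f c \<Longrightarrow> f \<in> Lq_space q I"
  using Lq_norm_le_iff[of q f I c] Lq_leD[of q "restrict_space lborel I" f c]
  by (auto simp: Lq_space_def intro: le_less_trans)

lemma Lq_norm_less:
  assumes "1 \<le> q" "Lq_le q (restrict_space lborel I) f c" "c < e"
  shows "Lq_norm q I f < ennreal e"
  using Lq_norm_le_iff[of q f I c] Lq_leD[of q "restrict_space lborel I" f c] assms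
  by (auto simp: ennreal_lessI intro: le_less_trans)

text \<open>Extension by zero moves tails and half-line estimates to the whole line, where
  convolution and the Fourier integral live.\<close>

lemma Lq_le_restrict_iff:
  assumes "1 \<le> q" and J: "J \<in> sets lborel"
  shows "Lq_le q (restrict_space lborel J) f c \<longleftrightarrow> Lq_le q lborel (\<lambda>x. indicator J x * f x) c"
proof -
  have m: "f \<in> borel_measurable (restrict_space lborel J) \<longleftrightarrow> (\<lambda>x. indicator J x * f x) \<in> borel_measurable lborel"
    using borel_measurable_restrict_space_iff[of J lborel f] assms
    by (simp add: indicator_scaleR_eq_if) (simp add: indicator_def of_bool_def if_distrib if_distribR cong: if_cong)
  show ?thesis
    using \<open>1 \<le> q\<close>
  proof (cases rule: exponent_cases)
    case infinite
    have "(AE x in restrict_space lborel J. norm (f x) \<le> c) \<longleftrightarrow> (AE x in lborel. norm (indicator J x * f x) \<le> c)"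
      if "0 \<le> c"
      using assms that by (subst AE_restrict_space_iff) (auto intro!: AE_cong simp: indicator_def)
    then show ?thesis using infinite m by (auto simp: Lq_le_top)
  next
    case (finite r)
    have "(\<integral>\<^sup>+x. ennreal (norm (f x) powr r) \<partial>restrict_space lborel J) = (\<integral>\<^sup>+x. ennreal (norm (indicator J x * f x) powr r) \<partial>lborel)"
      using assms finite by (subst nn_integral_restrict_space) (auto intro!: nn_integral_cong simp: indicator_def)
    then show ?thesis using finite m by (simp add: Lq_le_ennreal)
  qed
qed

section \<open>Convolution with dilated probability densities\<close>

text \<open>Affine substitution maps null sets to null sets. With x fixed, an almost everywhere
  statement about g therefore becomes one about u \<mapsto> g(x - s u), which is what makes a
  convolution defined at every x and independent of the representative.\<close>

lemma AE_lborel_affine: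
  fixes s x :: real
  assumes "s \<noteq> 0" "AE y in lborel. Q y"
  shows "AE u in lborel. Q (x - s * u)"
proof -
  obtain N where N: "{y. \<not> Q y} \<subseteq> N" "emeasure lborel N = 0" and [measurable]: "N \<in> sets lborel"
    using assms(2) by (auto elim!: AE_E)
  have "(\<integral>\<^sup>+u. indicator N u \<partial>lborel) = ennreal \<bar>- s\<bar> * (\<integral>\<^sup>+u. indicator N (x + (- s) * u) \<partial>lborel)"
    using assms(1) by (intro nn_integral_real_affine) auto
  then have "(\<integral>\<^sup>+u. indicator N (x - s * u) \<partial>lborel) = (0::ennreal)"
    using N(2) assms(1) \<open>N \<in> sets lborel\<close> nn_integral_indicator[of N lborel] by (auto simp: mult_ac)
  then have "AE u in lborel. indicator N (x - s * u) = (0::ennreal)"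
    by (subst (asm) nn_integral_0_iff_AE) auto
  then show ?thesis by eventually_elim (use N(1) in \<open>auto simp: indicator_def split: if_splits\<close>)
qed

lemma nn_integral_translate:
  fixes x :: real
  assumes [measurable]: "f \<in> borel_measurable borel"
  shows "(\<integral>\<^sup>+y. f (y - x) \<partial>lborel) = (\<integral>\<^sup>+y. f y \<partial>lborel)"
  using nn_integral_real_affine[of f 1 "-x"] by simp

lemma nn_integral_dilate:
  fixes x :: real
  assumes [measurable]: "f \<in> borel_measurable borel" and "0 < s"
  shows "(\<integral>\<^sup>+u. f (x - s * u) \<partial>lborel) = ennreal (1 / s) * (\<integral>\<^sup>+y. f y \<partial>lborel)"
proof -
  have "(\<integral>\<^sup>+y. f y \<partial>lborel) = ennreal s * (\<integral>\<^sup>+u. f (x - s * u) \<partial>lborel)"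
    using nn_integral_real_affine[of f "-s" x] assms by simp
  then show ?thesis using assms by (simp add: mult.assoc[symmetric] ennreal_mult[symmetric])
qed

text \<open>Weighted AM-GM for h^r and m^r. It is the tangent-line inequality of the r-th power at
  m, rearranged so that integration gives Jensen's inequality.\<close>

lemma powr_young:
  fixes m h r :: real
  assumes "0 < m" "0 \<le> h" "1 \<le> r"
  shows "m powr (r - 1) * h \<le> (1 / r) * h powr r + (1 - 1 / r) * m powr r"
proof (cases "h = 0")
  case False
  have "(h powr r) powr (1 / r) * (m powr r) powr (1 - 1 / r) \<le> (1 / r) * h powr r + (1 - 1 / r) * m powr r"
    using assms False by (intro Youngs_inequality_0) auto
  moreover have "(h powr r) powr (1 / r) * (m powr r) powr (1 - 1 / r) = m powr (r - 1) * h"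
    using assms by (simp add: powr_powr algebra_simps)
  ultimately show ?thesis by simp
qed (use assms in auto)

text \<open>Integrability comes from h \<le> 1 + h^r. Integrating \<open>powr_young\<close> at the
  mean m and cancelling (1 - 1/r) m^r leaves m^r \<le> c^r.\<close>

lemma (in prob_space) jensen_powr:
  fixes h :: "'a \<Rightarrow> real"
  assumes [measurable]: "h \<in> borel_measurable M" and h: "\<And>u. 0 \<le> h u" and r: "1 \<le> r" and "0 \<le> c"
    and le: "(\<integral>\<^sup>+u. ennreal (h u powr r) \<partial>M) \<le> ennreal (c powr r)"
  shows "integrable M h" "(\<integral>u. h u \<partial>M) \<le> c"
proof -
  have i1: "integrable M (\<lambda>u. h u powr r)"
    using le by (intro integrableI_bounded) (auto simp: less_top[symmetric] top_unique)
  have le': "(\<integral>u. h u powr r \<partial>M) \<le> c powr r"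
    using le i1 by (subst (asm) nn_integral_eq_integral) auto
  show i: "integrable M h"
  proof (rule Bochner_Integration.integrable_bound)
    show "integrable M (\<lambda>u. 1 + h u powr r)" using i1 by simp
    show "AE u in M. norm (h u) \<le> norm (1 + h u powr r)"
    proof (rule AE_I2)
      fix u
      have "h u \<le> 1 + h u powr r"
      proof (cases "h u \<le> 1")
        case True then show ?thesis by (smt (verit) powr_ge_zero)
      next
        case False
        then have "h u powr 1 \<le> h u powr r" using r by (intro powr_mono) auto
        then show ?thesis using False by simp
      qed
      then show "norm (h u) \<le> norm (1 + h u powr r)" using h[of u] by simp
    qed
  qed simp
  let ?m = "\<integral>u. h u \<partial>M"
  have m0: "0 \<le> ?m" using h by simp
  show "?m \<le> c"
  proof (cases "?m = 0")
    case False
    with m0 have m: "0 < ?m" by simp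
    have "(\<integral>u. ?m powr (r - 1) * h u \<partial>M) \<le> (\<integral>u. (1 / r) * h u powr r + (1 - 1 / r) * ?m powr r \<partial>M)"
      using i i1 powr_young[OF m h r] by (intro integral_mono) auto
    then have "?m powr (r - 1) * ?m \<le> (1 / r) * (\<integral>u. h u powr r \<partial>M) + (1 - 1 / r) * ?m powr r"
      using i i1 by (simp add: prob_space)
    moreover have "?m powr (r - 1) * ?m = ?m powr r" using m by (simp add: powr_diff)
    ultimately have "(1 / r) * ?m powr r \<le> (1 / r) * (\<integral>u. h u powr r \<partial>M)" by (simp add: algebra_simps)
    then have "?m powr r \<le> c powr r" using r le' by (simp add: divide_right_mono) (simp add: field_simps)
    then show ?thesis using r m \<open>0 \<le> c\<close>
      by (metis less_le_not_le linorder_not_less powr_less_mono2 order_less_le_trans zero_less_one)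
  qed (use \<open>0 \<le> c\<close> in simp)
qed

locale density_kernel =
  fixes k :: "real \<Rightarrow> real"
  assumes k_measurable [measurable]: "k \<in> borel_measurable borel"
    and k_nonneg: "0 \<le> k u"
    and k_total: "(\<integral>\<^sup>+u. ennreal (k u) \<partial>lborel) = 1"
begin

abbreviation P :: "real measure" where "P \<equiv> density lborel (\<lambda>u. ennreal (k u))"

sublocale P: real_distribution P
proof (intro real_distribution.intro real_distribution_axioms.intro prob_spaceI)
  show "emeasure P (space P) = 1"
    using k_total by (simp add: emeasure_density)
qed simp

text \<open>Integrating against the fixed measure \<open>P\<close> and dilating the argument,
  instead of dilating the density, keeps s = 0 meaningful: it returns g, just as the semigroup does
  at time 0.\<close>

definition conv :: "real \<Rightarrow> (real \<Rightarrow> complex) \<Rightarrow> real \<Rightarrow> complex" where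
  "conv s g x = (\<integral>u. g (x - s * u) \<partial>P)"

lemma conv_zero [simp]: "conv 0 g x = g x"
  using P.prob_space by (simp add: conv_def del: P.space_eq_univ)

lemma conv_measurable [measurable]:
  assumes [measurable]: "g \<in> borel_measurable borel"
  shows "conv s g \<in> borel_measurable borel"
  unfolding conv_def by measurable

lemma conv_measurable_scale:
  assumes [measurable]: "g \<in> borel_measurable borel" "s \<in> borel_measurable borel"
  shows "(\<lambda>t. conv (s t) g x) \<in> borel_measurable borel"
  unfolding conv_def by measurable

lemma AE_P: "AE u in lborel. Q u \<Longrightarrow> AE u in P. Q u"
  by (subst AE_density) (auto elim: AE_mp)

text \<open>The equality is at every x, which is false for s = 0, where \<open>conv\<close> merely
  evaluates its argument.\<close>

lemma conv_cong_AE: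
  assumes "s \<noteq> 0" "AE y in lborel. f y = g y"
   and [measurable]: "f \<in> borel_measurable borel" "g \<in> borel_measurable borel"
  shows "conv s f x = conv s g x"
  unfolding conv_def by (intro integral_cong_AE AE_P AE_lborel_affine assms) auto

lemma conv_bounded:
  assumes [measurable]: "g \<in> borel_measurable borel" and "0 \<le> c" and le: "AE u in P. norm (g (x - s * u)) \<le> c"
  shows "integrable P (\<lambda>u. g (x - s * u))" "norm (conv s g x) \<le> c"
proof -
  show i: "integrable P (\<lambda>u. g (x - s * u))"
    by (rule P.integrable_const_bound[OF le]) simp
  have "norm (conv s g x) \<le> (\<integral>u. norm (g (x - s * u)) \<partial>P)"
    unfolding conv_def by (rule integral_norm_bound)
  also have "\<dots> \<le> (\<integral>u. c \<partial>P)" using i le by (intro integral_mono_AE) auto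
  finally show "norm (conv s g x) \<le> c" using P.prob_space by (simp del: P.space_eq_univ)
qed

lemma conv_jensen:
  assumes [measurable]: "g \<in> borel_measurable borel" and r: "1 \<le> r" and c: "0 \<le> c"
    and le: "(\<integral>\<^sup>+u. ennreal (norm (g (x - s * u)) powr r) \<partial>P) \<le> ennreal (c powr r)"
  shows "integrable P (\<lambda>u. g (x - s * u))" "norm (conv s g x) \<le> c"
proof -
  note j = P.jensen_powr[of "\<lambda>u. norm (g (x - s * u))", OF _ _ r c le]
  show i: "integrable P (\<lambda>u. g (x - s * u))"
    by (subst integrable_norm_iff[symmetric]) (use j in auto)
  have "norm (conv s g x) \<le> (\<integral>u. norm (g (x - s * u)) \<partial>P)"
    unfolding conv_def by (rule integral_norm_bound)
  also have "\<dots> \<le> c" using j(2) by simp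
  finally show "norm (conv s g x) \<le> c" .
qed

text \<open>For finite q, Jensen at each x, then Tonelli and translation invariance. Since
  \<open>P\<close> has mass one, no constant is lost.\<close>

lemma conv_contraction:
  assumes "1 \<le> q" "Lq_le q lborel g c"
  shows "Lq_le q lborel (conv s g) c"
proof (cases "s = 0")
  case True then show ?thesis using assms by (simp add: conv_zero[abs_def])
next
  case False
  have [measurable]: "g \<in> borel_measurable borel" using assms Lq_le_measurable by fastforce
  have c: "0 \<le> c" using assms Lq_le_nonneg by blast
  show ?thesis
    using \<open>1 \<le> q\<close>
  proof (cases rule: exponent_cases)
    case infinite
    have "AE y in lborel. norm (g y) \<le> c" using assms infinite by (simp add: Lq_le_top)
    then have "norm (conv s g x) \<le> c" for x
      by (intro conv_bounded c AE_P AE_lborel_affine[OF False]) auto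
    then show ?thesis using infinite c by (simp add: Lq_le_top)
  next
    case (finite r)
    have "(\<integral>\<^sup>+x. ennreal (norm (conv s g x) powr r) \<partial>lborel) \<le>
       (\<integral>\<^sup>+x. (\<integral>\<^sup>+u. ennreal (norm (g (x - s * u)) powr r) \<partial>P) \<partial>lborel)"
    proof (rule nn_integral_mono)
      fix x
      show "ennreal (norm (conv s g x) powr r) \<le> (\<integral>\<^sup>+u. ennreal (norm (g (x - s * u)) powr r) \<partial>P)"
      proof (cases "\<integral>\<^sup>+u. ennreal (norm (g (x - s * u)) powr r) \<partial>P")
        case (real j)
        then have "norm (conv s g x) \<le> j powr (1 / r)"
          using finite by (intro conv_jensen(2)[where r=r]) (auto simp: powr_powr)
        then have "norm (conv s g x) powr r \<le> (j powr (1 / r)) powr r"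
          using finite by (intro powr_mono2) auto
        then show ?thesis using real finite by (simp add: powr_powr)
      qed simp
    qed
    also have "\<dots> = (\<integral>\<^sup>+u. (\<integral>\<^sup>+x. ennreal (norm (g (x - s * u)) powr r) \<partial>lborel) \<partial>P)"
    proof -
      interpret pair_sigma_finite lborel P ..
      show ?thesis by (rule Fubini'[symmetric]) measurable
    qed
    also have "\<dots> = (\<integral>\<^sup>+u. (\<integral>\<^sup>+x. ennreal (norm (g x) powr r) \<partial>lborel) \<partial>P)"
      by (intro nn_integral_cong nn_integral_translate[where f="\<lambda>x. ennreal (norm (g x) powr r)"]) simp
    also have "\<dots> = (\<integral>\<^sup>+x. ennreal (norm (g x) powr r) \<partial>lborel)"
      using P.emeasure_space_1 by (simp del: P.space_eq_univ)
    also have "\<dots> \<le> ennreal (c powr r)" using assms finite by (simp add: Lq_le_ennreal)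
    finally show ?thesis using finite c by (simp add: Lq_le_ennreal)
  qed
qed

text \<open>Replacing the density by its maximum B and substituting in Jensen's inequality gives the
  sup bound (B/s)^(1/q) c. For q \<ge> 2 the first factor is at most 1 + sqrt(B/s): compare with
  exponent 0 if B/s \<le> 1 and with exponent 1/2 otherwise. This converts smallness in L^q into
  pointwise smallness at positive times.\<close>

lemma conv_pointwise:
  assumes "1 \<le> q" and g: "Lq_le q lborel g c" and s: "0 < s" and B: "\<And>u. k u \<le> B"
  shows "integrable P (\<lambda>u. g (x - s * u))" "2 \<le> q \<Longrightarrow> norm (conv s g x) \<le> (1 + sqrt (B / s)) * c"
proof -
  have [measurable]: "g \<in> borel_measurable borel" using g Lq_le_measurable by fastforce
  have c: "0 \<le> c" using assms Lq_le_nonneg by blast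
  have B0: "0 \<le> B" using B[of 0] k_nonneg[of 0] by linarith
  have "integrable P (\<lambda>u. g (x - s * u)) \<and> (2 \<le> q \<longrightarrow> norm (conv s g x) \<le> (1 + sqrt (B / s)) * c)"
    using \<open>1 \<le> q\<close>
  proof (cases rule: exponent_cases)
    case infinite
    have "AE y in lborel. norm (g y) \<le> c" using assms infinite by (simp add: Lq_le_top)
    then have *: "AE u in P. norm (g (x - s * u)) \<le> c"
      using s by (intro AE_P AE_lborel_affine) auto
    have "c \<le> (1 + sqrt (B / s)) * c" using c B0 s by (simp add: algebra_simps)
    then show ?thesis using conv_bounded[OF _ c *] by force
  next
    case (finite r)
    have "(\<integral>\<^sup>+u. ennreal (norm (g (x - s * u)) powr r) \<partial>P) = (\<integral>\<^sup>+u. ennreal (k u) * ennreal (norm (g (x - s * u)) powr r) \<partial>lborel)"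
      by (subst nn_integral_density) auto
    also have "\<dots> \<le> (\<integral>\<^sup>+u. ennreal B * ennreal (norm (g (x - s * u)) powr r) \<partial>lborel)"
      by (intro nn_integral_mono mult_right_mono ennreal_leI B) simp
    also have "\<dots> = ennreal B * (\<integral>\<^sup>+u. ennreal (norm (g (x - s * u)) powr r) \<partial>lborel)"
      by (rule nn_integral_cmult) simp
    also have "\<dots> = ennreal B * (ennreal (1 / s) * (\<integral>\<^sup>+u. ennreal (norm (g u) powr r) \<partial>lborel))"
      using s by (subst nn_integral_dilate[where f="\<lambda>u. ennreal (norm (g u) powr r)"]) auto
    also have "\<dots> \<le> ennreal B * (ennreal (1 / s) * ennreal (c powr r))"
      using finite g by (intro mult_left_mono) (auto simp: Lq_le_ennreal)
    also have "\<dots> = ennreal (((B / s) powr (1 / r) * c) powr r)"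
      using finite B0 s c by (simp add: powr_mult powr_powr ennreal_mult[symmetric])
    finally have *: "(\<integral>\<^sup>+u. ennreal (norm (g (x - s * u)) powr r) \<partial>P) \<le> ennreal (((B / s) powr (1 / r) * c) powr r)" .
    have nn: "0 \<le> (B / s) powr (1 / r) * c" using c by simp
    note cj = conv_jensen[OF _ finite(2) nn *]
    have "norm (conv s g x) \<le> (1 + sqrt (B / s)) * c" if "2 \<le> q"
    proof -
      have "ennreal 2 \<le> ennreal r" using that finite by simp
      then have r: "2 \<le> r" using finite by (simp only: ennreal_le_iff)
      have "(B / s) powr (1 / r) \<le> 1 + sqrt (B / s)"
      proof (cases "B / s \<le> 1")
        case True
        then have "(B / s) powr (1 / r) \<le> 1 powr (1 / r)" using B0 s r by (intro powr_mono2) auto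
        then show ?thesis using B0 s by (simp add: add_increasing2)
      next
        case False
        then have "(B / s) powr (1 / r) \<le> (B / s) powr (1 / 2)" using r by (intro powr_mono) (auto simp: field_simps)
        then show ?thesis using B0 s by (simp add: powr_half_sqrt)
      qed
      then show ?thesis using cj(2) c by (auto intro: order_trans mult_right_mono)
    qed
    then show ?thesis using cj by simp
  qed
  then show "integrable P (\<lambda>u. g (x - s * u))" "2 \<le> q \<Longrightarrow> norm (conv s g x) \<le> (1 + sqrt (B / s)) * c"
    by auto
qed

end

section \<open>The Fourier integral and the Plancherel bound\<close>

lemma norm_fourier_phase [simp]: "norm (exp (- \<i> * of_real x * of_real z)) = 1"
  "norm (exp (- (\<i> * of_real x * of_real z))) = 1"
  by (simp_all add: norm_exp_eq_Re)

lemma fourier_integrand: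
  "integrable lborel g \<Longrightarrow> integrable lborel (\<lambda>x. g x * exp (- \<i> * of_real x * of_real z))"
  by (rule Bochner_Integration.integrable_bound[of lborel g]) (auto simp: norm_mult)

lemma fourier_measurable [measurable]:
  assumes [measurable]: "g \<in> borel_measurable borel"
  shows "fourier_integral g \<in> borel_measurable borel"
  unfolding fourier_integral_def by measurable

lemma fourier_cong_AE:
  assumes [measurable]: "f \<in> borel_measurable borel" "g \<in> borel_measurable borel" and "AE x in lborel. f x = g x"
  shows "fourier_integral f z = fourier_integral g z"
  unfolding fourier_integral_def by (rule integral_cong_AE) (use assms(3) in auto)

lemma fourier_norm_le: "norm (fourier_integral g z) \<le> (\<integral>x. norm (g x) \<partial>lborel)"
proof -
  have "norm (fourier_integral g z) \<le> (\<integral>x. norm (g x * exp (- \<i> * of_real x * of_real z)) \<partial>lborel)"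
    unfolding fourier_integral_def by (rule integral_norm_bound)
  then show ?thesis by (simp add: norm_mult)
qed

lemma fourier_add:
  assumes "integrable lborel f" "integrable lborel g"
  shows "fourier_integral (\<lambda>x. f x + g x) z = fourier_integral f z + fourier_integral g z"
  using fourier_integrand[OF assms(1), of z] fourier_integrand[OF assms(2), of z]
  by (simp add: fourier_integral_def distrib_right)

lemma fourier_diff:
  assumes "integrable lborel f" "integrable lborel g"
  shows "fourier_integral (\<lambda>x. f x - g x) z = fourier_integral f z - fourier_integral g z"
  using fourier_integrand[OF assms(1), of z] fourier_integrand[OF assms(2), of z]
  by (simp add: fourier_integral_def left_diff_distrib)

lemma fourier_cmult: "fourier_integral (\<lambda>x. c * f x) z = c * fourier_integral f z"
  by (simp add: fourier_integral_def mult.assoc)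

lemma fourier_lipschitz:
  assumes g: "integrable lborel g" and xg: "integrable lborel (\<lambda>x. of_real x * g x)"
  shows "norm (fourier_integral g z - fourier_integral g w) \<le> \<bar>z - w\<bar> * (\<integral>x. norm (of_real x * g x) \<partial>lborel)"
proof -
  have "fourier_integral g z - fourier_integral g w
     = (\<integral>x. g x * (exp (- \<i> * of_real x * of_real z) - exp (- \<i> * of_real x * of_real w)) \<partial>lborel)"
    using fourier_integrand[OF g, of z] fourier_integrand[OF g, of w]
    by (simp add: fourier_integral_def right_diff_distrib)
  also have "norm \<dots> \<le> (\<integral>x. norm (g x * (exp (- \<i> * of_real x * of_real z) - exp (- \<i> * of_real x * of_real w))) \<partial>lborel)"
    by (rule integral_norm_bound)
  also have "\<dots> \<le> (\<integral>x. \<bar>z - w\<bar> * norm (of_real x * g x) \<partial>lborel)"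
  proof (rule integral_mono)
    show "integrable lborel (\<lambda>x. norm (g x * (exp (- \<i> * of_real x * of_real z) - exp (- \<i> * of_real x * of_real w))))"
      using fourier_integrand[OF g, of z] fourier_integrand[OF g, of w]
      by (intro integrable_norm) (simp add: right_diff_distrib)
    show "integrable lborel (\<lambda>x. \<bar>z - w\<bar> * norm (of_real x * g x))"
      using xg by auto
    fix x
    have "norm (exp (- \<i> * of_real x * of_real z) - exp (- \<i> * of_real x * of_real w)) \<le> \<bar>x * (z - w)\<bar>"
    proof -
      have "exp (- \<i> * of_real x * of_real z) - exp (- \<i> * of_real x * of_real w) = iexp (- x * w) * (iexp (- x * (z - w)) - 1)"
        by (simp add: right_diff_distrib exp_add[symmetric]) (simp add: algebra_simps)
      then show ?thesis
        using iexp_approx1[of "- x * (z - w)" 0] by (simp add: norm_mult)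
    qed
    then have "norm (g x) * norm (exp (- \<i> * of_real x * of_real z) - exp (- \<i> * of_real x * of_real w)) \<le> norm (g x) * \<bar>x * (z - w)\<bar>"
      by (rule mult_left_mono) simp
    then show "norm (g x * (exp (- \<i> * of_real x * of_real z) - exp (- \<i> * of_real x * of_real w))) \<le> \<bar>z - w\<bar> * norm (of_real x * g x)"
      by (simp add: norm_mult abs_mult mult_ac)
  qed
  also have "\<dots> = \<bar>z - w\<bar> * (\<integral>x. norm (of_real x * g x) \<partial>lborel)" by simp
  finally show ?thesis .
qed

lemma lborel_integral_translate:
  fixes f :: "real \<Rightarrow> complex"
  shows "(\<integral>x. f (x - t) \<partial>lborel) = (\<integral>x. f x \<partial>lborel)"
  using lborel_integral_real_affine[of 1 f "-t"] by simp

lemma lborel_integrable_translate: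
  fixes f :: "real \<Rightarrow> complex"
  shows "integrable lborel f \<Longrightarrow> integrable lborel (\<lambda>x. f (x - t))"
  using lborel_integrable_real_affine[of f 1 "-t"] by simp

text \<open>Fubini for a phase symmetric in x and z. In \<open>plancherel_weighted\<close> it is
  applied twice: to evaluate the transform of the weighted conjugate, and to move the pairing from
  the frequency side to g.\<close>

lemma fourier_multiplication:
  assumes a: "integrable lborel a" and b: "integrable lborel b"
  shows "(\<integral>z. fourier_integral a z * b z \<partial>lborel) = (\<integral>x. a x * fourier_integral b x \<partial>lborel)"
proof -
  have [measurable]: "a \<in> borel_measurable borel" "b \<in> borel_measurable borel"
    using a b by (auto dest: borel_measurable_integrable)
  let ?f = "\<lambda>x z. a x * b z * exp (- \<i> * of_real x * of_real z)"
  have i: "integrable (lborel \<Otimes>\<^sub>M lborel) (case_prod ?f)"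
  proof (rule lborel_pair.Fubini_integrable)
    show "integrable lborel (\<lambda>x. \<integral>z. norm (case_prod ?f (x, z)) \<partial>lborel)"
      using a b by (simp add: norm_mult)
    show "AE x in lborel. integrable lborel (\<lambda>z. case_prod ?f (x, z))"
      by (intro AE_I2 Bochner_Integration.integrable_bound[OF integrable_mult_right[OF b]]) (auto simp: norm_mult)
  qed simp
  have "(\<integral>z. fourier_integral a z * b z \<partial>lborel) = (\<integral>z. \<integral>x. ?f x z \<partial>lborel \<partial>lborel)"
    unfolding fourier_integral_def integral_mult_left_zero[symmetric] by (simp add: mult_ac)
  also have "\<dots> = (\<integral>x. \<integral>z. ?f x z \<partial>lborel \<partial>lborel)"
    by (rule lborel_pair.Fubini_integral[OF i])
  also have "\<dots> = (\<integral>x. a x * fourier_integral b x \<partial>lborel)"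
    unfolding fourier_integral_def integral_mult_right_zero[symmetric] by (simp add: mult_ac)
  finally show ?thesis .
qed

context density_kernel
begin

text \<open>Averaging the phase at x - s u over u produces the characteristic function inside the
  integral. Smoothing the transform thus acts on g by pointwise multiplication, so the support of a
  truncated function is preserved.\<close>

lemma conv_fourier:
  assumes g: "integrable lborel g"
  shows "conv s (fourier_integral g) x = fourier_integral (\<lambda>y. char P (s * y) * g y) x"
proof -
  interpret Q: pair_sigma_finite lborel P ..
  have [measurable]: "g \<in> borel_measurable borel"
    using g by (auto dest: borel_measurable_integrable)
  let ?f = "\<lambda>y u. g y * exp (- \<i> * of_real y * of_real (x - s * u))"
  have i: "integrable (lborel \<Otimes>\<^sub>M P) (case_prod ?f)"
  proof (rule Q.Fubini_integrable)
    show "integrable lborel (\<lambda>y. \<integral>u. norm (case_prod ?f (y, u)) \<partial>P)"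
      using g P.prob_space by (simp add: norm_mult norm_exp_eq_Re del: P.space_eq_univ)
    show "AE y in lborel. integrable P (\<lambda>u. case_prod ?f (y, u))"
    proof (rule AE_I2)
      fix y show "integrable P (\<lambda>u. case_prod ?f (y, u))"
        by (intro P.integrable_const_bound[of _ "norm (g y)"]) (auto simp: norm_mult norm_exp_eq_Re)
    qed
  qed measurable
  have "conv s (fourier_integral g) x = (\<integral>u. \<integral>y. ?f y u \<partial>lborel \<partial>P)"
    by (simp add: conv_def fourier_integral_def)
  also have "\<dots> = (\<integral>y. \<integral>u. ?f y u \<partial>P \<partial>lborel)"
    by (rule Q.Fubini_integral[OF i])
  also have "\<dots> = (\<integral>y. \<integral>u. (g y * exp (- \<i> * of_real y * of_real x)) * iexp ((s * y) * u) \<partial>P \<partial>lborel)"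
    by (intro Bochner_Integration.integral_cong refl) (simp add: algebra_simps exp_add[symmetric])
  also have "\<dots> = fourier_integral (\<lambda>y. char P (s * y) * g y) x"
    unfolding integral_mult_right_zero by (simp add: fourier_integral_def char_def mult_ac)
  finally show ?thesis .
qed

text \<open>The dual of \<open>conv_fourier\<close>: translating g by s u multiplies its transform
  by exp(-i s u z), whose mean over u is the characteristic function at - s z.\<close>

lemma
  assumes g: "integrable lborel g"
  shows conv_integrable: "integrable lborel (conv s g)"
    and fourier_conv: "fourier_integral (conv s g) z = char P (- s * z) * fourier_integral g z"
proof -
  interpret Q: pair_sigma_finite P lborel ..
  have [measurable]: "g \<in> borel_measurable borel"
    using g by (auto dest: borel_measurable_integrable)
  \<comment> \<open>A generic unimodular factor e serves both claims: e = 1 gives integrability of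
    the convolution, and the phase justifies Fubini for its transform.\<close>
  have *: "integrable (P \<Otimes>\<^sub>M lborel) (\<lambda>(u, x). g (x - s * u) * e x)"
    if [measurable]: "e \<in> borel_measurable borel" and e: "\<And>x. norm (e x) = 1" for e :: "real \<Rightarrow> complex"
  proof (rule Q.Fubini_integrable)
    have "(\<integral>x. norm (g (x - s * u)) \<partial>lborel) = (\<integral>x. norm (g x) \<partial>lborel)" for u
      using lborel_integral_real_affine[of 1 "\<lambda>x. norm (g x)" "- (s * u)"] by simp
    then show "integrable P (\<lambda>u. \<integral>x. norm (case (u, x) of (u, x) \<Rightarrow> g (x - s * u) * e x) \<partial>lborel)"
      by (simp add: norm_mult e)
    show "AE u in P. integrable lborel (\<lambda>x. case (u, x) of (u, x) \<Rightarrow> g (x - s * u) * e x)"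
      by (intro AE_I2 Bochner_Integration.integrable_bound[OF lborel_integrable_translate[OF g]]) (auto simp: norm_mult e)
  qed measurable
  show "integrable lborel (conv s g)"
    using Q.integrable_snd[of "\<lambda>u x. g (x - s * u) * 1"] *[of "\<lambda>_. 1"] by (simp add: conv_def[abs_def])
  let ?f = "\<lambda>u x. g (x - s * u) * exp (- \<i> * of_real x * of_real z)"
  have "fourier_integral (conv s g) z = (\<integral>x. \<integral>u. ?f u x \<partial>P \<partial>lborel)"
    by (simp add: conv_def fourier_integral_def)
  also have "\<dots> = (\<integral>u. \<integral>x. ?f u x \<partial>lborel \<partial>P)"
    by (rule Q.Fubini_integral, rule *) simp_all
  also have "\<dots> = (\<integral>u. \<integral>x. (\<lambda>x. g x * exp (- \<i> * of_real (x + s * u) * of_real z)) (x - s * u) \<partial>lborel \<partial>P)"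
    by simp
  also have "\<dots> = (\<integral>u. \<integral>x. g x * exp (- \<i> * of_real (x + s * u) * of_real z) \<partial>lborel \<partial>P)"
    by (subst lborel_integral_translate) simp
  also have "\<dots> = (\<integral>u. \<integral>x. iexp ((- s * z) * u) * (g x * exp (- \<i> * of_real x * of_real z)) \<partial>lborel \<partial>P)"
    by (intro Bochner_Integration.integral_cong refl) (simp add: algebra_simps exp_add[symmetric])
  also have "\<dots> = char P (- s * z) * fourier_integral g z"
    unfolding integral_mult_right_zero integral_mult_left_zero by (simp add: fourier_integral_def char_def)
  finally show "fourier_integral (conv s g) z = char P (- s * z) * fourier_integral g z" .
qed

end

section \<open>Gaussian weights and the Plancherel inequality\<close>

interpretation gauss: density_kernel std_normal_density
proof
  have "emeasure std_normal_distribution (space std_normal_distribution) = 1"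
    by (rule prob_space.emeasure_space_1[OF prob_space_normal_density]) simp
  then show "(\<integral>\<^sup>+u. ennreal (std_normal_density u) \<partial>lborel) = 1"
    by (simp add: emeasure_density)
qed simp_all

lemma fourier_gaussian:
  assumes n: "0 < n"
  shows "integrable lborel (\<lambda>z. of_real (exp (- (z / n)\<^sup>2 / 2)) :: complex)"
    and "fourier_integral (\<lambda>z. of_real (exp (- (z / n)\<^sup>2 / 2))) y = of_real (n * sqrt (2 * pi)) * of_real (exp (- (n * y)\<^sup>2 / 2))"
proof -
  let ?w = "\<lambda>z. complex_of_real (exp (- (z / n)\<^sup>2 / 2))"
  have w: "?w z = of_real (sqrt (2 * pi)) * of_real (std_normal_density (0 + (1/n) * z))" for z
    by (simp add: std_normal_density_def)
  have "integrable lborel (\<lambda>z. std_normal_density (0 + (1 / n) * z))"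
    using n by (intro lborel_integrable_real_affine) auto
  then show "integrable lborel ?w" unfolding w by (intro integrable_mult_right) auto
  have "fourier_integral ?w y = of_real n * (\<integral>u. ?w (n * u) * exp (- \<i> * of_real (n * u) * of_real y) \<partial>lborel)"
    unfolding fourier_integral_def
    using n by (subst lborel_integral_real_affine[of n _ 0]) (auto simp: scaleR_conv_of_real)
  also have "(\<integral>u. ?w (n * u) * exp (- \<i> * of_real (n * u) * of_real y) \<partial>lborel)
     = (\<integral>u. of_real (sqrt (2 * pi)) * (std_normal_density u *\<^sub>R iexp ((- n * y) * u)) \<partial>lborel)"
    using n by (intro Bochner_Integration.integral_cong refl) (simp add: std_normal_density_def scaleR_conv_of_real algebra_simps)
  also have "\<dots> = of_real (sqrt (2 * pi)) * (\<integral>u. std_normal_density u *\<^sub>R iexp ((- n * y) * u) \<partial>lborel)"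
    by (rule integral_mult_right_zero)
  also have "(\<integral>u. std_normal_density u *\<^sub>R iexp ((- n * y) * u) \<partial>lborel) = char std_normal_distribution (- n * y)"
    unfolding char_def by (subst integral_density) auto
  finally show "fourier_integral ?w y = of_real (n * sqrt (2 * pi)) * of_real (exp (- (n * y)\<^sup>2 / 2))"
    by (simp add: char_std_normal_distribution)
qed

(* The Gaussian weight turns |Fg|^2 into the pairing of g with a Gaussian mean of g. *)
lemma plancherel_weighted:
  assumes g: "integrable lborel g" and n: "0 < n"
  shows "(\<integral>\<^sup>+z. ennreal ((norm (fourier_integral g z))\<^sup>2 * exp (- (z / n)\<^sup>2 / 2)) \<partial>lborel)
     \<le> ennreal (2 * pi) * (\<integral>\<^sup>+x. ennreal ((norm (g x))\<^sup>2) \<partial>lborel)"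
proof (cases "\<integral>\<^sup>+x. ennreal ((norm (g x))\<^sup>2) \<partial>lborel")
  case top
  then show ?thesis by (simp add: ennreal_mult_top)
next
  case (real j)
  have [measurable]: "g \<in> borel_measurable borel"
    using g by (auto dest: borel_measurable_integrable)
  define w :: "real \<Rightarrow> complex" where "w = (\<lambda>z. of_real (exp (- (z / n)\<^sup>2 / 2)))"
  have [measurable]: "cnj \<in> borel_measurable borel"
    by (intro borel_measurable_continuous_onI continuous_intros)
  have w: "integrable lborel w" using fourier_gaussian(1)[OF n] by (simp add: w_def)
  have [measurable]: "w \<in> borel_measurable borel" unfolding w_def by measurable
  have Fw: "fourier_integral w y = of_real (n * sqrt (2 * pi)) * of_real (exp (- (n * y)\<^sup>2 / 2))" for y
    using fourier_gaussian(2)[OF n] by (simp add: w_def)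
  \<comment> \<open>The product of the transform of g with b is the weighted square of its modulus,
    so the multiplication formula turns the integral to be bounded into a pairing of g with the
    transform of b.\<close>
  define b where "b = (\<lambda>z. cnj (fourier_integral g z) * w z)"
  have b: "integrable lborel b"
  proof (rule Bochner_Integration.integrable_bound)
    show "integrable lborel (\<lambda>z. of_real (\<integral>x. norm (g x) \<partial>lborel) * w z)" using w by simp
    show "AE z in lborel. norm (b z) \<le> norm (of_real (\<integral>x. norm (g x) \<partial>lborel) * w z)"
      using fourier_norm_le[of g] by (intro AE_I2) (simp add: b_def norm_mult mult_right_mono)
  qed (simp add: b_def)
  \<comment> \<open>The weight of width n has a Gaussian transform of width 1/n and total mass 2 pi,
    so the transform of b is 2 pi times a conjugated Gaussian mean of g at scale 1/n.\<close>
  have Fb: "fourier_integral b x = 2 * pi * cnj (gauss.conv (1 / n) g x)" for x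
  proof -
    have "cnj (fourier_integral b x) = (\<integral>z. fourier_integral g z * exp (\<i> * of_real x * of_real z) * w z \<partial>lborel)"
    proof -
      have "cnj (fourier_integral b x) = (\<integral>z. cnj (b z * exp (- \<i> * of_real z * of_real x)) \<partial>lborel)"
        unfolding fourier_integral_def[of b] by (rule Bochner_Integration.integral_cnj[symmetric])
      also have "\<dots> = (\<integral>z. fourier_integral g z * exp (\<i> * of_real x * of_real z) * w z \<partial>lborel)"
        by (intro Bochner_Integration.integral_cong refl) (simp add: b_def w_def exp_cnj mult_ac)
      finally show ?thesis .
    qed
    also have "\<dots> = (\<integral>z. fourier_integral (\<lambda>y. g (y - (- x))) z * w z \<partial>lborel)"
    proof (intro Bochner_Integration.integral_cong refl arg_cong2[where f="(*)"])
      fix z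
      have "fourier_integral (\<lambda>y. g (y - (- x))) z = (\<integral>y. (\<lambda>y. g y * exp (- \<i> * of_real (y - x) * of_real z)) (y - (- x)) \<partial>lborel)"
        by (simp add: fourier_integral_def)
      also have "\<dots> = (\<integral>y. (g y * exp (- \<i> * of_real y * of_real z)) * exp (\<i> * of_real x * of_real z) \<partial>lborel)"
        by (rule trans[OF lborel_integral_translate[where t="-x"]], intro Bochner_Integration.integral_cong refl) (simp add: algebra_simps exp_add[symmetric])
      finally show "fourier_integral g z * exp (\<i> * of_real x * of_real z) = fourier_integral (\<lambda>y. g (y - (- x))) z"
        by (simp add: fourier_integral_def)
    qed
    also have "\<dots> = (\<integral>y. g (y - (- x)) * fourier_integral w y \<partial>lborel)"
      by (rule fourier_multiplication[OF lborel_integrable_translate[OF g] w])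
    also have "\<dots> = of_real (1 / n) * (\<integral>u. g (x - (1 / n) * u) * fourier_integral w (- (1 / n) * u) \<partial>lborel)"
      using n by (subst lborel_integral_real_affine[of "- (1 / n)" _ 0]) (auto simp: scaleR_conv_of_real algebra_simps)
    also have "\<dots> = of_real (1 / n) * (\<integral>u. of_real (n * (2 * pi)) * (std_normal_density u *\<^sub>R g (x - (1 / n) * u)) \<partial>lborel)"
    proof -
      have "fourier_integral w (- (1 / n) * u) = of_real (n * (2 * pi) * std_normal_density u)" for u
      proof -
        have "n * sqrt (2 * pi) * exp (- (n * (- (1 / n) * u))\<^sup>2 / 2) = n * (2 * pi) * std_normal_density u"
          using n real_sqrt_mult_self[of "2 * pi"] by (simp add: std_normal_density_def field_simps)
        then show ?thesis unfolding Fw by (metis of_real_mult)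
      qed
      then have "g (x - (1 / n) * u) * fourier_integral w (- (1 / n) * u)
        = of_real (n * (2 * pi)) * (std_normal_density u *\<^sub>R g (x - (1 / n) * u))" for u
        by (simp only: scaleR_conv_of_real of_real_mult mult_ac)
      then show ?thesis by presburger
    qed
    also have "\<dots> = 2 * pi * gauss.conv (1 / n) g x"
      unfolding gauss.conv_def integral_mult_right_zero using n by (subst integral_density) auto
    finally show ?thesis by (metis complex_cnj_cnj complex_cnj_mult complex_cnj_complex_of_real complex_cnj_numeral)
  qed
  have i: "integrable lborel (\<lambda>z. (norm (fourier_integral g z))\<^sup>2 * exp (- (z / n)\<^sup>2 / 2))"
  proof (rule Bochner_Integration.integrable_bound)
    show "integrable lborel (\<lambda>z. of_real ((\<integral>x. norm (g x) \<partial>lborel)\<^sup>2) * w z)" using w by simp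
    show "AE z in lborel. norm ((norm (fourier_integral g z))\<^sup>2 * exp (- (z / n)\<^sup>2 / 2)) \<le> norm (of_real ((\<integral>x. norm (g x) \<partial>lborel)\<^sup>2) * w z)"
      using fourier_norm_le[of g] by (intro AE_I2) (simp add: w_def norm_mult norm_power power_mono)
  qed simp
  have eq: "of_real ((norm (fourier_integral g z))\<^sup>2 * exp (- (z / n)\<^sup>2 / 2)) = fourier_integral g z * b z" for z
    unfolding b_def w_def by (simp add: mult.assoc[symmetric] complex_norm_square[symmetric])
  have "(\<integral>\<^sup>+z. ennreal ((norm (fourier_integral g z))\<^sup>2 * exp (- (z / n)\<^sup>2 / 2)) \<partial>lborel)
     = ennreal (\<integral>z. (norm (fourier_integral g z))\<^sup>2 * exp (- (z / n)\<^sup>2 / 2) \<partial>lborel)"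
    by (rule nn_integral_eq_integral[OF i]) simp
  also have "(\<integral>z. (norm (fourier_integral g z))\<^sup>2 * exp (- (z / n)\<^sup>2 / 2) \<partial>lborel)
     = norm (complex_of_real (\<integral>z. (norm (fourier_integral g z))\<^sup>2 * exp (- (z / n)\<^sup>2 / 2) \<partial>lborel))"
    by (simp add: abs_of_nonneg)
  also have "\<dots> = norm (\<integral>z. fourier_integral g z * b z \<partial>lborel)"
    unfolding integral_complex_of_real[symmetric] eq ..
  also have "\<dots> = norm (\<integral>x. g x * fourier_integral b x \<partial>lborel)"
    unfolding fourier_multiplication[OF g b] ..
  also have "ennreal \<dots> \<le> (\<integral>\<^sup>+x. ennreal (norm (g x * fourier_integral b x)) \<partial>lborel)"
  \<comment> \<open>If the product were not integrable, its Bochner integral would be 0 by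
    convention and the estimate would hold trivially.\<close>
  proof (cases "integrable lborel (\<lambda>x. g x * fourier_integral b x)")
    case False
    then show ?thesis unfolding not_integrable_integral_eq[OF False] by simp
  qed (rule integral_norm_bound_ennreal)
  \<comment> \<open>The elementary 2 a b \<le> a^2 + b^2 stands in for Cauchy-Schwarz. As the
    Gaussian mean is an L^2 contraction, both squares have integral at most j, and pi (j + j) is the
    asserted bound.\<close>
  also have "\<dots> \<le> (\<integral>\<^sup>+x. ennreal pi * (ennreal ((norm (g x))\<^sup>2) + ennreal ((norm (gauss.conv (1 / n) g x))\<^sup>2)) \<partial>lborel)"
  proof (rule nn_integral_mono)
    fix x
    have "2 * (norm (g x) * norm (gauss.conv (1 / n) g x)) \<le> (norm (g x))\<^sup>2 + (norm (gauss.conv (1 / n) g x))\<^sup>2"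
      using sum_squares_bound[of "norm (g x)" "norm (gauss.conv (1 / n) g x)"] by simp
    then have "pi * (2 * (norm (g x) * norm (gauss.conv (1 / n) g x))) \<le> pi * ((norm (g x))\<^sup>2 + (norm (gauss.conv (1 / n) g x))\<^sup>2)"
      by (intro mult_left_mono) auto
    then show "ennreal (norm (g x * fourier_integral b x)) \<le> ennreal pi * (ennreal ((norm (g x))\<^sup>2) + ennreal ((norm (gauss.conv (1 / n) g x))\<^sup>2))"
      by (simp add: Fb norm_mult ennreal_plus[symmetric] ennreal_mult[symmetric] mult_ac del: ennreal_plus)
  qed
  also have "\<dots> = ennreal pi * ((\<integral>\<^sup>+x. ennreal ((norm (g x))\<^sup>2) \<partial>lborel) + (\<integral>\<^sup>+x. ennreal ((norm (gauss.conv (1 / n) g x))\<^sup>2) \<partial>lborel))"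
    by (simp add: nn_integral_cmult nn_integral_add)
  also have "\<dots> \<le> ennreal pi * (ennreal j + ennreal j)"
  proof -
    have "Lq_le (ennreal 2) lborel g (sqrt j)"
      using real by (simp add: Lq_le_ennreal del: ennreal_numeral)
    then have "Lq_le (ennreal 2) lborel (gauss.conv (1 / n) g) (sqrt j)"
      by (intro gauss.conv_contraction) auto
    then have "(\<integral>\<^sup>+x. ennreal ((norm (gauss.conv (1 / n) g x))\<^sup>2) \<partial>lborel) \<le> ennreal j"
      using real by (simp add: Lq_le_ennreal del: ennreal_numeral)
    then show ?thesis using real by (intro mult_left_mono add_mono) auto
  qed
  also have "\<dots> = ennreal (2 * pi) * ennreal j"
    using real by (simp add: ennreal_plus[symmetric] ennreal_mult[symmetric] del: ennreal_plus)
  finally show ?thesis using real by simp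
qed

text \<open>Let the Gaussian weight widen. Fatou's lemma suffices because only an upper bound is
  sought.\<close>

lemma plancherel_le:
  assumes g: "integrable lborel g"
  shows "(\<integral>\<^sup>+z. ennreal ((norm (fourier_integral g z))\<^sup>2) \<partial>lborel)
     \<le> ennreal (2 * pi) * (\<integral>\<^sup>+x. ennreal ((norm (g x))\<^sup>2) \<partial>lborel)"
proof -
  have [measurable]: "g \<in> borel_measurable borel"
    using g by (auto dest: borel_measurable_integrable)
  let ?h = "\<lambda>m z. ennreal ((norm (fourier_integral g z))\<^sup>2 * exp (- (z / real (Suc m))\<^sup>2 / 2))"
  have "(\<integral>\<^sup>+z. ennreal ((norm (fourier_integral g z))\<^sup>2) \<partial>lborel) = (\<integral>\<^sup>+z. liminf (\<lambda>m. ?h m z) \<partial>lborel)"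
  proof (rule nn_integral_cong)
    fix z
    have "(\<lambda>m. z * inverse (real (Suc m))) \<longlonglongrightarrow> z * 0"
      by (intro tendsto_mult tendsto_const LIMSEQ_inverse_real_of_nat)
    then have "(\<lambda>m. z / real (Suc m)) \<longlonglongrightarrow> 0" by (simp add: divide_inverse)
    then have "(\<lambda>m. (norm (fourier_integral g z))\<^sup>2 * exp (- (z / real (Suc m))\<^sup>2 / 2)) \<longlonglongrightarrow> (norm (fourier_integral g z))\<^sup>2 * exp (- 0\<^sup>2 / 2)"
      by (intro tendsto_intros) auto
    then have "(\<lambda>m. ?h m z) \<longlonglongrightarrow> ennreal ((norm (fourier_integral g z))\<^sup>2)" by (intro tendsto_ennrealI) simp
    then show "ennreal ((norm (fourier_integral g z))\<^sup>2) = liminf (\<lambda>m. ?h m z)"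
      by (intro lim_imp_Liminf[symmetric]) auto
  qed
  also have "\<dots> \<le> liminf (\<lambda>m. \<integral>\<^sup>+z. ?h m z \<partial>lborel)"
    by (rule nn_integral_liminf) measurable
  also have "\<dots> \<le> liminf (\<lambda>m. ennreal (2 * pi) * (\<integral>\<^sup>+x. ennreal ((norm (g x))\<^sup>2) \<partial>lborel))"
    by (intro Liminf_mono always_eventually allI plancherel_weighted[OF g]) simp
  also have "\<dots> = ennreal (2 * pi) * (\<integral>\<^sup>+x. ennreal ((norm (g x))\<^sup>2) \<partial>lborel)"
    by (rule Liminf_const) simp
  finally show ?thesis .
qed

section \<open>The Hausdorff--Young inequality\<close>

text \<open>The layer-cake formula for a single height. It is used with \<alpha> = q to unfold the
  modulus of the transform, and with \<alpha> = q - 2 to fold the threshold 2 N |g|^(1-p) back into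
  a power of |g|.\<close>

lemma nn_integral_powr_le:
  fixes a \<alpha> :: real
  assumes "0 < \<alpha>" "0 \<le> a"
  shows "(\<integral>\<^sup>+l. ennreal (if 0 \<le> l \<and> l \<le> a then l powr (\<alpha> - 1) else 0) \<partial>lborel) = ennreal (a powr \<alpha> / \<alpha>)"
proof -
  have "((\<lambda>l. l powr (\<alpha> - 1)) has_integral (a powr (\<alpha> - 1 + 1) / (\<alpha> - 1 + 1))) {0..a}"
    using assms by (intro has_integral_powr_from_0) auto
  then have "(\<integral>\<^sup>+l. ennreal (indicator {0..a} l * l powr (\<alpha> - 1)) \<partial>lborel) = ennreal (a powr \<alpha> / \<alpha>)"
    using nn_integral_has_integral_lebesgue[of "{0..a}" "\<lambda>l. l powr (\<alpha> - 1)"] by simp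
  moreover have "indicator {0..a} l * l powr (\<alpha> - 1) = (if 0 \<le> l \<and> l \<le> a then l powr (\<alpha> - 1) else 0)" for l
    by (simp add: indicator_def)
  ultimately show ?thesis by simp
qed

(* Splitting g at the height where |g|^(1-p) = l / (2N) makes the large part contribute at most l/2 to the
   transform uniformly, so the superlevel set is controlled by the Plancherel bound for the small part. *)
lemma fourier_weak_bound:
  assumes g: "integrable lborel g" and p: "1 < p" and N: "0 < N"
    and le: "(\<integral>\<^sup>+x. ennreal (norm (g x) powr p) \<partial>lborel) \<le> ennreal N" and l: "0 < l"
  shows "(\<integral>\<^sup>+z. ennreal (if l \<le> norm (fourier_integral g z) then l\<^sup>2 else 0) \<partial>lborel)
     \<le> ennreal (8 * pi) * (\<integral>\<^sup>+x. ennreal (if l \<le> 2 * N * norm (g x) powr (1 - p) then (norm (g x))\<^sup>2 else 0) \<partial>lborel)"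
proof -
  have [measurable]: "g \<in> borel_measurable borel"
    using g by (auto dest: borel_measurable_integrable)
  define S where "S = (\<lambda>x. l \<le> 2 * N * norm (g x) powr (1 - p))"
  have [measurable]: "Measurable.pred borel S" unfolding S_def by measurable
  define a where "a = (\<lambda>x. if S x then g x else 0)"
  define b where "b = (\<lambda>x. if S x then 0 else g x)"
  have a: "integrable lborel a" and b: "integrable lborel b"
    by (rule Bochner_Integration.integrable_bound[OF g]; simp add: a_def b_def)+
  \<comment> \<open>Where \<open>S\<close> fails and g is nonzero, |g| = |g|^(1-p) |g|^p \<le>
    l/(2N) |g|^p. Zeros of g belong to b, since \<open>0 powr (1 - p)\<close> is 0 and l is
    positive.\<close>
  have "(\<integral>\<^sup>+x. ennreal (norm (b x)) \<partial>lborel) \<le> (\<integral>\<^sup>+x. ennreal (l / (2 * N)) * ennreal (norm (g x) powr p) \<partial>lborel)"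
  proof (rule nn_integral_mono)
    fix x
    have "norm (b x) \<le> l / (2 * N) * norm (g x) powr p"
    proof (cases "S x \<or> g x = 0")
      case True then show ?thesis using l N by (auto simp: b_def)
    next
      case False
      then have "norm (g x) powr (1 - p) \<le> l / (2 * N)" using N by (simp add: S_def field_simps)
      then have "norm (g x) powr (1 - p) * norm (g x) powr p \<le> l / (2 * N) * norm (g x) powr p"
        by (rule mult_right_mono) simp
      then show ?thesis using False by (simp add: b_def powr_add[symmetric])
    qed
    then show "ennreal (norm (b x)) \<le> ennreal (l / (2 * N)) * ennreal (norm (g x) powr p)"
      using l N by (simp add: ennreal_mult[symmetric])
  qed
  also have "\<dots> = ennreal (l / (2 * N)) * (\<integral>\<^sup>+x. ennreal (norm (g x) powr p) \<partial>lborel)"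
    by (rule nn_integral_cmult) simp
  also have "\<dots> \<le> ennreal (l / (2 * N)) * ennreal N" by (intro mult_left_mono le) simp
  also have "\<dots> = ennreal (l / 2)" using l N by (simp add: ennreal_mult[symmetric])
  finally have "(\<integral>x. norm (b x) \<partial>lborel) \<le> l / 2"
    using b l by (subst (asm) nn_integral_eq_integral) (auto intro: integrable_norm)
  then have Fb: "norm (fourier_integral b z) \<le> l / 2" for z
    using fourier_norm_le[of b z] by linarith
  \<comment> \<open>On the superlevel set the transform of a has modulus at least l/2. This costs a
    factor 4 which, with the 2 pi from Plancherel, makes 8 pi.\<close>
  have "(\<integral>\<^sup>+z. ennreal (if l \<le> norm (fourier_integral g z) then l\<^sup>2 else 0) \<partial>lborel)
     \<le> (\<integral>\<^sup>+z. ennreal 4 * ennreal ((norm (fourier_integral a z))\<^sup>2) \<partial>lborel)"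
  proof (rule nn_integral_mono)
    fix z
    have "fourier_integral g z = fourier_integral a z + fourier_integral b z"
    proof -
      have "g = (\<lambda>x. a x + b x)" by (auto simp: a_def b_def)
      then show ?thesis using fourier_add[OF a b] by metis
    qed
    then have *: "norm (fourier_integral g z) \<le> norm (fourier_integral a z) + l / 2"
      using Fb[of z] norm_triangle_ineq[of "fourier_integral a z" "fourier_integral b z"] by simp
    have "(if l \<le> norm (fourier_integral g z) then l\<^sup>2 else 0) \<le> 4 * (norm (fourier_integral a z))\<^sup>2"
    proof (cases "l \<le> norm (fourier_integral g z)")
      case True
      then have "l \<le> 2 * norm (fourier_integral a z)" using * by linarith
      then have "l\<^sup>2 \<le> (2 * norm (fourier_integral a z))\<^sup>2" using l by (intro power_mono) auto
      then show ?thesis by (simp add: power_mult_distrib)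
    qed simp
    then show "ennreal (if l \<le> norm (fourier_integral g z) then l\<^sup>2 else 0) \<le> ennreal 4 * ennreal ((norm (fourier_integral a z))\<^sup>2)"
      by (subst ennreal_mult[symmetric]) (auto intro!: ennreal_leI)
  qed
  also have "\<dots> = ennreal 4 * (\<integral>\<^sup>+z. ennreal ((norm (fourier_integral a z))\<^sup>2) \<partial>lborel)"
    by (rule nn_integral_cmult) (simp add: a_def)
  also have "\<dots> \<le> ennreal 4 * (ennreal (2 * pi) * (\<integral>\<^sup>+x. ennreal ((norm (a x))\<^sup>2) \<partial>lborel))"
    by (intro mult_left_mono plancherel_le a) simp
  also have "\<dots> = ennreal (8 * pi) * (\<integral>\<^sup>+x. ennreal ((norm (a x))\<^sup>2) \<partial>lborel)"
    by (simp only: mult.assoc[symmetric]) (subst ennreal_mult[symmetric], auto)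
  also have "(\<integral>\<^sup>+x. ennreal ((norm (a x))\<^sup>2) \<partial>lborel) = (\<integral>\<^sup>+x. ennreal (if S x then (norm (g x))\<^sup>2 else 0) \<partial>lborel)"
    by (intro nn_integral_cong) (simp add: a_def)
  finally show ?thesis by (simp only: S_def)
qed

text \<open>Apply \<open>fourier_weak_bound\<close> at every height l and exchange the integrals.
  Splitting l^(q-1) = l^(q-3) l^2 leaves the integral of l^(q-3) from 0 to 2 N |g|^(1-p), which
  converges because p < 2 means q > 2. The resulting power of |g| is 2 + (1-p)(q-2), equal to p
  exactly for the conjugate exponent.\<close>

lemma hausdorff_young_strict:
  assumes g: "integrable lborel g" and p: "1 < p" "p < 2" and q: "q = p / (p - 1)" and N: "0 < N"
    and le: "(\<integral>\<^sup>+x. ennreal (norm (g x) powr p) \<partial>lborel) \<le> ennreal N"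
  shows "(\<integral>\<^sup>+z. ennreal (norm (fourier_integral g z) powr q) \<partial>lborel)
     \<le> ennreal (8 * pi * q * 2 powr (q - 2) / (q - 2) * N powr (q - 1))"
proof -
  have [measurable]: "g \<in> borel_measurable borel"
    using g by (auto dest: borel_measurable_integrable)
  have q2: "2 < q" using p unfolding q by (simp add: field_simps)
  have expo: "2 + (1 - p) * (q - 2) = p"
    using p unfolding q by (simp add: field_simps)
  let ?F = "\<lambda>z. norm (fourier_integral g z)"
  have "(\<integral>\<^sup>+z. ennreal (?F z powr q) \<partial>lborel)
     = (\<integral>\<^sup>+z. ennreal q * (\<integral>\<^sup>+l. ennreal (if 0 \<le> l \<and> l \<le> ?F z then l powr (q - 1) else 0) \<partial>lborel) \<partial>lborel)"
    using q2 by (intro nn_integral_cong, subst nn_integral_powr_le) (auto simp: ennreal_mult[symmetric])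
  also have "\<dots> = ennreal q * (\<integral>\<^sup>+z. (\<integral>\<^sup>+l. ennreal (if 0 \<le> l \<and> l \<le> ?F z then l powr (q - 1) else 0) \<partial>lborel) \<partial>lborel)"
    by (rule nn_integral_cmult) measurable
  finally have layers: "(\<integral>\<^sup>+z. ennreal (?F z powr q) \<partial>lborel)
     = ennreal q * (\<integral>\<^sup>+z. (\<integral>\<^sup>+l. ennreal (if 0 \<le> l \<and> l \<le> ?F z then l powr (q - 1) else 0) \<partial>lborel) \<partial>lborel)" .
  have "(\<integral>\<^sup>+z. (\<integral>\<^sup>+l. ennreal (if 0 \<le> l \<and> l \<le> ?F z then l powr (q - 1) else 0) \<partial>lborel) \<partial>lborel)
     = (\<integral>\<^sup>+l. (\<integral>\<^sup>+z. ennreal (if 0 \<le> l \<and> l \<le> ?F z then l powr (q - 1) else 0) \<partial>lborel) \<partial>lborel)"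
    by (rule lborel_pair.Fubini'[symmetric]) measurable
  also have "\<dots> \<le> (\<integral>\<^sup>+l. (\<integral>\<^sup>+x. ennreal (8 * pi) * ennreal ((norm (g x))\<^sup>2 * (if 0 \<le> l \<and> l \<le> 2 * N * norm (g x) powr (1 - p) then l powr (q - 2 - 1) else 0)) \<partial>lborel) \<partial>lborel)"
  proof (rule nn_integral_mono)
    fix l :: real
    show "(\<integral>\<^sup>+z. ennreal (if 0 \<le> l \<and> l \<le> ?F z then l powr (q - 1) else 0) \<partial>lborel)
       \<le> (\<integral>\<^sup>+x. ennreal (8 * pi) * ennreal ((norm (g x))\<^sup>2 * (if 0 \<le> l \<and> l \<le> 2 * N * norm (g x) powr (1 - p) then l powr (q - 2 - 1) else 0)) \<partial>lborel)"
    proof (cases "0 < l")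
      case True
      have "(\<integral>\<^sup>+z. ennreal (if 0 \<le> l \<and> l \<le> ?F z then l powr (q - 1) else 0) \<partial>lborel)
        = (\<integral>\<^sup>+z. ennreal (l powr (q - 2 - 1)) * ennreal (if l \<le> ?F z then l\<^sup>2 else 0) \<partial>lborel)"
      proof (intro nn_integral_cong)
        have "l powr (q - 2 - 1) * l\<^sup>2 = l powr (q - 1)"
          using True powr_add[of l "q - 2 - 1" 2] by simp
        then show "ennreal (if 0 \<le> l \<and> l \<le> ?F z then l powr (q - 1) else 0) = ennreal (l powr (q - 2 - 1)) * ennreal (if l \<le> ?F z then l\<^sup>2 else 0)" for z
          using True by (simp add: ennreal_mult[symmetric])
      qed
      also have "\<dots> = ennreal (l powr (q - 2 - 1)) * (\<integral>\<^sup>+z. ennreal (if l \<le> ?F z then l\<^sup>2 else 0) \<partial>lborel)"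
        by (rule nn_integral_cmult) measurable
      also have "\<dots> \<le> ennreal (l powr (q - 2 - 1)) * (ennreal (8 * pi) * (\<integral>\<^sup>+x. ennreal (if l \<le> 2 * N * norm (g x) powr (1 - p) then (norm (g x))\<^sup>2 else 0) \<partial>lborel))"
        by (intro mult_left_mono fourier_weak_bound[OF g p(1) N le True]) simp
      also have "\<dots> = (\<integral>\<^sup>+x. ennreal (l powr (q - 2 - 1)) * (ennreal (8 * pi) * ennreal (if l \<le> 2 * N * norm (g x) powr (1 - p) then (norm (g x))\<^sup>2 else 0)) \<partial>lborel)"
        by (simp add: nn_integral_cmult)
      also have "\<dots> = (\<integral>\<^sup>+x. ennreal (8 * pi) * ennreal ((norm (g x))\<^sup>2 * (if 0 \<le> l \<and> l \<le> 2 * N * norm (g x) powr (1 - p) then l powr (q - 2 - 1) else 0)) \<partial>lborel)"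
        using True by (intro nn_integral_cong) (auto simp: ennreal_mult[symmetric])
      finally show ?thesis by simp
    next
      case False
      then have "(if 0 \<le> l \<and> l \<le> ?F z then l powr (q - 1) else 0) = 0" for z by auto
      then show ?thesis by simp
    qed
  qed
  also have "\<dots> = (\<integral>\<^sup>+x. (\<integral>\<^sup>+l. ennreal (8 * pi) * ennreal ((norm (g x))\<^sup>2 * (if 0 \<le> l \<and> l \<le> 2 * N * norm (g x) powr (1 - p) then l powr (q - 2 - 1) else 0)) \<partial>lborel) \<partial>lborel)"
    by (rule lborel_pair.Fubini') measurable
  also have "\<dots> = (\<integral>\<^sup>+x. ennreal (8 * pi * (2 * N) powr (q - 2) / (q - 2)) * ennreal (norm (g x) powr p) \<partial>lborel)"
  proof (rule nn_integral_cong)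
    fix x
    let ?a = "2 * N * norm (g x) powr (1 - p)"
    have "(\<integral>\<^sup>+l. ennreal (8 * pi) * ennreal ((norm (g x))\<^sup>2 * (if 0 \<le> l \<and> l \<le> ?a then l powr (q - 2 - 1) else 0)) \<partial>lborel)
       = (\<integral>\<^sup>+l. ennreal (8 * pi * (norm (g x))\<^sup>2) * ennreal (if 0 \<le> l \<and> l \<le> ?a then l powr (q - 2 - 1) else 0) \<partial>lborel)"
      by (intro nn_integral_cong) (auto simp: ennreal_mult[symmetric])
    also have "\<dots> = ennreal (8 * pi * (norm (g x))\<^sup>2) * (\<integral>\<^sup>+l. ennreal (if 0 \<le> l \<and> l \<le> ?a then l powr (q - 2 - 1) else 0) \<partial>lborel)"
      by (rule nn_integral_cmult) measurable
    also have "\<dots> = ennreal (8 * pi * (norm (g x))\<^sup>2) * ennreal (?a powr (q - 2) / (q - 2))"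
      using q2 N by (subst nn_integral_powr_le) auto
    also have "\<dots> = ennreal (8 * pi * (norm (g x))\<^sup>2 * (?a powr (q - 2) / (q - 2)))"
      using q2 by (intro ennreal_mult[symmetric]) auto
    also have "8 * pi * (norm (g x))\<^sup>2 * (?a powr (q - 2) / (q - 2)) = 8 * pi * (2 * N) powr (q - 2) / (q - 2) * norm (g x) powr p"
    proof (cases "g x = 0")
      case False
      have "?a powr (q - 2) = (2 * N) powr (q - 2) * norm (g x) powr ((1 - p) * (q - 2))"
        using N by (subst powr_mult) (auto simp: powr_powr)
      then have "8 * pi * (norm (g x))\<^sup>2 * (?a powr (q - 2) / (q - 2))
          = 8 * pi * (2 * N) powr (q - 2) / (q - 2) * ((norm (g x))\<^sup>2 * norm (g x) powr ((1 - p) * (q - 2)))"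
        by (simp only: times_divide_eq_right times_divide_eq_left mult_ac)
      also have "(norm (g x))\<^sup>2 * norm (g x) powr ((1 - p) * (q - 2)) = norm (g x) powr (2 + (1 - p) * (q - 2))"
        using False by (simp add: powr_add)
      finally show ?thesis by (simp only: expo)
    qed (use p in simp)
    finally show "(\<integral>\<^sup>+l. ennreal (8 * pi) * ennreal ((norm (g x))\<^sup>2 * (if 0 \<le> l \<and> l \<le> ?a then l powr (q - 2 - 1) else 0)) \<partial>lborel)
       = ennreal (8 * pi * (2 * N) powr (q - 2) / (q - 2)) * ennreal (norm (g x) powr p)"
      by (subst ennreal_mult''[symmetric]) simp_all
  qed
  also have "\<dots> = ennreal (8 * pi * (2 * N) powr (q - 2) / (q - 2)) * (\<integral>\<^sup>+x. ennreal (norm (g x) powr p) \<partial>lborel)"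
    by (rule nn_integral_cmult) measurable
  also have "\<dots> \<le> ennreal (8 * pi * (2 * N) powr (q - 2) / (q - 2)) * ennreal N"
    by (intro mult_left_mono le) simp
  finally have "(\<integral>\<^sup>+z. ennreal (?F z powr q) \<partial>lborel) \<le> ennreal q * (ennreal (8 * pi * (2 * N) powr (q - 2) / (q - 2)) * ennreal N)"
    unfolding layers by (rule mult_left_mono) simp
  also have "\<dots> = ennreal (q * (8 * pi * (2 * N) powr (q - 2) / (q - 2) * N))"
    using q2 N by (simp add: ennreal_mult[symmetric])
  also have "q * (8 * pi * (2 * N) powr (q - 2) / (q - 2) * N) = 8 * pi * q * 2 powr (q - 2) / (q - 2) * N powr (q - 1)"
  proof -
    have eq1: "N powr (q - 1) = N powr (q - 2) * N" using N powr_add[of N "q - 2" 1] by simp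
    have eq2: "(2 * N) powr (q - 2) = 2 powr (q - 2) * N powr (q - 2)" using N by (simp add: powr_mult)
    show ?thesis unfolding eq1 eq2 by (simp only: times_divide_eq_right times_divide_eq_left mult_ac)
  qed
  finally show ?thesis .
qed

text \<open>The extended-real conventions do the endpoint work: 1/\<infinity> = 0 pairs p = 1 with
  \<infinity>, and 1/0 = \<infinity> excludes p' = 0.\<close>

lemma conjugate_exponent_cases:
  fixes p p' :: ennreal
  assumes "1 \<le> p" "p \<le> 2" "1 / p + 1 / p' = 1"
  obtains "p = 1" "p' = \<top>" | r where "1 < r" "r \<le> 2" "p = ennreal r" "p' = ennreal (r / (r - 1))"
proof -
  obtain r where r: "p = ennreal r" "1 \<le> r"
    using assms(1,2) by (cases p) (auto simp: top_unique)
  have "ennreal r \<le> ennreal 2" using assms(2) r by simp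
  then have r2: "r \<le> 2" by (simp only: ennreal_le_iff)
  have p: "1 / p = ennreal (1 / r)" using r by (simp add: divide_ennreal[symmetric])
  show ?thesis
  proof (cases p')
    case top
    then have "ennreal (1 / r) = 1" using assms(3) p by simp
    then have "r = 1" using r by (simp add: ennreal_eq_1)
    then show ?thesis using that(1) top r by simp
  next
    case (real t)
    have "t \<noteq> 0"
    proof
      assume "t = 0"
      then have "1 / p' = \<top>" using real by simp
      then show False using assms(3) by simp
    qed
    then have t: "0 < t" using real by simp
    then have "1 / p' = ennreal (1 / t)" using real by (simp add: divide_ennreal[symmetric])
    then have "ennreal (1 / r + 1 / t) = 1" using assms(3) p r t by simp
    then have eq: "1 / r + 1 / t = 1" by (simp only: ennreal_eq_1)
    then have "1 / r < 1" using t by (smt (verit) zero_less_divide_1_iff)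
    then have "1 < r" using r by (simp add: field_simps)
    moreover have "t = r / (r - 1)" using eq r t \<open>1 < r\<close> by (simp add: field_simps)
    ultimately show ?thesis using that(2) r r2 real by blast
  qed
qed

lemma conjugate_exponent_ge_2:
  fixes p p' :: ennreal
  assumes "1 \<le> p" "p \<le> 2" "1 / p + 1 / p' = 1"
  shows "2 \<le> p'"
  using assms
proof (cases rule: conjugate_exponent_cases)
  case (2 r)
  then have "ennreal 2 \<le> ennreal (r / (r - 1))" by (intro ennreal_leI) (simp add: field_simps)
  then show ?thesis using 2 by simp
qed simp

theorem hausdorff_young:
  fixes p p' :: ennreal
  assumes pp: "1 \<le> p" "p \<le> 2" "1 / p + 1 / p' = 1"
  obtains C where "0 < C" "\<And>g c. integrable lborel g \<Longrightarrow> Lq_le p lborel g c \<Longrightarrow> Lq_le p' lborel (fourier_integral g) (C * c)"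
  using pp
proof (cases rule: conjugate_exponent_cases)
  case 1
  have "Lq_le p' lborel (fourier_integral g) (1 * c)" if g: "integrable lborel g" "Lq_le p lborel g c" for g c
  proof -
    have "0 \<le> c" using g Lq_le_nonneg by blast
    then have "(\<integral>\<^sup>+x. ennreal (norm (g x)) \<partial>lborel) \<le> ennreal c"
      using g 1 by (simp add: Lq_le_def)
    then have "(\<integral>x. norm (g x) \<partial>lborel) \<le> c"
      using g \<open>0 \<le> c\<close> by (subst (asm) nn_integral_eq_integral) auto
    then have "norm (fourier_integral g z) \<le> c" for z using fourier_norm_le[of g z] by linarith
    then show ?thesis using 1 \<open>0 \<le> c\<close> g borel_measurable_integrable[OF g(1)] by (simp add: Lq_le_top)
  qed
  then show ?thesis using that[of 1] by simp
next
  case (2 r)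
  define q where "q = r / (r - 1)"
  have q: "2 \<le> q" using 2 by (simp add: q_def field_simps)
  have rq: "r * (q - 1) = q" using 2 by (simp add: q_def field_simps)
  \<comment> \<open>The interpolation constant has q - 2 in its denominator and degenerates at r =
    2, where the Plancherel constant takes over.\<close>
  define D where "D = (if r = 2 then 2 * pi else 8 * pi * q * 2 powr (q - 2) / (q - 2))"
  have q2: "2 < q" if "r \<noteq> 2" using that 2 by (simp add: q_def field_simps)
  have D: "0 < D" using q q2 by (simp add: D_def)
  have "Lq_le p' lborel (fourier_integral g) (D powr (1 / q) * c)" if g: "integrable lborel g" "Lq_le p lborel g c" for g c
  proof -
    have [measurable]: "g \<in> borel_measurable borel"
      using g by (auto dest: borel_measurable_integrable)
    have le: "(\<integral>\<^sup>+x. ennreal (norm (g x) powr r) \<partial>lborel) \<le> ennreal (c powr r)" and c: "0 \<le> c"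
      using g 2 by (simp_all add: Lq_le_ennreal)
    have "(\<integral>\<^sup>+z. ennreal (norm (fourier_integral g z) powr q) \<partial>lborel) \<le> ennreal (D * c powr q)"
    \<comment> \<open>Splitting by height requires a positive mass bound, so the case where g
      vanishes almost everywhere is treated apart.\<close>
    proof (cases "c = 0")
      case True
      then have "(\<integral>\<^sup>+x. ennreal (norm (g x) powr r) \<partial>lborel) = 0" using le 2 by simp
      then have "AE x in lborel. ennreal (norm (g x) powr r) = 0" by (subst (asm) nn_integral_0_iff_AE) auto
      then have "AE x in lborel. g x = 0" by eventually_elim auto
      then have "fourier_integral g z = fourier_integral (\<lambda>_. 0) z" for z
        by (intro fourier_cong_AE) auto
      then show ?thesis using q by (simp add: fourier_integral_def)
    next
      case False
      then have c: "0 < c" using c by simp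
      show ?thesis
      proof (cases "r = 2")
        case True
        then have "q = 2" by (simp add: q_def)
        have "(\<integral>\<^sup>+z. ennreal ((norm (fourier_integral g z))\<^sup>2) \<partial>lborel) \<le> ennreal (2 * pi) * ennreal (c\<^sup>2)"
          by (rule order_trans[OF plancherel_le[OF g(1)] mult_left_mono]) (use le True c in auto)
        also have "\<dots> = ennreal (D * c\<^sup>2)" unfolding D_def using True by (subst ennreal_mult[symmetric]) auto
        finally show ?thesis using c by (simp add: \<open>q = 2\<close>)
      next
        case False
        then have "(c powr r) powr (q - 1) = c powr q" by (simp add: powr_powr rq)
        moreover have "(\<integral>\<^sup>+z. ennreal (norm (fourier_integral g z) powr q) \<partial>lborel)
            \<le> ennreal (8 * pi * q * 2 powr (q - 2) / (q - 2) * (c powr r) powr (q - 1))"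
          using False 2 c by (intro hausdorff_young_strict[OF g(1) _ _ q_def _ le]) auto
        ultimately show ?thesis using False by (simp add: D_def)
      qed
    qed
    also have "D * c powr q = (D powr (1 / q) * c) powr q"
      using D c q by (simp add: powr_mult powr_powr)
    finally show ?thesis using 2 q c g by (simp add: q_def[symmetric] Lq_le_ennreal)
  qed
  then show ?thesis using that[of "D powr (1 / q)"] D by simp
qed

section \<open>Truncation to balls\<close>

definition trunc :: "real \<Rightarrow> (real \<Rightarrow> complex) \<Rightarrow> real \<Rightarrow> complex" where
  "trunc R g x = (if \<bar>x\<bar> \<le> R then g x else 0)"

lemma trunc_measurable [measurable]:
  assumes [measurable]: "g \<in> borel_measurable borel"
  shows "trunc R g \<in> borel_measurable borel"
  unfolding trunc_def[abs_def] by measurable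

lemma norm_trunc_le: "norm (trunc R g x) \<le> norm (g x)" "norm (g x - trunc R g x) \<le> norm (g x)"
  by (simp_all add: trunc_def)

lemma Lq_le_trunc:
  assumes "1 \<le> q" and g: "Lq_le q lborel g c"
  shows "Lq_le q lborel (trunc R g) c"
proof -
  have [measurable]: "g \<in> borel_measurable borel" using g Lq_le_measurable by fastforce
  show ?thesis by (rule Lq_le_AE_mono[where f=g and c=c and a=1]) (use assms in \<open>auto simp: norm_trunc_le\<close>)
qed

text \<open>From |g| \<le> 1 + |g|^r on the ball. The explicit L^1 bound depends only on R, c and r,
  hence is uniform over a bounded family; it supplies the Lipschitz constant in
  \<open>Pa_imp_Pb2\<close>.\<close>

lemma trunc_integrable:
  assumes p: "1 \<le> r" and g: "Lq_le (ennreal r) lborel g c" and R: "0 \<le> R"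
  shows "integrable lborel (trunc R g)" "(\<integral>x. norm (trunc R g x) \<partial>lborel) \<le> 2 * R + c powr r"
proof -
  have [measurable]: "g \<in> borel_measurable borel" using g Lq_le_measurable by fastforce
  have le: "(\<integral>\<^sup>+x. ennreal (norm (g x) powr r) \<partial>lborel) \<le> ennreal (c powr r)"
    using g p by (simp add: Lq_le_ennreal)
  have "(\<integral>\<^sup>+x. ennreal (norm (trunc R g x)) \<partial>lborel) \<le> (\<integral>\<^sup>+x. indicator {-R..R} x + ennreal (norm (g x) powr r) \<partial>lborel)"
  proof (rule nn_integral_mono)
    fix x
    have "norm (g x) \<le> 1 + norm (g x) powr r"
    proof (cases "norm (g x) \<le> 1")
      case True then show ?thesis by (smt (verit) powr_ge_zero)
    next
      case False
      then have "norm (g x) powr 1 \<le> norm (g x) powr r" using p by (intro powr_mono) auto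
      then show ?thesis using False by simp
    qed
    then have "ennreal (norm (g x)) \<le> 1 + ennreal (norm (g x) powr r)"
      using ennreal_leI[of "norm (g x)" "1 + norm (g x) powr r"] by simp
    then show "ennreal (norm (trunc R g x)) \<le> indicator {-R..R} x + ennreal (norm (g x) powr r)"
      by (auto simp: trunc_def indicator_def)
  qed
  also have "\<dots> = ennreal (2 * R) + (\<integral>\<^sup>+x. ennreal (norm (g x) powr r) \<partial>lborel)"
    using R by (subst nn_integral_add) auto
  also have "\<dots> \<le> ennreal (2 * R) + ennreal (c powr r)" by (intro add_left_mono le)
  also have "\<dots> = ennreal (2 * R + c powr r)" using R by simp
  finally have *: "(\<integral>\<^sup>+x. ennreal (norm (trunc R g x)) \<partial>lborel) \<le> ennreal (2 * R + c powr r)" .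
  show i: "integrable lborel (trunc R g)"
    using le_less_trans[OF * ennreal_less_top] by (intro integrableI_bounded) simp_all
  show "(\<integral>x. norm (trunc R g x) \<partial>lborel) \<le> 2 * R + c powr r"
    using * R i by (subst (asm) nn_integral_eq_integral) (auto simp del: ennreal_plus)
qed

text \<open>Dominated convergence for one fixed g: the counterpart of P_a without uniformity over a
  family.\<close>

lemma trunc_tail:
  assumes p: "1 \<le> r" and g: "Lq_le (ennreal r) lborel g c" and e: "0 < e"
  shows "\<forall>\<^sub>F n in sequentially. Lq_le (ennreal r) lborel (\<lambda>x. g x - trunc (real n) g x) e"
proof -
  have [measurable]: "g \<in> borel_measurable borel" using g Lq_le_measurable by fastforce
  have le: "(\<integral>\<^sup>+x. ennreal (norm (g x) powr r) \<partial>lborel) \<le> ennreal (c powr r)"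
    using g p by (simp add: Lq_le_ennreal)
  have "(\<lambda>n. \<integral>\<^sup>+x. ennreal (norm (g x - trunc (real n) g x) powr r) \<partial>lborel) \<longlonglongrightarrow> (\<integral>\<^sup>+x. 0 \<partial>(lborel :: real measure))"
  proof (rule nn_integral_dominated_convergence)
    show "AE x in lborel. ennreal (norm (g x - trunc (real n) g x) powr r) \<le> ennreal (norm (g x) powr r)" for n
      using p by (intro AE_I2 ennreal_leI powr_mono2 norm_trunc_le) auto
    show "(\<integral>\<^sup>+x. ennreal (norm (g x) powr r) \<partial>lborel) < \<infinity>"
      using le_less_trans[OF le ennreal_less_top] by simp
    show "AE x in lborel. (\<lambda>n. ennreal (norm (g x - trunc (real n) g x) powr r)) \<longlonglongrightarrow> 0"
    proof (rule AE_I2, rule tendsto_eventually)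
      fix x
      obtain N :: nat where "\<bar>x\<bar> \<le> real N" using real_arch_simple by blast
      then show "\<forall>\<^sub>F n in sequentially. ennreal (norm (g x - trunc (real n) g x) powr r) = 0"
        using p by (auto simp: trunc_def eventually_sequentially intro!: exI[of _ N])
    qed
  qed measurable
  from order_tendstoD(2)[OF this, of "ennreal (e powr r)"]
  have "\<forall>\<^sub>F n in sequentially. (\<integral>\<^sup>+x. ennreal (norm (g x - trunc (real n) g x) powr r) \<partial>lborel) < ennreal (e powr r)"
    using e by simp
  then show ?thesis
    by eventually_elim (use p e in \<open>simp add: Lq_le_ennreal less_imp_le\<close>)
qed

section \<open>Bounded extension of the transform\<close>

text \<open>The approximating sequence is determined by g alone. Two limits are then equal almost
  everywhere, and linearity is inherited from the Fourier integral because truncation is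
  linear.\<close>

definition is_Fourier_limit :: "ennreal \<Rightarrow> (real \<Rightarrow> complex) \<Rightarrow> (real \<Rightarrow> complex) \<Rightarrow> bool" where
  "is_Fourier_limit q g h \<longleftrightarrow> (\<forall>e>0. \<forall>\<^sub>F n in sequentially. Lq_le q lborel (\<lambda>z. h z - fourier_integral (trunc (real n) g) z) e)"

lemma is_Fourier_limit_unique:
  assumes q: "1 \<le> q" and "is_Fourier_limit q g h" "is_Fourier_limit q g h'"
  shows "AE z in lborel. h z = h' z"
proof -
  have "AE z in lborel. h z - h' z = 0"
  proof (rule Lq_le_imp_zero[OF q])
    fix e :: real assume e: "0 < e"
    have "\<forall>\<^sub>F n in sequentially. Lq_le q lborel (\<lambda>z. h z - fourier_integral (trunc (real n) g) z) (e/4) \<and>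
       Lq_le q lborel (\<lambda>z. h' z - fourier_integral (trunc (real n) g) z) (e/4)"
      using assms e by (auto simp: is_Fourier_limit_def eventually_conj_iff)
    then obtain n where "Lq_le q lborel (\<lambda>z. h z - fourier_integral (trunc (real n) g) z) (e/4)"
       "Lq_le q lborel (\<lambda>z. h' z - fourier_integral (trunc (real n) g) z) (e/4)"
      by (auto simp: eventually_sequentially)
    from Lq_le_diff[OF q this] show "Lq_le q lborel (\<lambda>z. h z - h' z) e" by simp
  qed
  then show ?thesis by eventually_elim simp
qed

text \<open>The Riesz-Fischer argument, arranged to avoid iterating the triangle inequality, whose
  factor 2 would compound. Weighting the increments by 2^k against their decay 4^(-k) gives a series
  of r-th powers with finite integral. Its sum is finite almost everywhere, and each increment is
  then at most a constant times 2^(-k).\<close>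

lemma Lq_le_geometric_convergent:
  assumes q: "1 \<le> q" "q \<noteq> \<top>" and X: "\<And>k. Lq_le q lborel (\<lambda>z. X (Suc k) z - X k z) (B / 4 ^ k)"
  shows "AE z in lborel. convergent (\<lambda>k::nat. X k z)"
proof -
  obtain r where r: "q = ennreal r" "1 \<le> r" using q by (cases q) auto
  have m [measurable]: "(\<lambda>z. X (Suc k) z - X k z) \<in> borel_measurable borel" for k
    using Lq_le_measurable[OF X[of k]] by simp
  have B: "0 \<le> B" using Lq_le_nonneg[OF X[of 0]] by simp
  have le_suminf: "f k \<le> (\<Sum>k. f k)" for f :: "nat \<Rightarrow> ennreal" and k
    using sum_le_suminf[of f "{k}"] by simp
  let ?s = "\<lambda>k z. ennreal ((2 ^ k * norm (X (Suc k) z - X k z)) powr r)"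
  have "(\<integral>\<^sup>+z. ?s k z \<partial>lborel) \<le> ennreal (B powr r * (1 / 2) ^ k)" for k
  proof -
    have "(\<integral>\<^sup>+z. ?s k z \<partial>lborel) = (\<integral>\<^sup>+z. ennreal ((2 ^ k) powr r) * ennreal (norm (X (Suc k) z - X k z) powr r) \<partial>lborel)"
      by (intro nn_integral_cong) (simp add: powr_mult ennreal_mult[symmetric])
    also have "\<dots> = ennreal ((2 ^ k) powr r) * (\<integral>\<^sup>+z. ennreal (norm (X (Suc k) z - X k z) powr r) \<partial>lborel)"
      by (rule nn_integral_cmult) measurable
    also have "\<dots> \<le> ennreal ((2 ^ k) powr r) * ennreal ((B / 4 ^ k) powr r)"
      using X[of k] r by (intro mult_left_mono) (simp_all add: Lq_le_ennreal)
    also have "\<dots> = ennreal (B powr r * ((1 / 2) ^ k) powr r)"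
    proof -
      have "(2::real) ^ k * (B / 4 ^ k) = B * (1 / 2) ^ k"
        by (simp add: power_divide field_simps flip: power_mult_distrib)
      then have "(2 ^ k) powr r * (B / 4 ^ k) powr r = B powr r * ((1 / 2) ^ k) powr r"
        using B by (metis powr_mult)
      then show ?thesis by (simp add: ennreal_mult[symmetric])
    qed
    also have "\<dots> \<le> ennreal (B powr r * (1 / 2) ^ k)"
    proof (intro ennreal_leI mult_left_mono)
      have "((1 / 2 :: real) ^ k) powr r \<le> ((1 / 2) ^ k) powr 1"
        using r by (intro powr_mono') (auto simp: power_le_one)
      then show "((1 / 2 :: real) ^ k) powr r \<le> (1 / 2) ^ k" by simp
    qed simp
    finally show ?thesis .
  qed
  then have "(\<Sum>k. \<integral>\<^sup>+z. ?s k z \<partial>lborel) \<le> (\<Sum>k. ennreal (B powr r * (1 / 2) ^ k))"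
    by (intro suminf_le) auto
  also have "\<dots> = ennreal (\<Sum>k. B powr r * (1 / 2) ^ k)"
    by (intro suminf_ennreal2 summable_mult summable_geometric) auto
  finally have "(\<integral>\<^sup>+z. (\<Sum>k. ?s k z) \<partial>lborel) \<noteq> \<infinity>"
    by (subst nn_integral_suminf) (auto simp: top_unique)
  then have "AE z in lborel. (\<Sum>k. ?s k z) \<noteq> \<infinity>"
    by (intro nn_integral_PInf_AE) measurable
  then show ?thesis
  proof eventually_elim
    case (elim z)
    define t where "t = (\<Sum>k. ?s k z)"
    have "t \<noteq> \<infinity>" unfolding t_def by (rule elim)
    then obtain S where "t = ennreal S" "0 \<le> S" by (cases t) auto
    note S = this[unfolded t_def]
    have b: "norm (X (Suc k) z - X k z) \<le> S powr (1 / r) * (1 / 2) ^ k" for k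
    proof -
      have "?s k z \<le> ennreal S" using le_suminf[of "\<lambda>k. ?s k z" k] unfolding S(1) .
      then have "(2 ^ k * norm (X (Suc k) z - X k z)) powr r \<le> S" using S(2) by (simp only: ennreal_le_iff)
      then have "((2 ^ k * norm (X (Suc k) z - X k z)) powr r) powr (1 / r) \<le> S powr (1 / r)"
        using r by (intro powr_mono2) auto
      then have "2 ^ k * norm (X (Suc k) z - X k z) \<le> S powr (1 / r)"
        using r by (simp add: powr_powr)
      then show ?thesis by (simp add: field_simps power_divide)
    qed
    have "summable (\<lambda>k. X (Suc k) z - X k z)"
    proof (rule summable_comparison_test')
      show "summable (\<lambda>k. S powr (1 / r) * (1 / 2) ^ k)" by (intro summable_mult summable_geometric) simp
    qed (rule b)
    then have "convergent (\<lambda>n. \<Sum>k<n. X (Suc k) z - X k z)" by (simp add: summable_iff_convergent)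
    then have "convergent (\<lambda>n. X n z - X 0 z)" by (simp add: sum_lessThan_telescope[of "\<lambda>k. X k z"])
    then have "convergent (\<lambda>n. (X n z - X 0 z) + X 0 z)" by (intro convergent_add convergent_const)
    then show ?case by simp
  qed
qed

text \<open>For p = 1 the Fourier integral itself is the limit. Otherwise p' is finite, a rapidly
  converging subsequence has a pointwise limit, and Hausdorff-Young compares that limit with the
  whole sequence.\<close>

lemma Fourier_limit_exists:
  fixes p p' :: ennreal
  assumes pp: "1 \<le> p" "p \<le> 2" "1 / p + 1 / p' = 1" and C: "0 < C"
    and hy: "\<And>g c. integrable lborel g \<Longrightarrow> Lq_le p lborel g c \<Longrightarrow> Lq_le p' lborel (fourier_integral g) (C * c)"
    and g: "Lq_le p lborel g c"
  shows "\<exists>h. is_Fourier_limit p' g h \<and> Lq_le p' lborel h (C * c)"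
proof -
  have p'1: "1 \<le> p'" using conjugate_exponent_ge_2[OF pp] by (rule order_trans[rotated]) simp
  have [measurable]: "g \<in> borel_measurable borel" using g Lq_le_measurable by fastforce
  obtain r where r: "p = ennreal r" "1 \<le> r" using pp(1,2) by (cases p) (auto simp: top_unique)
  note gr = g[unfolded r(1)]
  have ti: "integrable lborel (trunc (real n) g)" for n using trunc_integrable[OF r(2) gr] by simp
  have tail: "\<forall>\<^sub>F n in sequentially. Lq_le p lborel (\<lambda>x. g x - trunc (real n) g x) e" if "0 < e" for e
    using trunc_tail[OF r(2) gr that] r by simp
  \<comment> \<open>The 4 is the 2 (e + e) of \<open>Lq_le_diff\<close>, passed through the
    Hausdorff-Young bound.\<close>
  have diff: "Lq_le p' lborel (\<lambda>z. fourier_integral (trunc (real m) g) z - fourier_integral (trunc (real n) g) z) (4 * C * e)"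
    if "Lq_le p lborel (\<lambda>x. g x - trunc (real n) g x) e" "Lq_le p lborel (\<lambda>x. g x - trunc (real m) g x) e" for m n e
    using hy[OF Bochner_Integration.integrable_diff[OF ti[of m] ti[of n]], of "4 * e"] Lq_le_diff[OF pp(1) that]
    by (simp add: fourier_diff[OF ti ti, abs_def] mult_ac)
  show ?thesis
    using pp
  proof (cases rule: conjugate_exponent_cases)
    case 1
    have gi: "integrable lborel g"
    proof (rule integrableI_bounded)
      have "(\<integral>\<^sup>+x. ennreal (norm (g x)) \<partial>lborel) \<le> ennreal c"
        using g 1 Lq_le_nonneg[OF g] by (simp add: Lq_le_def)
      then show "(\<integral>\<^sup>+x. ennreal (norm (g x)) \<partial>lborel) < \<infinity>" using le_less_trans[OF _ ennreal_less_top] by simp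
    qed simp
    have "is_Fourier_limit p' g (fourier_integral g)"
      unfolding is_Fourier_limit_def
    proof (intro allI impI)
      fix e :: real assume "0 < e"
      then have "\<forall>\<^sub>F n in sequentially. Lq_le p lborel (\<lambda>x. g x - trunc (real n) g x) (e / C)"
        using C by (intro tail) simp
      then show "\<forall>\<^sub>F n in sequentially. Lq_le p' lborel (\<lambda>z. fourier_integral g z - fourier_integral (trunc (real n) g) z) e"
      proof eventually_elim
        case (elim n)
        then show ?case
          using hy[OF Bochner_Integration.integrable_diff[OF gi ti[of n]], of "e / C"] C
          by (simp add: fourier_diff[OF gi ti, abs_def])
      qed
    qed
    then show ?thesis using hy[OF gi g] by blast
  next
    case (2 t)
    then have top: "p' \<noteq> \<top>" by simp
    have "\<exists>N. \<forall>n\<ge>N. Lq_le p lborel (\<lambda>x. g x - trunc (real n) g x) (1 / 4 ^ k)" for k :: nat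
      using tail[of "1 / 4 ^ k"] by (simp add: eventually_sequentially)
    then obtain N where N: "\<And>k n. N k \<le> n \<Longrightarrow> Lq_le p lborel (\<lambda>x. g x - trunc (real n) g x) (1 / 4 ^ k)" by metis
    \<comment> \<open>Partial sums make the indices monotone and let M j dominate N k for every k
      \<le> j.\<close>
    define M where "M = (\<lambda>k. \<Sum>i\<le>k. N i)"
    have M: "N k \<le> M j" if "k \<le> j" for k j
      unfolding M_def using that by (intro member_le_sum) auto
    let ?X = "\<lambda>k. fourier_integral (trunc (real (M k)) g)"
    have "Lq_le p' lborel (\<lambda>z. ?X (Suc k) z - ?X k z) (4 * C / 4 ^ k)" for k
      using diff[OF N[OF M[of k k]] N[OF M[of k "Suc k"]]] by simp
    then have conv: "AE z in lborel. convergent (\<lambda>k. ?X k z)"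
      by (rule Lq_le_geometric_convergent[OF p'1 top])
    \<comment> \<open>\<open>lim\<close> is unspecified where the sequence diverges, but that is a
      null set, and h stays measurable.\<close>
    define h where "h = (\<lambda>z. lim (\<lambda>k. ?X k z))"
    have hm [measurable]: "h \<in> borel_measurable borel" unfolding h_def by measurable
    have lim: "AE z in lborel. (\<lambda>k. ?X k z) \<longlonglongrightarrow> h z"
      using conv by eventually_elim (simp add: h_def convergent_LIMSEQ_iff)
    have "is_Fourier_limit p' g h"
      unfolding is_Fourier_limit_def
    proof (intro allI impI)
      fix e :: real assume e: "0 < e"
      define d where "d = e / (4 * C)"
      have d: "0 < d" "4 * C * d = e" using e C by (auto simp: d_def)
      from d(1) obtain k0 where k0: "1 / 4 ^ k0 < d"
        using real_arch_pow_inv[of d "1/4"] by (auto simp: power_divide)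
      show "\<forall>\<^sub>F n in sequentially. Lq_le p' lborel (\<lambda>z. h z - fourier_integral (trunc (real n) g) z) e"
        using tail[OF d(1)]
      proof eventually_elim
        case (elim n)
        show ?case
        proof (rule Lq_le_limit[OF p'1])
          fix k
          have "Lq_le p lborel (\<lambda>x. g x - trunc (real (M (k + k0))) g x) d"
            by (rule Lq_le_mono[OF pp(1) N[of k0]]) (use M k0 in auto)
          from diff[OF elim this]
          show "Lq_le p' lborel (\<lambda>z. ?X (k + k0) z - fourier_integral (trunc (real n) g) z) e"
            by (simp add: d)
        next
          show "AE z in lborel. (\<lambda>k. ?X (k + k0) z - fourier_integral (trunc (real n) g) z) \<longlonglongrightarrow> h z - fourier_integral (trunc (real n) g) z"
            using lim by eventually_elim (intro tendsto_diff tendsto_const LIMSEQ_ignore_initial_segment)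
        qed measurable
      qed
    qed
    moreover have "Lq_le p' lborel h (C * c)"
      by (rule Lq_le_limit[OF p'1 hy[OF ti Lq_le_trunc[OF pp(1) g]] _ lim]) simp
    ultimately show ?thesis by blast
  qed
qed

text \<open>The map s folds the line onto I, and f o s is the function on the line with which f is
  identified: f itself, or its even extension. All estimates are made for f o s, so both settings
  share one proof.\<close>

locale half_or_full_line =
  fixes I :: "real set" and s :: "real \<Rightarrow> real"
  assumes cases: "(I = UNIV \<and> s = (\<lambda>x. x)) \<or> (I = {0..} \<and> s = abs)"
begin

lemma I_sets [measurable]: "I \<in> sets borel"
  using cases by auto

lemma fold_id: "x \<in> I \<Longrightarrow> s x = x" and fold_in: "s x \<in> I" and abs_fold: "\<bar>s x\<bar> = \<bar>x\<bar>"
  and fold_fold: "s (s x) = s x" and fold_measurable [measurable]: "s \<in> borel_measurable borel"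
  using cases by auto

lemma fold_composition_measurable:
  assumes f: "f \<in> borel_measurable (restrict_space lborel I)"
  shows "(\<lambda>x. f (s x)) \<in> borel_measurable borel"
proof -
  have "s \<in> measurable borel (restrict_space lborel I)"
    by (rule measurable_restrict_space2) (auto intro: fold_in)
  from measurable_compose[OF this f] show ?thesis .
qed

lemma AE_restrictI: "AE x in lborel. Q x \<Longrightarrow> AE x in restrict_space lborel I. Q x"
  by (subst AE_restrict_space_iff) (auto elim: AE_mp)

lemma AE_fold:
  assumes "AE x in restrict_space lborel I. Q x"
  shows "AE x in lborel. Q (s x)"
proof -
  have 1: "AE x in lborel. x \<in> I \<longrightarrow> Q x" using assms by (subst (asm) AE_restrict_space_iff) auto
  from AE_lborel_affine[OF _ 1, of 1 0] have 2: "AE x in lborel. - x \<in> I \<longrightarrow> Q (- x)" by simp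
  from 1 2 show ?thesis
  proof eventually_elim
    case (elim x)
    then show ?case using cases by (cases "0 \<le> x") auto
  qed
qed

lemma Lq_le_restrictI:
  assumes "1 \<le> q" "Lq_le q lborel g c"
  shows "Lq_le q (restrict_space lborel I) g c"
proof -
  have [measurable]: "g \<in> borel_measurable borel" using assms Lq_le_measurable by fastforce
  have "Lq_le q lborel (\<lambda>x. indicator I x * g x) c"
    by (rule Lq_le_AE_mono[where f=g and c=c and a=1]) (use assms in \<open>auto simp: indicator_def\<close>)
  then show ?thesis using assms(1) by (subst Lq_le_restrict_iff) auto
qed

text \<open>f o s is the extension of f by zero plus, off I, its reflection. Both parts are bounded
  by c, and \<open>Lq_le_add\<close> turns this into 2 (c + c); the same constant is kept for the
  full line.\<close>

lemma Lq_le_foldI: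
  assumes q: "1 \<le> q" and f: "Lq_le q (restrict_space lborel I) f c"
  shows "Lq_le q lborel (\<lambda>x. f (s x)) (4 * c)"
proof -
  have [measurable]: "(\<lambda>x. f (s x)) \<in> borel_measurable borel"
    by (rule fold_composition_measurable[OF Lq_le_measurable[OF f]])
  let ?g = "\<lambda>x. indicator I x * f x"
  have g: "Lq_le q lborel ?g c" using f q by (subst (asm) Lq_le_restrict_iff) auto
  then have [measurable]: "?g \<in> borel_measurable borel" using Lq_le_measurable by fastforce
  have c: "0 \<le> c" using g Lq_le_nonneg by blast
  have g': "Lq_le q lborel (\<lambda>x. ?g (- x)) c"
    using q
  proof (cases rule: exponent_cases)
    case infinite
    then have "AE x in lborel. norm (?g x) \<le> c" using g by (simp add: Lq_le_top)
    from AE_lborel_affine[OF _ this, of 1 0] show ?thesis using infinite c by (simp add: Lq_le_top)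
  next
    case (finite r)
    have "(\<integral>\<^sup>+x. ennreal (norm (?g (0 - 1 * x)) powr r) \<partial>lborel) = ennreal (1 / 1) * (\<integral>\<^sup>+x. ennreal (norm (?g x) powr r) \<partial>lborel)"
      by (rule nn_integral_dilate[where f="\<lambda>x. ennreal (norm (?g x) powr r)"]) auto
    then show ?thesis using g finite c by (simp add: Lq_le_ennreal)
  qed
  have "Lq_le q lborel (\<lambda>x. ?g x + (if x \<in> I then 0 else ?g (- x))) (2 * (c + c))"
    by (rule Lq_le_add[OF q g], rule Lq_le_AE_mono[OF q g', where a=1]) auto
  then have "Lq_le q lborel (\<lambda>x. ?g x + (if x \<in> I then 0 else ?g (- x))) (4 * c)" by simp
  moreover have "?g x + (if x \<in> I then 0 else ?g (- x)) = f (s x)" for x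
    using cases by (auto simp: indicator_def)
  ultimately show ?thesis by simp
qed

text \<open>On the half line this is the cosine integral of an integrable f, the sine part
  cancelling by evenness. The exponential form makes the Fourier theory on the line applicable to
  both settings.\<close>

definition transform :: "(real \<Rightarrow> complex) \<Rightarrow> real \<Rightarrow> complex" where
  "transform f = fourier_integral (\<lambda>x. f (s x))"

text \<open>This existence proof is what gives the \<open>SOME\<close> in
  \<open>extended_transform\<close> a meaning. The extension picks a measurable Fourier limit of f o
  s; all its properties follow from bounds on such limits and their uniqueness almost
  everywhere.\<close>

theorem bounded_extension_exists:
  assumes pp: "1 \<le> p" "p \<le> 2" "1 / p + 1 / p' = 1"
  shows "\<exists>A. is_bounded_extension p p' I transform A"
proof -
  have p'1: "1 \<le> p'" using conjugate_exponent_ge_2[OF pp] by (rule order_trans[rotated]) simp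
  obtain r where r: "p = ennreal r" "1 \<le> r" using pp(1,2) by (cases p) (auto simp: top_unique)
  obtain C where C: "0 < C"
    and hy: "\<And>g c. integrable lborel g \<Longrightarrow> Lq_le p lborel g c \<Longrightarrow> Lq_le p' lborel (fourier_integral g) (C * c)"
    using hausdorff_young[OF pp] by blast
  define B where "B = (\<lambda>g. SOME h. is_Fourier_limit p' g h \<and> h \<in> borel_measurable borel)"
  define A where "A = (\<lambda>f. B (\<lambda>x. f (s x)))"
  have B: "is_Fourier_limit p' g (B g)" "Lq_le p' lborel (B g) (C * c)" if g: "Lq_le p lborel g c" for g c
  proof -
    obtain h where h: "is_Fourier_limit p' g h" "Lq_le p' lborel h (C * c)"
      using Fourier_limit_exists[OF pp C hy g] by blast
    have *: "is_Fourier_limit p' g (B g) \<and> B g \<in> borel_measurable borel"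
      unfolding B_def by (rule someI[of _ h]) (use h Lq_le_measurable[OF h(2)] in simp)
    then show "is_Fourier_limit p' g (B g)" by blast
    show "Lq_le p' lborel (B g) (C * c)"
      by (rule Lq_le_cong_AE[OF p'1 h(2) _ is_Fourier_limit_unique[OF p'1]]) (use * h in auto)
  qed
  have A: "Lq_le p' (restrict_space lborel I) (A f) (C * (4 * c))" if "Lq_le p (restrict_space lborel I) f c" for f c
    unfolding A_def by (intro Lq_le_restrictI p'1 B(2) Lq_le_foldI pp that)
  have "is_bounded_extension p p' I transform A"
    unfolding is_bounded_extension_def
  proof (intro conjI ballI allI)
    fix f assume "f \<in> Lq_space p I"
    from Lq_spaceE[OF pp(1) this] show "A f \<in> Lq_space p' I" by (metis A Lq_spaceI p'1)
  next
    fix f g c assume "f \<in> Lq_space p I" "g \<in> Lq_space p I"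
    then obtain a b where "Lq_le p (restrict_space lborel I) f a" "Lq_le p (restrict_space lborel I) g b"
      by (metis Lq_spaceE pp(1))
    then have f: "Lq_le p lborel (\<lambda>x. f (s x)) (4 * a)" and g: "Lq_le p lborel (\<lambda>x. g (s x)) (4 * b)"
      by (auto intro: Lq_le_foldI[OF pp(1)])
    let ?f = "\<lambda>x. f (s x)" and ?g = "\<lambda>x. g (s x)"
    let ?k = "\<lambda>x. c * f (s x) + g (s x)"
    note k = Lq_le_add[OF pp(1) Lq_le_cmult[OF pp(1) f, of c] g]
    have ti: "integrable lborel (trunc (real n) ?f)" "integrable lborel (trunc (real n) ?g)" for n
      using trunc_integrable(1)[OF r(2)] f g r by auto
    have "is_Fourier_limit p' ?k (\<lambda>z. c * B ?f z + B ?g z)"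
      unfolding is_Fourier_limit_def
    proof (intro allI impI)
      fix e :: real assume e: "0 < e"
      \<comment> \<open>Chosen so that the bound 2 (|c| d + d) from \<open>Lq_le_add\<close> is
        exactly e.\<close>
      define d where "d = e / (2 * (norm c + 1))"
      have nc: "0 < 2 * (norm c + 1)" by (simp add: add_nonneg_pos)
      have "2 * (norm c * d + d) = d * (2 * (norm c + 1))" by (simp add: algebra_simps)
      then have d: "0 < d" "2 * (norm c * d + d) = e" using e nc by (simp_all add: d_def)
      have "\<forall>\<^sub>F n in sequentially. Lq_le p' lborel (\<lambda>z. B ?f z - fourier_integral (trunc (real n) ?f) z) d"
        "\<forall>\<^sub>F n in sequentially. Lq_le p' lborel (\<lambda>z. B ?g z - fourier_integral (trunc (real n) ?g) z) d"
        using B(1)[OF f] B(1)[OF g] d(1) by (auto simp: is_Fourier_limit_def)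
      then show "\<forall>\<^sub>F n in sequentially. Lq_le p' lborel (\<lambda>z. c * B ?f z + B ?g z - fourier_integral (trunc (real n) ?k) z) e"
      proof eventually_elim
        case (elim n)
        have tk: "trunc (real n) ?k = (\<lambda>x. c * trunc (real n) ?f x + trunc (real n) ?g x)"
          by (auto simp: trunc_def)
        have eq: "fourier_integral (trunc (real n) ?k) z = c * fourier_integral (trunc (real n) ?f) z + fourier_integral (trunc (real n) ?g) z" for z
          unfolding tk using ti by (simp add: fourier_add fourier_cmult)
        show ?case
          using Lq_le_add[OF p'1 Lq_le_cmult[OF p'1 elim(1), of c] elim(2)]
          by (simp only: d(2) eq) (simp add: algebra_simps)
      qed
    qed
    from is_Fourier_limit_unique[OF p'1 B(1)[OF k] this]
    show "AE x in restrict_space lborel I. A (\<lambda>y. c * f y + g y) x = c * A f x + A g x"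
      unfolding A_def by (rule AE_restrictI)
  next
    show "\<exists>C. \<forall>f\<in>Lq_space p I. Lq_norm p' I (A f) \<le> ennreal C * Lq_norm p I f"
    proof (intro exI ballI)
      fix f assume "f \<in> Lq_space p I"
      then obtain c where c: "Lq_le p (restrict_space lborel I) f c" "Lq_norm p I f = ennreal c"
        by (metis Lq_spaceE pp(1))
      note Af = A[OF c(1)]
      have "Lq_norm p' I (A f) \<le> ennreal (C * (4 * c))"
        using Lq_norm_le_iff[OF p'1 Lq_le_measurable[OF Af] Lq_le_nonneg[OF Af]] Af by blast
      also have "\<dots> = ennreal (4 * C) * Lq_norm p I f"
        using C Lq_le_nonneg[OF c(1)] by (simp add: c(2) ennreal_mult[symmetric] mult_ac)
      finally show "Lq_norm p' I (A f) \<le> ennreal (4 * C) * Lq_norm p I f" .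
    qed
  next
    fix f assume f: "f \<in> Lq_space 1 I \<inter> Lq_space p I"
    then obtain a b where "Lq_le 1 (restrict_space lborel I) f a" "Lq_le p (restrict_space lborel I) f b"
      by (metis Lq_spaceE pp(1) IntD1 IntD2 order_refl)
    then have f1: "Lq_le 1 lborel (\<lambda>x. f (s x)) (4 * a)" and f: "Lq_le p lborel (\<lambda>x. f (s x)) (4 * b)"
      by (auto intro: Lq_le_foldI[OF pp(1)] Lq_le_foldI)
    let ?f = "\<lambda>x. f (s x)"
    have fi: "integrable lborel ?f"
    proof (rule integrableI_bounded)
      have "(\<integral>\<^sup>+x. ennreal (norm (?f x)) \<partial>lborel) \<le> ennreal (4 * a)"
        using f1 Lq_le_nonneg[OF f1] by (simp add: Lq_le_def)
      then show "(\<integral>\<^sup>+x. ennreal (norm (?f x)) \<partial>lborel) < \<infinity>" using le_less_trans[OF _ ennreal_less_top] by simp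
    qed (use Lq_le_measurable[OF f1] in simp)
    have ti: "integrable lborel (trunc (real n) ?f)" for n
      using trunc_integrable(1)[OF r(2)] f r by auto
    have "is_Fourier_limit p' ?f (fourier_integral ?f)"
      unfolding is_Fourier_limit_def
    proof (intro allI impI)
      fix e :: real assume "0 < e"
      then have "\<forall>\<^sub>F n in sequentially. Lq_le p lborel (\<lambda>x. ?f x - trunc (real n) ?f x) (e / C)"
        using C trunc_tail[OF r(2), of ?f "4 * b" "e / C"] f r by simp
      then show "\<forall>\<^sub>F n in sequentially. Lq_le p' lborel (\<lambda>z. fourier_integral ?f z - fourier_integral (trunc (real n) ?f) z) e"
      proof eventually_elim
        case (elim n)
        then show ?case
          using hy[OF Bochner_Integration.integrable_diff[OF fi ti[of n]], of "e / C"] C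
          by (simp add: fourier_diff[OF fi ti, abs_def])
      qed
    qed
    from is_Fourier_limit_unique[OF p'1 B(1)[OF f] this]
    show "AE x in restrict_space lborel I. A f x = transform f x"
      unfolding A_def transform_def by (rule AE_restrictI)
  qed
  then show ?thesis by blast
qed

end

section \<open>The convolution setting\<close>

lemma Lq_le_if_norm_less:
  assumes "1 \<le> q" "f \<in> borel_measurable (restrict_space lborel I)" "Lq_norm q I f < ennreal e"
  shows "Lq_le q (restrict_space lborel I) f e"
proof -
  have "0 \<le> e" using assms(3) by (metis ennreal_neg linorder_linear not_less_zero)
  then show ?thesis using assms Lq_norm_le_iff[of q f I e] by (simp add: less_imp_le)
qed

text \<open>What the transfer uses of a semigroup. \<open>\<sigma>_lower\<close> limits the time
  singularity of sqrt(B / \<open>\<sigma> t\<close>) to t^(-1/2). \<open>char_decay\<close> keeps 1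
  - m_t at modulus at least 1/2 far out, which permits division by it.\<close>

locale convolution_setting = half_or_full_line I s + density_kernel k
  for I s k +
  fixes \<sigma> :: "real \<Rightarrow> real" and T :: "real \<Rightarrow> (real \<Rightarrow> complex) \<Rightarrow> real \<Rightarrow> complex" and B :: real
  assumes T_conv: "\<And>f x t. 0 \<le> t \<Longrightarrow> x \<in> I \<Longrightarrow> (\<lambda>x. f (s x)) \<in> borel_measurable borel \<Longrightarrow>
      T t f x = conv (\<sigma> t) (\<lambda>x. f (s x)) x"
    and k_even: "\<And>u. k (- u) = k u"
    and k_bound: "\<And>u. k u \<le> B"
    and \<sigma>_measurable [measurable]: "\<sigma> \<in> borel_measurable borel"
    and \<sigma>_continuous: "continuous_on {0..} \<sigma>"
    and \<sigma>_zero: "\<sigma> 0 = 0" and \<sigma>_pos: "\<And>t. 0 < t \<Longrightarrow> 0 < \<sigma> t"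
    and \<sigma>_lower: "\<And>a. 0 < a \<Longrightarrow> \<exists>D\<ge>0. \<forall>t. 0 < t \<longrightarrow> t \<le> a \<longrightarrow> B / \<sigma> t \<le> D / t"
    and char_decay: "\<exists>Z. \<forall>z. Z \<le> \<bar>z\<bar> \<longrightarrow> norm (char (density lborel (\<lambda>u. ennreal (k u))) z) \<le> 1 / 2"
begin

lemma \<sigma>_nonneg: "0 \<le> t \<Longrightarrow> 0 \<le> \<sigma> t"
  using \<sigma>_pos[of t] \<sigma>_zero by (cases "t = 0") auto

text \<open>Reflection of the integration variable. It lets an almost everywhere identity on the
  half line be unfolded to the whole line in \<open>A_decomposition\<close>.\<close>

lemma transform_fold: "transform f (s z) = transform f z"
proof (cases "s z = z")
  case False
  then have s: "\<And>x. s x = \<bar>x\<bar>" and z: "s z = - z" using cases by auto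
  have "transform f (s z) = (\<integral>x. f \<bar>x\<bar> * exp (- \<i> * of_real x * of_real (- z)) \<partial>lborel)"
    unfolding z by (simp add: transform_def fourier_integral_def s)
  also have "\<dots> = (\<integral>x. f \<bar>0 + (- 1) * x\<bar> * exp (- \<i> * of_real (0 + (- 1) * x) * of_real (- z)) \<partial>lborel)"
    by (subst lborel_integral_real_affine[of "-1" _ 0]) auto
  also have "\<dots> = transform f z" by (simp add: transform_def fourier_integral_def s)
  finally show ?thesis .
qed simp

text \<open>Evenness of k makes the convolution of an even function even, so a bound on I for the
  time increment unfolds to the line in \<open>Pb1_imp_Pa\<close>.\<close>

lemma conv_fold:
  assumes [measurable]: "(\<lambda>x. f (s x)) \<in> borel_measurable borel"
  shows "conv t (\<lambda>x. f (s x)) (s x) = conv t (\<lambda>x. f (s x)) x"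
proof (cases "s x = x")
  case False
  then have s: "\<And>x. s x = \<bar>x\<bar>" and z: "s x = - x" using cases by auto
  have "conv t (\<lambda>x. f (s x)) (s x) = (\<integral>u. k u *\<^sub>R f (s (- x - t * u)) \<partial>lborel)"
    unfolding conv_def z by (subst integral_density) (auto simp: k_nonneg)
  also have "\<dots> = (\<integral>u. k (0 + (- 1) * u) *\<^sub>R f (s (- x - t * (0 + (- 1) * u))) \<partial>lborel)"
    by (subst lborel_integral_real_affine[of "-1" _ 0]) auto
  also have "\<dots> = (\<integral>u. k u *\<^sub>R f (s (x - t * u)) \<partial>lborel)"
  proof (intro Bochner_Integration.integral_cong refl)
    fix u
    have "- x - t * (0 + (- 1) * u) = - (x - t * u)" by simp
    then have "\<bar>- x - t * (0 + (- 1) * u)\<bar> = \<bar>x - t * u\<bar>" by (simp only: abs_minus_cancel)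
    then show "k (0 + (- 1) * u) *\<^sub>R f (s (- x - t * (0 + (- 1) * u))) = k u *\<^sub>R f (s (x - t * u))"
      by (simp add: s k_even)
  qed
  also have "\<dots> = conv t (\<lambda>x. f (s x)) x"
    unfolding conv_def by (subst integral_density) (auto simp: k_nonneg)
  finally show ?thesis .
qed simp

text \<open>The splitting of G holds only almost everywhere, but the conclusion holds at every x
  because the scale is positive. P_b2 requires this pointwise form; \<open>conv_add_AE\<close> adds
  scale 0 for the norm estimates.\<close>

lemma conv_add:
  assumes q: "1 \<le> q" and t: "0 < t" and G: "G \<in> borel_measurable borel"
    and G1: "Lq_le q lborel G1 c1" and G2: "Lq_le q lborel G2 c2"
    and eq: "AE x in lborel. G x = G1 x + G2 x"
  shows "conv t G x = conv t G1 x + conv t G2 x"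
proof -
  have [measurable]: "G1 \<in> borel_measurable borel" "G2 \<in> borel_measurable borel"
    using G1 G2 Lq_le_measurable by fastforce+
  have "conv t G x = conv t (\<lambda>x. G1 x + G2 x) x"
    by (rule conv_cong_AE[OF _ eq G]) (use t in auto)
  also have "\<dots> = conv t G1 x + conv t G2 x"
    unfolding conv_def
    by (intro Bochner_Integration.integral_add conv_pointwise(1)[OF q G1 t k_bound] conv_pointwise(1)[OF q G2 t k_bound])
  finally show ?thesis .
qed

lemma conv_add_AE:
  assumes q: "1 \<le> q" and t: "0 \<le> t" and G: "G \<in> borel_measurable borel"
    and G1: "Lq_le q lborel G1 c1" and G2: "Lq_le q lborel G2 c2"
    and eq: "AE x in lborel. G x = G1 x + G2 x"
  shows "AE x in lborel. conv t G x = conv t G1 x + conv t G2 x"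
proof (cases "t = 0")
  case True then show ?thesis using eq by simp
next
  case False
  then show ?thesis using conv_add[OF q _ G G1 G2 eq] t by simp
qed

lemma multiplier_uniformly_continuous:
  assumes M: "0 < M" and R: "0 \<le> R" and e: "0 < e"
  obtains d where "0 < d" "\<And>t h y. 0 \<le> t \<Longrightarrow> t < M \<Longrightarrow> \<bar>h\<bar> \<le> d \<Longrightarrow> 0 \<le> t + h \<Longrightarrow> \<bar>y\<bar> \<le> R \<Longrightarrow>
     norm (char P (\<sigma> (t + h) * y) - char P (\<sigma> t * y)) \<le> e"
proof -
  let ?K = "{0..M + 1} \<times> {-R..R}"
  let ?f = "\<lambda>(t, y). char P (\<sigma> t * y)"
  have "continuous_on UNIV (char P)"
    by (intro continuous_at_imp_continuous_on ballI P.isCont_char)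
  then have "continuous_on ?K (char P \<circ> (\<lambda>z. \<sigma> (fst z) * snd z))"
    by (intro continuous_on_compose continuous_intros continuous_on_compose2[OF \<sigma>_continuous])
      (auto intro: continuous_on_subset)
  then have "continuous_on ?K ?f" by (simp add: comp_def case_prod_unfold)
  then have "uniformly_continuous_on ?K ?f" by (intro compact_uniformly_continuous compact_Times) auto
  then obtain d where d: "0 < d" "\<And>z z'. z \<in> ?K \<Longrightarrow> z' \<in> ?K \<Longrightarrow> dist z' z < d \<Longrightarrow> dist (?f z') (?f z) < e"
    using e unfolding uniformly_continuous_on_def by metis
  show ?thesis
  \<comment> \<open>The bound 1 keeps t + h inside the compact interval up to M + 1, and d/2 makes
    the distance strictly less than d.\<close>
  proof (rule that[of "min (d / 2) 1"])
    show "0 < min (d / 2) 1" using d by simp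
    fix t h y :: real
    assume *: "0 \<le> t" "t < M" "\<bar>h\<bar> \<le> min (d / 2) 1" "0 \<le> t + h" "\<bar>y\<bar> \<le> R"
    have "dist (?f (t + h, y)) (?f (t, y)) < e"
      by (rule d(2)) (use * d in \<open>auto simp: dist_Pair_Pair dist_real_def\<close>)
    then show "norm (char P (\<sigma> (t + h) * y) - char P (\<sigma> t * y)) \<le> e" by (simp add: dist_norm)
  qed
qed

lemma set_integrable_singular:
  assumes "0 < a"
  shows "integrable lborel (\<lambda>t. indicator {0..a} t * t powr (- 1 / 2) :: real)"
proof (rule integrableI_bounded)
  have "((\<lambda>t. t powr (- 1 / 2)) has_integral (a powr (- 1 / 2 + 1) / (- 1 / 2 + 1))) {0..a}"
    using assms by (intro has_integral_powr_from_0) auto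
  from nn_integral_has_integral_lebesgue[OF _ this]
  show "(\<integral>\<^sup>+t. ennreal (norm (indicator {0..a} t * t powr (- 1 / 2) :: real)) \<partial>lborel) < \<infinity>"
    by (simp add: abs_mult)
qed simp

end

section \<open>Transfer between the compactness conditions for a bounded extension\<close>

locale extended_setting = convolution_setting +
  fixes p p' :: ennreal and A :: "(real \<Rightarrow> complex) \<Rightarrow> real \<Rightarrow> complex"
  assumes pp: "1 \<le> p" "p \<le> 2" "1 / p + 1 / p' = 1"
    and A: "is_bounded_extension p p' I transform A"
begin

abbreviation R where "R \<equiv> restrict_space lborel I"

lemma p'_ge_2: "2 \<le> p'" and p'_ge_1: "1 \<le> p'"
proof -
  show "2 \<le> p'" by (rule conjugate_exponent_ge_2[OF pp])
  then show "1 \<le> p'" by (rule order_trans[rotated]) simp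
qed

lemma A_bound:
  obtains C where "0 \<le> C" "\<And>f c. Lq_le p R f c \<Longrightarrow> Lq_le p' R (A f) (C * c)"
proof -
  obtain C where C: "\<And>f. f \<in> Lq_space p I \<Longrightarrow> Lq_norm p' I (A f) \<le> ennreal C * Lq_norm p I f"
    using A unfolding is_bounded_extension_def by blast
  \<comment> \<open>The constant in the definition may be negative, where \<open>ennreal\<close>
    reads it as 0.\<close>
  have "Lq_le p' R (A f) (max C 0 * c)" if f: "Lq_le p R f c" for f c
  proof -
    have fS: "f \<in> Lq_space p I" by (rule Lq_spaceI[OF pp(1) f])
    then have "A f \<in> Lq_space p' I" using A unfolding is_bounded_extension_def by blast
    then have m: "A f \<in> borel_measurable R" by (simp add: Lq_space_def)
    have c: "0 \<le> c" using f Lq_le_nonneg by blast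
    have "Lq_norm p I f \<le> ennreal c"
      using f Lq_norm_le_iff[OF pp(1) Lq_le_measurable[OF f] c] by blast
    then have "Lq_norm p' I (A f) \<le> ennreal (max C 0) * ennreal c"
      by (intro order_trans[OF C[OF fS]] mult_mono) (auto intro: ennreal_leI)
    moreover have "ennreal (max C 0 * c) = ennreal (max C 0) * ennreal c" using c by (intro ennreal_mult) auto
    ultimately have "Lq_norm p' I (A f) \<le> ennreal (max C 0 * c)" by (simp only:)
    then show ?thesis using Lq_norm_le_iff[OF p'_ge_1 m] c by simp
  qed
  then show ?thesis using that[of "max C 0"] by simp
qed

(* Away from a large ball f contributes little to A f, and on the ball A is the absolutely convergent integral. *)
lemma A_decomposition:
  assumes C: "\<And>f c. Lq_le p R f c \<Longrightarrow> Lq_le p' R (A f) (C * c)"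
    and f: "Lq_le p R f c" and d: "Lq_le p R (\<lambda>x. f x - trunc \<rho> f x) d" and \<rho>: "0 \<le> \<rho>"
  obtains G where "Lq_le p' lborel G (4 * (C * d))"
    "AE x in lborel. A f (s x) = fourier_integral (trunc \<rho> (\<lambda>x. f (s x))) x + G x"
    "integrable lborel (trunc \<rho> (\<lambda>x. f (s x)))" "Lq_le p lborel (trunc \<rho> (\<lambda>x. f (s x))) (4 * c)"
proof -
  let ?h = "\<lambda>x. f x - trunc \<rho> f x"
  have trf: "(\<lambda>x. trunc \<rho> f (s x)) = trunc \<rho> (\<lambda>x. f (s x))"
    by (auto simp: trunc_def abs_fold)
  obtain r where r: "p = ennreal r" "1 \<le> r" using pp(1,2) by (cases p) (auto simp: top_unique)
  note g = Lq_le_foldI[OF pp(1) f]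
  have gi: "integrable lborel (trunc \<rho> (\<lambda>x. f (s x)))"
    using trunc_integrable(1)[OF r(2) _ \<rho>] g r by blast
  have gp: "Lq_le p lborel (trunc \<rho> (\<lambda>x. f (s x))) (4 * c)" by (rule Lq_le_trunc[OF pp(1) g])
  have fm: "f \<in> borel_measurable R" using f Lq_le_measurable by blast
  have tm: "trunc \<rho> f \<in> borel_measurable R"
  proof -
    have "(\<lambda>x. indicator {-\<rho>..\<rho>} x :: complex) \<in> borel_measurable R"
      by (rule measurable_restrict_space1) simp
    then have "(\<lambda>x. indicator {-\<rho>..\<rho>} x * f x) \<in> borel_measurable R"
      using fm by (rule borel_measurable_times)
    moreover have "(\<lambda>x. indicator {-\<rho>..\<rho>} x * f x) = trunc \<rho> f"
      by (intro ext) (auto simp: trunc_def indicator_def)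
    ultimately show ?thesis by simp
  qed
  have restr: "Lq_le q R (trunc \<rho> f) c'" if q: "1 \<le> q" and *: "Lq_le q lborel (trunc \<rho> (\<lambda>x. f (s x))) c'" for q c'
  proof (rule Lq_le_cong_AE[OF q Lq_le_restrictI[OF q *] tm])
    show "AE x in R. trunc \<rho> f x = trunc \<rho> (\<lambda>x. f (s x)) x"
      by (rule AE_I2) (simp add: trunc_def fold_id space_restrict_space)
  qed
  have t1: "trunc \<rho> f \<in> Lq_space 1 I"
  proof -
    have "Lq_le 1 lborel (trunc \<rho> (\<lambda>x. f (s x))) (\<integral>x. norm (trunc \<rho> (\<lambda>x. f (s x)) x) \<partial>lborel)"
      using gi borel_measurable_integrable[OF gi] by (simp add: Lq_le_def nn_integral_eq_integral)
    from Lq_spaceI[OF _ restr[OF _ this]] show ?thesis by simp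
  qed
  have tp: "trunc \<rho> f \<in> Lq_space p I" by (rule Lq_spaceI[OF pp(1) restr[OF pp(1) gp]])
  have hp: "?h \<in> Lq_space p I" by (rule Lq_spaceI[OF pp(1) d])
  \<comment> \<open>The linearity clause with scalar 1, applied to the truncation and the
    remainder.\<close>
  have "AE x in R. A (\<lambda>y. 1 * trunc \<rho> f y + ?h y) x = 1 * A (trunc \<rho> f) x + A ?h x"
    by (rule A[unfolded is_bounded_extension_def, THEN conjunct2, THEN conjunct1, THEN bspec[OF _ tp], THEN bspec[OF _ hp], THEN spec])
  moreover have "(\<lambda>y. 1 * trunc \<rho> f y + ?h y) = f" by auto
  ultimately have "AE x in R. A f x = A (trunc \<rho> f) x + A ?h x" by simp
  moreover have "AE x in R. A (trunc \<rho> f) x = transform (trunc \<rho> f) x"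
    using A t1 tp unfolding is_bounded_extension_def by blast
  ultimately have "AE x in R. A f x = transform (trunc \<rho> f) x + A ?h x"
    by eventually_elim simp
  from AE_fold[OF this] have "AE x in lborel. A f (s x) = fourier_integral (trunc \<rho> (\<lambda>x. f (s x))) x + A ?h (s x)"
    unfolding transform_fold unfolding transform_def trf .
  then show ?thesis using that[OF Lq_le_foldI[OF p'_ge_1 C[OF d]] _ gi gp] by blast
qed

lemma diff_ball_eq: "I - {x \<in> I. \<bar>x\<bar> \<le> \<rho>} = {x \<in> I. \<rho> < \<bar>x\<bar>}" by auto

lemma outside_ball_sets: "{x \<in> I. \<rho> < \<bar>x\<bar>} \<in> sets lborel"
  by measurable

lemma Lq_le_tail:
  assumes f: "f \<in> borel_measurable R" and le: "Lq_norm p (I - {x \<in> I. \<bar>x\<bar> \<le> \<rho>}) f < ennreal d"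
  shows "Lq_le p R (\<lambda>x. f x - trunc \<rho> f x) d"
proof -
  let ?J = "{x \<in> I. \<rho> < \<bar>x\<bar>}"
  have "f \<in> borel_measurable (restrict_space lborel ?J)"
    by (rule measurable_restrict_mono[OF f]) auto
  then have "Lq_le p (restrict_space lborel ?J) f d"
    using Lq_le_if_norm_less[OF pp(1)] le by (simp add: diff_ball_eq)
  then have "Lq_le p lborel (\<lambda>x. indicator ?J x * f x) d"
    using Lq_le_restrict_iff[OF pp(1) outside_ball_sets] by simp
  moreover have "(\<lambda>x. indicator ?J x * f x) = (\<lambda>x. indicator I x * (f x - trunc \<rho> f x))"
    by (auto simp: indicator_def trunc_def)
  ultimately show ?thesis using Lq_le_restrict_iff[OF pp(1)] by simp
qed

lemma T_A:
  assumes "Lq_le p' R (A f) c" "0 \<le> t" "x \<in> I"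
  shows "T t (A f) x = conv (\<sigma> t) (\<lambda>x. A f (s x)) x"
  by (rule T_conv[OF assms(2,3) fold_composition_measurable[OF Lq_le_measurable[OF assms(1)]]])

theorem Pa_imp_Pb1:
  assumes K: "\<And>f. f \<in> K \<Longrightarrow> Lq_le p R f c0" and Pa: "property_Pa p I K"
  shows "property_Pb1 p' I T (A ` K)"
  unfolding property_Pb1_def
proof (intro allI impI)
  fix \<epsilon> M :: real assume \<epsilon>: "0 < \<epsilon>" and M: "0 < M"
  obtain C where C: "0 \<le> C" "\<And>f c. Lq_le p R f c \<Longrightarrow> Lq_le p' R (A f) (C * c)" by (rule A_bound) blast
  obtain H where H: "0 < H" and hy: "\<And>g c. integrable lborel g \<Longrightarrow> Lq_le p lborel g c \<Longrightarrow> Lq_le p' lborel (fourier_integral g) (H * c)"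
    using hausdorff_young[OF pp] by blast
  define c where "c = \<bar>c0\<bar>"
  have c: "0 \<le> c" by (simp add: c_def)
  \<comment> \<open>In the final bound the tail contributes 32 C d \<le> \<epsilon>/4 and the
    multiplier 8 H \<eta> c \<le> \<epsilon>/4. Using C + 1 and c + 1 avoids division by
    zero.\<close>
  define d where "d = \<epsilon> / (128 * (C + 1))"
  have d: "0 < d" using \<epsilon> C by (simp add: d_def)
  have "C * d \<le> \<epsilon> / 128" using \<epsilon> C by (simp add: d_def field_simps)
  define \<eta> where "\<eta> = \<epsilon> / (32 * H * (c + 1))"
  have \<eta>: "0 < \<eta>" using \<epsilon> H c by (simp add: \<eta>_def)
  have "H * (\<eta> * (4 * c)) = \<epsilon> / 8 * (c / (c + 1))" using H c by (simp add: \<eta>_def)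
  also have "\<dots> \<le> \<epsilon> / 8" using \<epsilon> c by (intro mult_left_le) auto
  finally have "H * (\<eta> * (4 * c)) \<le> \<epsilon> / 8" .
  with \<open>C * d \<le> \<epsilon> / 128\<close> have total: "2 * (H * (\<eta> * (4 * c)) + 2 * (4 * (C * d) + 4 * (C * d))) < \<epsilon>" using \<epsilon> by simp
  obtain \<rho> where \<rho>: "0 < \<rho>" "\<And>f. f \<in> K \<Longrightarrow> Lq_norm p (I - {x \<in> I. \<bar>x\<bar> \<le> \<rho>}) f < ennreal d"
    using Pa d unfolding property_Pa_def by blast
  obtain \<delta> where \<delta>: "0 < \<delta>" "\<And>t h y. 0 \<le> t \<Longrightarrow> t < M \<Longrightarrow> \<bar>h\<bar> \<le> \<delta> \<Longrightarrow> 0 \<le> t + h \<Longrightarrow> \<bar>y\<bar> \<le> \<rho> \<Longrightarrow>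
     norm (char P (\<sigma> (t + h) * y) - char P (\<sigma> t * y)) \<le> \<eta>"
    using multiplier_uniformly_continuous[OF M less_imp_le[OF \<rho>(1)] \<eta>] by metis
  have main: "Lq_norm p' I (\<lambda>x. T (t + h) (A f) x - T t (A f) x) < ennreal \<epsilon>"
    if t: "0 \<le> t" "t < M" "\<bar>h\<bar> \<le> \<delta>" "0 \<le> t + h" and fK: "f \<in> K" for t h f
  proof -
    have f: "Lq_le p R f c" by (rule Lq_le_mono[OF pp(1) K[OF fK]]) (simp add: c_def)
    have Af: "Lq_le p' R (A f) (C * c)" by (rule C(2)[OF f])
    let ?G = "\<lambda>x. A f (s x)" and ?g = "trunc \<rho> (\<lambda>x. f (s x))"
    have Gm [measurable]: "?G \<in> borel_measurable borel"
      by (rule fold_composition_measurable[OF Lq_le_measurable[OF Af]])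
    obtain G2 where G2: "Lq_le p' lborel G2 (4 * (C * d))"
      and eq: "AE x in lborel. ?G x = fourier_integral ?g x + G2 x"
      and gi: "integrable lborel ?g" and gp: "Lq_le p lborel ?g (4 * c)"
      by (rule A_decomposition[OF C(2) f Lq_le_tail[OF Lq_le_measurable[OF f] \<rho>(2)[OF fK]]]) (use \<rho> in auto)
    have [measurable]: "?g \<in> borel_measurable borel" using gi by (auto dest: borel_measurable_integrable)
    note Fg = hy[OF gi gp]
    have sp: "AE x in lborel. conv (\<sigma> u) ?G x = fourier_integral (\<lambda>y. char P (\<sigma> u * y) * ?g y) x + conv (\<sigma> u) G2 x"
      if "0 \<le> u" for u
      using conv_add_AE[OF p'_ge_1 \<sigma>_nonneg[OF that] Gm Fg G2 eq] by (simp add: conv_fourier[OF gi])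
    let ?m = "\<lambda>u y. char P (\<sigma> u * y) * ?g y"
    have mi: "integrable lborel (?m u)" for u
      by (rule Bochner_Integration.integrable_bound[OF gi])
        (auto simp: norm_mult intro!: mult_left_le_one_le P.cmod_char_le_1)
    \<comment> \<open>On the ball the multipliers at the two times differ by at most \<eta>; off the
      ball the truncated function vanishes.\<close>
    have "Lq_le p lborel (\<lambda>y. ?m (t + h) y - ?m t y) (\<eta> * (4 * c))"
    proof (rule Lq_le_AE_mono[OF pp(1) gp])
      show "AE y in lborel. norm (?m (t + h) y - ?m t y) \<le> \<eta> * norm (?g y)"
      proof (rule AE_I2)
        fix y
        have "norm (char P (\<sigma> (t + h) * y) - char P (\<sigma> t * y)) * norm (?g y) \<le> \<eta> * norm (?g y)"
          using \<delta>(2)[OF t, of y] by (cases "\<bar>y\<bar> \<le> \<rho>") (auto intro: mult_right_mono simp: trunc_def)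
        then show "norm (?m (t + h) y - ?m t y) \<le> \<eta> * norm (?g y)"
          by (simp add: left_diff_distrib[symmetric] norm_mult)
      qed
    qed (use \<eta> in auto)
    from hy[OF Bochner_Integration.integrable_diff[OF mi mi] this]
    have 1: "Lq_le p' lborel (\<lambda>x. fourier_integral (?m (t + h)) x - fourier_integral (?m t) x) (H * (\<eta> * (4 * c)))"
      by (simp add: fourier_diff[OF mi mi, abs_def])
    \<comment> \<open>The remainder is small by itself, so contraction at each of the two times
      suffices.\<close>
    have 2: "Lq_le p' lborel (\<lambda>x. conv (\<sigma> (t + h)) G2 x - conv (\<sigma> t) G2 x) (2 * (4 * (C * d) + 4 * (C * d)))"
      by (intro Lq_le_diff p'_ge_1 conv_contraction G2)
    have 3: "Lq_le p' lborel (\<lambda>x. conv (\<sigma> (t + h)) ?G x - conv (\<sigma> t) ?G x) (2 * (H * (\<eta> * (4 * c)) + 2 * (4 * (C * d) + 4 * (C * d))))"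
    proof (rule Lq_le_cong_AE[OF p'_ge_1 Lq_le_add[OF p'_ge_1 1 2]])
      show "AE x in lborel. conv (\<sigma> (t + h)) ?G x - conv (\<sigma> t) ?G x =
         fourier_integral (?m (t + h)) x - fourier_integral (?m t) x + (conv (\<sigma> (t + h)) G2 x - conv (\<sigma> t) G2 x)"
        using sp[OF t(4)] sp[OF t(1)] by eventually_elim simp
    qed simp
    from Lq_norm_less[OF p'_ge_1 Lq_le_restrictI[OF p'_ge_1 this] total]
    have "Lq_norm p' I (\<lambda>x. conv (\<sigma> (t + h)) ?G x - conv (\<sigma> t) ?G x) < ennreal \<epsilon>" .
    moreover have "Lq_le p' R (\<lambda>x. T (t + h) (A f) x - T t (A f) x) (2 * (H * (\<eta> * (4 * c)) + 2 * (4 * (C * d) + 4 * (C * d))))"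
    proof (rule Lq_le_cong_AE[OF p'_ge_1 Lq_le_restrictI[OF p'_ge_1 3]])
      have *: "x \<in> I \<Longrightarrow> T (t + h) (A f) x - T t (A f) x = conv (\<sigma> (t + h)) ?G x - conv (\<sigma> t) ?G x" for x
        using T_A[OF Af t(4)] T_A[OF Af t(1)] by simp
      then show "AE x in R. T (t + h) (A f) x - T t (A f) x = conv (\<sigma> (t + h)) ?G x - conv (\<sigma> t) ?G x"
        by (intro AE_I2) (simp add: space_restrict_space)
      show "(\<lambda>x. T (t + h) (A f) x - T t (A f) x) \<in> borel_measurable R"
        using Lq_le_measurable[OF Lq_le_restrictI[OF p'_ge_1 3]]
        by (rule measurable_cong[THEN iffD2, rotated]) (simp add: * space_restrict_space)
    qed
    ultimately show ?thesis using Lq_norm_less[OF p'_ge_1 _ total] by blast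
  qed
  show "\<exists>\<delta>>0. \<forall>t h. 0 \<le> t \<longrightarrow> t < M \<longrightarrow> \<bar>h\<bar> \<le> \<delta> \<longrightarrow> 0 \<le> t + h \<longrightarrow>
     (\<forall>f\<in>A ` K. Lq_norm p' I (\<lambda>x. T (t + h) f x - T t f x) < ennreal \<epsilon>)"
    using \<delta>(1) main by blast
qed

end

context extended_setting
begin

text \<open>Smallness of the remainder in L^p' has to become pointwise smallness. At time t > 0
  \<open>conv_pointwise\<close> gives this with a factor w(t), and the time average needs only that
  w is integrable. The main part is a transform of a truncated function times a multiplier of
  modulus at most 1, so its Lipschitz constant L is uniform in t and f.\<close>

theorem Pa_imp_Pb2:
  assumes K: "\<And>f. f \<in> K \<Longrightarrow> Lq_le p R f c0" and Pa: "property_Pa p I K"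
  shows "property_Pb2 I T (A ` K)"
  unfolding property_Pb2_def
proof (intro allI impI)
  fix \<epsilon> a R0 :: real assume \<epsilon>: "0 < \<epsilon>" and a: "0 < a"
  obtain r where r: "p = ennreal r" "1 \<le> r" using pp(1,2) by (cases p) (auto simp: top_unique)
  obtain C where C: "0 \<le> C" "\<And>f c. Lq_le p R f c \<Longrightarrow> Lq_le p' R (A f) (C * c)" by (rule A_bound) blast
  obtain H where H: "0 < H" and hy: "\<And>g c. integrable lborel g \<Longrightarrow> Lq_le p lborel g c \<Longrightarrow> Lq_le p' lborel (fourier_integral g) (H * c)"
    using hausdorff_young[OF pp] by blast
  obtain D where D: "0 \<le> D" "\<And>t. 0 < t \<Longrightarrow> t \<le> a \<Longrightarrow> B / \<sigma> t \<le> D / t" using \<sigma>_lower[OF a] by blast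
  define c where "c = \<bar>c0\<bar>"
  have c: "0 \<le> c" by (simp add: c_def)
  \<comment> \<open>An integrable majorant on (0, a] of the factor 1 + sqrt(B /
    \<open>\<sigma> t\<close>) from \<open>conv_pointwise\<close>.\<close>
  define w where "w = (\<lambda>t. indicator {0..a} t * (1 + sqrt D * t powr (- 1 / 2)))"
  have wi: "integrable lborel w"
  proof -
    have "integrable lborel (\<lambda>t. indicator {0..a} t + sqrt D * (indicator {0..a} t * t powr (- 1 / 2)))"
      by (intro Bochner_Integration.integrable_add integrable_mult_right set_integrable_singular a)
        (simp add: integrable_indicator_iff emeasure_lborel_Icc_eq)
    then show ?thesis by (simp add: w_def algebra_simps)
  qed
  have w0: "0 \<le> w t" for t using D by (simp add: w_def)
  define W where "W = (\<integral>t. w t \<partial>lborel)"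
  have W: "0 \<le> W" using w0 by (simp add: W_def)
  define d where "d = \<epsilon> * a / (32 * ((C + 1) * (W + 1)))"
  have d: "0 < d" using \<epsilon> a C W by (simp add: d_def)
  have dW: "8 * (C * d) * W \<le> \<epsilon> * a / 4"
  proof -
    have "8 * (C * d) * W = \<epsilon> * a / 4 * ((C / (C + 1)) * (W / (W + 1)))" using C W by (simp add: d_def)
    also have "\<dots> \<le> \<epsilon> * a / 4 * 1" using \<epsilon> a C W by (intro mult_left_mono mult_le_one) auto
    finally show ?thesis by simp
  qed
  obtain \<rho> where \<rho>: "0 < \<rho>" "\<And>f. f \<in> K \<Longrightarrow> Lq_norm p (I - {x \<in> I. \<bar>x\<bar> \<le> \<rho>}) f < ennreal d"
    using Pa d unfolding property_Pa_def by blast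
  \<comment> \<open>The radius times the L^1 bound of \<open>trunc_integrable\<close>; 4 c is the
    bound after unfolding.\<close>
  define L where "L = \<rho> * (2 * \<rho> + (4 * c) powr r)"
  have L: "0 \<le> L" using \<rho> by (simp add: L_def)
  define \<delta> where "\<delta> = \<epsilon> / (4 * (L + 1))"
  have \<delta>: "0 < \<delta>" using \<epsilon> L by (simp add: \<delta>_def)
  have \<delta>L: "\<delta> * L \<le> \<epsilon> / 4"
  proof -
    have "\<delta> * L = \<epsilon> / 4 * (L / (L + 1))" using L by (simp add: \<delta>_def)
    also have "\<dots> \<le> \<epsilon> / 4" using \<epsilon> L by (intro mult_left_le) auto
    finally show ?thesis .
  qed
  have singular: "(1 + sqrt (B / \<sigma> t)) \<le> w t" if "0 < t" "t \<le> a" for t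
  proof -
    have "sqrt (B / \<sigma> t) \<le> sqrt (D / t)" using D(2)[OF that] by simp
    also have "sqrt (D / t) = sqrt D * t powr (- 1 / 2)"
      using that powr_minus[of t "1 / 2"] by (simp add: real_sqrt_divide powr_half_sqrt inverse_eq_divide)
    finally show ?thesis using that by (simp add: w_def)
  qed
  have main: "norm (time_mean T a R0 (A f) (x + h) - time_mean T a R0 (A f) x) < \<epsilon>"
    if h: "\<bar>h\<bar> \<le> \<delta>" and x: "x \<in> I" "x + h \<in> I" "\<bar>x\<bar> < R0" "\<bar>x + h\<bar> < R0" and fK: "f \<in> K" for x h f
  proof -
    have f: "Lq_le p R f c" by (rule Lq_le_mono[OF pp(1) K[OF fK]]) (simp add: c_def)
    have Af: "Lq_le p' R (A f) (C * c)" by (rule C(2)[OF f])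
    let ?G = "\<lambda>x. A f (s x)" and ?g = "trunc \<rho> (\<lambda>x. f (s x))"
    have Gm [measurable]: "?G \<in> borel_measurable borel"
      by (rule fold_composition_measurable[OF Lq_le_measurable[OF Af]])
    have G: "Lq_le p' lborel ?G (4 * (C * c))" by (rule Lq_le_foldI[OF p'_ge_1 Af])
    obtain G2 where G2: "Lq_le p' lborel G2 (4 * (C * d))"
      and eq: "AE x in lborel. ?G x = fourier_integral ?g x + G2 x"
      and gi: "integrable lborel ?g" and gp: "Lq_le p lborel ?g (4 * c)"
      by (rule A_decomposition[OF C(2) f Lq_le_tail[OF Lq_le_measurable[OF f] \<rho>(2)[OF fK]]]) (use \<rho> in auto)
    have [measurable]: "?g \<in> borel_measurable borel" using gi by (auto dest: borel_measurable_integrable)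
    have gL: "(\<integral>y. \<rho> * norm (?g y) \<partial>lborel) \<le> L"
      using trunc_integrable(2)[OF r(2) Lq_le_foldI[OF pp(1) f, unfolded r(1)] less_imp_le[OF \<rho>(1)]] \<rho>(1)
      by (simp add: L_def mult_left_mono)
    let ?m = "\<lambda>u y. char P (\<sigma> u * y) * ?g y"
    have mi: "integrable lborel (?m u)" for u
      by (rule Bochner_Integration.integrable_bound[OF gi])
        (auto simp: norm_mult intro!: mult_left_le_one_le P.cmod_char_le_1)
    have ymle: "norm (of_real y * ?m u y) \<le> \<rho> * norm (?g y)" for u y
    proof (cases "\<bar>y\<bar> \<le> \<rho>")
      case True
      have "norm (of_real y * ?m u y) = \<bar>y\<bar> * (norm (char P (\<sigma> u * y)) * norm (?g y))" by (simp add: norm_mult)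
      also have "\<dots> \<le> \<rho> * (1 * norm (?g y))"
        using True by (intro mult_mono mult_right_mono P.cmod_char_le_1) auto
      finally show ?thesis by simp
    qed (simp add: trunc_def)
    have ymi: "integrable lborel (\<lambda>y. of_real y * ?m u y)" for u
    proof (rule Bochner_Integration.integrable_bound)
      show "integrable lborel (\<lambda>y. \<rho> * norm (?g y))" using gi by simp
      show "AE y in lborel. norm (of_real y * ?m u y) \<le> norm (\<rho> * norm (?g y))"
        using \<rho>(1) by (intro AE_I2 order_trans[OF ymle]) simp
    qed simp
    have lip: "norm (fourier_integral (?m u) (x + h) - fourier_integral (?m u) x) \<le> \<bar>h\<bar> * L" for u
    proof -
      have "(\<integral>y. norm (of_real y * ?m u y) \<partial>lborel) \<le> (\<integral>y. \<rho> * norm (?g y) \<partial>lborel)"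
        using ymi[of u] gi by (intro integral_mono ymle) auto
      with gL have "(\<integral>y. norm (of_real y * ?m u y) \<partial>lborel) \<le> L" by linarith
      then have "\<bar>x + h - x\<bar> * (\<integral>y. norm (of_real y * ?m u y) \<partial>lborel) \<le> \<bar>h\<bar> * L" by (simp add: mult_left_mono)
      then show ?thesis by (rule order_trans[OF fourier_lipschitz[OF mi ymi]])
    qed
    have diff: "norm (conv (\<sigma> t) ?G (x + h) - conv (\<sigma> t) ?G x) \<le> \<bar>h\<bar> * L + 8 * (C * d) * w t" if t: "0 < t" "t \<le> a" for t
    proof -
      have sp: "conv (\<sigma> t) ?G y = fourier_integral (?m t) y + conv (\<sigma> t) G2 y" for y
        using conv_add[OF p'_ge_1 \<sigma>_pos[OF t(1)] Gm hy[OF gi gp] G2 eq] by (simp add: conv_fourier[OF gi])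
      have 2: "norm (conv (\<sigma> t) G2 y) \<le> w t * (4 * (C * d))" for y
        by (rule order_trans[OF conv_pointwise(2)[OF p'_ge_1 G2 \<sigma>_pos[OF t(1)] k_bound p'_ge_2]])
          (intro mult_right_mono singular t, use C d in simp)
      have "norm (conv (\<sigma> t) ?G (x + h) - conv (\<sigma> t) ?G x)
        = norm ((fourier_integral (?m t) (x + h) - fourier_integral (?m t) x) + (conv (\<sigma> t) G2 (x + h) - conv (\<sigma> t) G2 x))"
        unfolding sp by (simp only: add_diff_add)
      also have "\<dots> \<le> \<bar>h\<bar> * L + (w t * (4 * (C * d)) + w t * (4 * (C * d)))"
        by (intro norm_triangle_mono lip order_trans[OF norm_triangle_ineq4 add_mono] 2)
      finally show ?thesis by (simp add: algebra_simps)
    qed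
    let ?J = "\<lambda>y t. indicator {0..a} t *\<^sub>R conv (\<sigma> t) ?G y"
    \<comment> \<open>At t = 0 the convolution is evaluation of an arbitrary representative and has
      no sup bound; a single time does not affect the average.\<close>
    have nz: "AE t in lborel. t \<noteq> (0::real)" by (rule AE_lborel_singleton)
    have Ji: "integrable lborel (?J y)" for y
    proof (rule Bochner_Integration.integrable_bound)
      show "integrable lborel (\<lambda>t. w t * (4 * (C * c)))" using wi by simp
      show "?J y \<in> borel_measurable lborel" using conv_measurable_scale[OF Gm \<sigma>_measurable] by simp
      show "AE t in lborel. norm (?J y t) \<le> norm (w t * (4 * (C * c)))"
        using nz
      proof eventually_elim
        case (elim t)
        show ?case
        proof (cases "0 < t \<and> t \<le> a")
          case True
          then have "norm (conv (\<sigma> t) ?G y) \<le> (1 + sqrt (B / \<sigma> t)) * (4 * (C * c))"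
            by (intro conv_pointwise(2)[OF p'_ge_1 G \<sigma>_pos k_bound p'_ge_2]) simp
          also have "\<dots> \<le> w t * (4 * (C * c))" using True C c by (intro mult_right_mono singular) auto
          also have "\<dots> \<le> norm (w t * (4 * (C * c)))" by simp
          finally show ?thesis using True by simp
        qed (use elim in \<open>auto simp: indicator_def\<close>)
      qed
    qed
    have tm: "time_mean T a R0 (A f) y = of_real (1 / a) * (\<integral>t. ?J y t \<partial>lborel)" if "y \<in> I" "\<bar>y\<bar> < R0" for y
    proof -
      have "(LINT t:{0..a}|lborel. T t (A f) y) = (\<integral>t. ?J y t \<partial>lborel)"
        unfolding set_lebesgue_integral_def
        by (intro Bochner_Integration.integral_cong refl) (auto simp: indicator_def T_A[OF Af _ that(1)])
      then show ?thesis using that(2) by (simp add: time_mean_def)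
    qed
    have "norm (time_mean T a R0 (A f) (x + h) - time_mean T a R0 (A f) x)
       = (1 / a) * norm (\<integral>t. ?J (x + h) t - ?J x t \<partial>lborel)"
      using a x by (simp add: tm Bochner_Integration.integral_diff[OF Ji Ji] norm_divide flip: diff_divide_distrib)
    also have "\<dots> \<le> (1 / a) * (\<integral>t. indicator {0..a} t * (\<bar>h\<bar> * L) + 8 * (C * d) * w t \<partial>lborel)"
    proof (intro mult_left_mono order_trans[OF integral_norm_bound integral_mono_AE])
      show "integrable lborel (\<lambda>t. norm (?J (x + h) t - ?J x t))"
        by (intro integrable_norm Bochner_Integration.integrable_diff Ji)
      show "integrable lborel (\<lambda>t. indicator {0..a} t * (\<bar>h\<bar> * L) + 8 * (C * d) * w t)"
        using wi by (intro Bochner_Integration.integrable_add integrable_mult_left integrable_mult_right)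
          (auto simp: integrable_indicator_iff emeasure_lborel_Icc_eq)
      show "AE t in lborel. norm (?J (x + h) t - ?J x t) \<le> indicator {0..a} t * (\<bar>h\<bar> * L) + 8 * (C * d) * w t"
        using nz
      proof eventually_elim
        case (elim t)
        show ?case
        proof (cases "0 < t \<and> t \<le> a")
          case True
          then show ?thesis using diff[of t] by (simp add: indicator_def)
        next
          case False
          then have "t \<notin> {0..a}" using elim by auto
          then show ?thesis using C d w0 by simp
        qed
      qed
    qed (use a in simp)
    also have "(\<integral>t. indicator {0..a} t * (\<bar>h\<bar> * L) + 8 * (C * d) * w t \<partial>lborel) = a * (\<bar>h\<bar> * L) + 8 * (C * d) * W"
      using a wi unfolding W_def
      by (subst Bochner_Integration.integral_add) (auto simp: integrable_indicator_iff)
    also have "(1 / a) * (a * (\<bar>h\<bar> * L) + 8 * (C * d) * W) \<le> (1 / a) * (a * (\<epsilon> / 4) + \<epsilon> * a / 4)"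
    proof -
      have "\<bar>h\<bar> * L \<le> \<delta> * L" using h L by (rule mult_right_mono)
      with \<delta>L have "\<bar>h\<bar> * L \<le> \<epsilon> / 4" by linarith
      then show ?thesis using dW a by (intro mult_left_mono add_mono) auto
    qed
    also have "\<dots> < \<epsilon>" using a \<epsilon> by (simp add: field_simps)
    finally show ?thesis .
  qed
  show "\<exists>\<delta>>0. \<forall>x h. \<bar>h\<bar> \<le> \<delta> \<longrightarrow> x \<in> I \<longrightarrow> x + h \<in> I \<longrightarrow> \<bar>x\<bar> < R0 \<longrightarrow> \<bar>x + h\<bar> < R0 \<longrightarrow>
     (\<forall>f\<in>A ` K. norm (time_mean T a R0 f (x + h) - time_mean T a R0 f x) < \<epsilon>)"
    using \<delta> main by blast
qed

text \<open>The product formula for the transform of a convolution is available for integrable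
  functions only, so it is applied to a truncation u of f o s. The truncation radius may vary with
  f, since its errors are bounded by the fixed d; the cut-off \<rho> depends only on the time step
  and hence is uniform over K.\<close>

theorem Pb1_imp_Pa:
  assumes K: "\<And>f. f \<in> K \<Longrightarrow> Lq_le p R f c0" and Pb1: "property_Pb1 p I T K"
  shows "property_Pa p' I (A ` K)"
  unfolding property_Pa_def
proof (intro allI impI)
  fix \<epsilon> :: real assume \<epsilon>: "0 < \<epsilon>"
  obtain r where r: "p = ennreal r" "1 \<le> r" using pp(1,2) by (cases p) (auto simp: top_unique)
  obtain C where C: "0 \<le> C" "\<And>f c. Lq_le p R f c \<Longrightarrow> Lq_le p' R (A f) (C * c)" by (rule A_bound) blast
  obtain H where H: "0 < H" and hy: "\<And>g c. integrable lborel g \<Longrightarrow> Lq_le p lborel g c \<Longrightarrow> Lq_le p' lborel (fourier_integral g) (H * c)"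
    using hausdorff_young[OF pp] by blast
  define \<eta> where "\<eta> = \<epsilon> / (128 * H)"
  have \<eta>: "0 < \<eta>" using \<epsilon> H by (simp add: \<eta>_def)
  have H\<eta>: "H * \<eta> = \<epsilon> / 128" using H by (simp add: \<eta>_def)
  \<comment> \<open>Both H d and C d must be small at once, so d is divided by a number exceeding H
    and C. The final bound is 32 H \<eta> + 32 H d + 8 C d, with 32 H \<eta> = \<epsilon>/4.\<close>
  define S where "S = H + C + 1"
  define d where "d = \<epsilon> / (1024 * S)"
  have S: "0 < S" using H C by (simp add: S_def)
  have d: "0 < d" using \<epsilon> S by (simp add: d_def)
  have "d * S = \<epsilon> / 1024" using S by (simp add: d_def)
  then have "d * H + d * C + d = \<epsilon> / 1024" by (simp add: S_def algebra_simps)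
  moreover have "0 \<le> d * H" "0 \<le> d * C" using d H C by auto
  ultimately have Hd: "H * d \<le> \<epsilon> / 1024" "C * d \<le> \<epsilon> / 1024"
    using d unfolding mult.commute[of H d] mult.commute[of C d] by linarith+
  have total: "2 * (2 * (H * (2 * (4 * \<eta> + 2 * (d + d)))) + 4 * (C * d)) < \<epsilon>"
  proof -
    have "2 * (2 * (H * (2 * (4 * \<eta> + 2 * (d + d)))) + 4 * (C * d)) = 32 * (H * \<eta>) + 32 * (H * d) + 8 * (C * d)"
      by algebra
    then show ?thesis using Hd H\<eta> \<epsilon> by linarith
  qed
  \<comment> \<open>Only the increment from time 0 to time \<delta> is extracted from P_b1.\<close>
  obtain \<delta> where \<delta>: "0 < \<delta>" "\<And>f. f \<in> K \<Longrightarrow> Lq_norm p I (\<lambda>x. T (0 + \<delta>) f x - T 0 f x) < ennreal \<eta>"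
  proof -
    have "\<exists>\<delta>>0. \<forall>t h. 0 \<le> t \<longrightarrow> t < 1 \<longrightarrow> \<bar>h\<bar> \<le> \<delta> \<longrightarrow> 0 \<le> t + h \<longrightarrow>
           (\<forall>f\<in>K. Lq_norm p I (\<lambda>x. T (t + h) f x - T t f x) < ennreal \<eta>)"
      using Pb1 \<eta> zero_less_one unfolding property_Pb1_def by (elim allE[of _ \<eta>] allE[of _ 1] impE)
    then obtain \<delta> where *: "0 < \<delta>" "\<And>t h f. 0 \<le> t \<Longrightarrow> t < 1 \<Longrightarrow> \<bar>h\<bar> \<le> \<delta> \<Longrightarrow> 0 \<le> t + h \<Longrightarrow> f \<in> K \<Longrightarrow>
           Lq_norm p I (\<lambda>x. T (t + h) f x - T t f x) < ennreal \<eta>"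
      by auto
    show ?thesis by (rule that[OF *(1) *(2)]) (use *(1) in auto)
  qed
  have \<sigma>: "0 < \<sigma> \<delta>" by (rule \<sigma>_pos[OF \<delta>(1)])
  obtain Z where Z: "\<And>z. Z \<le> \<bar>z\<bar> \<Longrightarrow> norm (char P z) \<le> 1 / 2" using char_decay by blast
  \<comment> \<open>Beyond \<rho> the argument of the characteristic function exceeds the decay
    threshold; the added 1 keeps \<rho> positive.\<close>
  define \<rho> where "\<rho> = \<bar>Z\<bar> / \<sigma> \<delta> + 1"
  have \<rho>: "0 < \<rho>" using \<sigma> by (simp add: \<rho>_def add_nonneg_pos)
  have half: "norm v \<le> 2 * norm (char P (- \<sigma> \<delta> * z) * v - v)" if "\<rho> < \<bar>z\<bar>" for z v
  proof -
    have "\<bar>Z\<bar> / \<sigma> \<delta> \<le> \<bar>z\<bar>" using that by (simp add: \<rho>_def)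
    then have "\<bar>Z\<bar> \<le> \<sigma> \<delta> * \<bar>z\<bar>" using \<sigma> by (simp add: field_simps)
    then have "norm (char P (- \<sigma> \<delta> * z)) \<le> 1 / 2" using \<sigma> by (intro Z) (simp add: abs_mult)
    then have "norm (char P (- \<sigma> \<delta> * z) * v) \<le> 1 / 2 * norm v" unfolding norm_mult by (intro mult_right_mono) auto
    then show ?thesis using norm_triangle_ineq2[of v "char P (- \<sigma> \<delta> * z) * v"] by (simp add: norm_minus_commute)
  qed
  have main: "Lq_norm p' (I - {x \<in> I. \<bar>x\<bar> \<le> \<rho>}) (A f) < ennreal \<epsilon>" if fK: "f \<in> K" for f
  proof -
    note f = K[OF fK]
    let ?g = "\<lambda>x. f (s x)"
    have g: "Lq_le p lborel ?g (4 * c0)" by (rule Lq_le_foldI[OF pp(1) f])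
    have gm [measurable]: "?g \<in> borel_measurable borel"
      by (rule fold_composition_measurable[OF Lq_le_measurable[OF f]])
    have "Lq_le p lborel (\<lambda>x. conv (\<sigma> \<delta>) ?g x - ?g x) (4 * \<eta>)"
    proof -
      let ?f = "\<lambda>x. T (0 + \<delta>) f x - T 0 f x"
      have *: "x \<in> I \<Longrightarrow> ?f x = conv (\<sigma> \<delta>) ?g x - ?g x" for x
        using \<delta>(1) T_conv[of \<delta> x f] T_conv[of 0 x f] gm by (simp add: \<sigma>_zero)
      have "?f \<in> borel_measurable R \<longleftrightarrow> (\<lambda>x. conv (\<sigma> \<delta>) ?g x - ?g x) \<in> borel_measurable R"
        by (rule measurable_cong, rule *) (simp add: space_restrict_space)
      then have "?f \<in> borel_measurable R" by (simp add: measurable_restrict_space1)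
      from Lq_le_foldI[OF pp(1) Lq_le_if_norm_less[OF pp(1) this \<delta>(2)[OF fK]]]
      have "Lq_le p lborel (\<lambda>x. ?f (s x)) (4 * \<eta>)" .
      moreover have "?f (s x) = conv (\<sigma> \<delta>) ?g x - ?g x" for x
        unfolding *[OF fold_in] fold_fold conv_fold[OF gm] ..
      ultimately show ?thesis by simp
    qed
    note small = this
    obtain n where n: "Lq_le p lborel (\<lambda>x. ?g x - trunc (real n) ?g x) d"
      using trunc_tail[OF r(2) g[unfolded r(1)] d] unfolding r(1)[symmetric]
      by (auto simp: eventually_sequentially)
    let ?u = "trunc (real n) ?g"
    let ?v = "\<lambda>x. ?g x - ?u x"
    have fm: "f \<in> borel_measurable R" using f Lq_le_measurable by blast
    have ftr: "Lq_le p R (\<lambda>x. f x - trunc (real n) f x) d"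
    proof (rule Lq_le_cong_AE[OF pp(1) Lq_le_restrictI[OF pp(1) n]])
      have *: "x \<in> I \<Longrightarrow> f x - trunc (real n) f x = ?v x" for x by (simp add: trunc_def fold_id)
      show "AE x in R. f x - trunc (real n) f x = ?v x"
        by (rule AE_I2) (simp add: * space_restrict_space)
      show "(\<lambda>x. f x - trunc (real n) f x) \<in> borel_measurable R"
        by (subst measurable_cong[where g="?v"])
          (auto simp: * space_restrict_space intro!: measurable_restrict_space1)
    qed
    obtain G where G: "Lq_le p' lborel G (4 * (C * d))"
      and eq: "AE x in lborel. A f (s x) = fourier_integral ?u x + G x"
      and ui: "integrable lborel ?u" and up: "Lq_le p lborel ?u (4 * c0)"
      by (rule A_decomposition[OF C(2) f ftr]) auto
    have "conv (\<sigma> \<delta>) ?g x = conv (\<sigma> \<delta>) ?u x + conv (\<sigma> \<delta>) ?v x" for x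
      by (rule conv_add[OF pp(1) \<sigma> gm up n]) simp
    \<comment> \<open>The time increment of the truncation is that of the whole function minus that
      of the tail; contraction bounds the latter by 2 (d + d).\<close>
    then have cu: "conv (\<sigma> \<delta>) ?u x - ?u x = (conv (\<sigma> \<delta>) ?g x - ?g x) - (conv (\<sigma> \<delta>) ?v x - ?v x)" for x
      by simp
    have ci: "integrable lborel (conv (\<sigma> \<delta>) ?u)" by (rule conv_integrable[OF ui])
    have "Lq_le p lborel (\<lambda>x. conv (\<sigma> \<delta>) ?u x - ?u x) (2 * (4 * \<eta> + 2 * (d + d)))"
      unfolding cu by (intro Lq_le_diff small conv_contraction n pp)
    from hy[OF Bochner_Integration.integrable_diff[OF ci ui] this]
    have Fu: "Lq_le p' lborel (\<lambda>z. char P (- \<sigma> \<delta> * z) * fourier_integral ?u z - fourier_integral ?u z) (H * (2 * (4 * \<eta> + 2 * (d + d))))"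
      by (simp add: fourier_diff[OF ci ui, abs_def] fourier_conv[OF ui])
    let ?F = "\<lambda>z. if \<rho> < \<bar>z\<bar> then fourier_integral ?u z else 0"
    have "Lq_le p' lborel ?F (2 * (H * (2 * (4 * \<eta> + 2 * (d + d)))))"
    proof (rule Lq_le_AE_mono[OF p'_ge_1 Fu, where a=2])
      show "AE z in lborel. norm (?F z) \<le> 2 * norm (char P (- \<sigma> \<delta> * z) * fourier_integral ?u z - fourier_integral ?u z)"
        using half by (intro AE_I2) simp
    qed auto
    note FG = Lq_le_add[OF p'_ge_1 this G]
    let ?J = "{x \<in> I. \<rho> < \<bar>x\<bar>}"
    have Af: "Lq_le p' R (A f) (C * c0)" by (rule C(2)[OF f])
    have [measurable]: "(\<lambda>x. A f (s x)) \<in> borel_measurable borel"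
      by (rule fold_composition_measurable[OF Lq_le_measurable[OF Af]])
    have "Lq_le p' lborel (\<lambda>x. indicator ?J x * A f x) (2 * (2 * (H * (2 * (4 * \<eta> + 2 * (d + d)))) + 4 * (C * d)))"
    proof (rule Lq_le_AE_mono[OF p'_ge_1 FG, where a=1])
      have *: "(\<lambda>x. indicator ?J x * A f x) = (\<lambda>x. indicator ?J x * A f (s x))"
        by (intro ext) (auto simp: indicator_def fold_id)
      show "(\<lambda>x. indicator ?J x * A f x) \<in> borel_measurable lborel"
        unfolding * using outside_ball_sets by measurable
      show "AE x in lborel. norm (indicator ?J x * A f x) \<le> 1 * norm (?F x + G x)"
        using eq by eventually_elim (auto simp: indicator_def fold_id)
    qed auto
    then have "Lq_le p' (restrict_space lborel ?J) (A f) (2 * (2 * (H * (2 * (4 * \<eta> + 2 * (d + d)))) + 4 * (C * d)))"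
      using Lq_le_restrict_iff[OF p'_ge_1 outside_ball_sets] by blast
    from Lq_norm_less[OF p'_ge_1 this total] show ?thesis by (simp only: diff_ball_eq)
  qed
  show "\<exists>R0>0. \<forall>f\<in>A ` K. Lq_norm p' (I - {x \<in> I. \<bar>x\<bar> \<le> R0}) f < ennreal \<epsilon>"
    using \<rho> main by blast
qed

end

section \<open>Heat and Poisson kernels\<close>

theorem (in convolution_setting) compactness_transfer:
  fixes p p' :: ennreal
  assumes pp: "1 \<le> p" "p \<le> 2" "1 / p + 1 / p' = 1"
    and F: "\<And>f z. f \<in> Lq_space 1 I \<Longrightarrow> F f z = transform f z"
    and K: "K \<subseteq> Lq_space p I" "Lq_bounded p I K"
    and Khat: "Khat = extended_transform p p' I F ` K"
  shows "Khat \<subseteq> Lq_space p' I \<and>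
    (property_Pa p I K \<longrightarrow> property_Pb1 p' I T Khat \<and> property_Pb2 I T Khat) \<and>
    (property_Pb1 p I T K \<longrightarrow> property_Pa p' I Khat)"
proof -
  define A where "A = extended_transform p p' I F"
  \<comment> \<open>The predicate inspects the integral transform only on integrable functions, so
    agreement there makes the two predicates, and hence the chosen operators, equal.\<close>
  have "is_bounded_extension p p' I F = is_bounded_extension p p' I transform"
    unfolding is_bounded_extension_def
    by (intro ext arg_cong2[where f="(\<and>)"] refl ball_cong) (simp add: F)
  then have A: "is_bounded_extension p p' I transform A"
    using someI_ex[OF bounded_extension_exists[OF pp]] by (simp add: A_def extended_transform_def)
  interpret extended_setting I s k \<sigma> T B p p' A
    by unfold_locales (fact pp A)+
  obtain c where c: "\<And>f. f \<in> K \<Longrightarrow> Lq_norm p I f \<le> ennreal c"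
    using K(2) unfolding Lq_bounded_def by blast
  have bound: "Lq_le p R f (max c 0)" if "f \<in> K" for f
  proof -
    have "f \<in> borel_measurable R" using that K(1) by (auto simp: Lq_space_def)
    moreover have "Lq_norm p I f \<le> ennreal (max c 0)"
      by (rule order_trans[OF c[OF that]]) (rule ennreal_leI, simp)
    ultimately show ?thesis using Lq_norm_le_iff[OF pp(1), of f I "max c 0"] by (simp only: max.cobounded2)
  qed
  have "A ` K \<subseteq> Lq_space p' I" using A K(1) unfolding is_bounded_extension_def by blast
  then show ?thesis
    using Pa_imp_Pb1[OF bound] Pa_imp_Pb2[OF bound] Pb1_imp_Pa[OF bound] by (simp add: Khat A_def[symmetric])
qed

text \<open>The heat kernel at time t is the centred normal density of variance 2 b^2 t, which gives
  the scale b sqrt(2 t).\<close>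

lemma heat_setting:
  assumes b: "0 < b"
  shows "convolution_setting UNIV (\<lambda>x. x) std_normal_density (\<lambda>t. b * sqrt (2 * t)) (heat_semigroup b) 1"
proof
  fix f :: "real \<Rightarrow> complex" and x t :: real
  assume t: "0 \<le> t" and f [measurable]: "f \<in> borel_measurable borel"
  show "heat_semigroup b t f x = gauss.conv (b * sqrt (2 * t)) f x"
  proof (cases "t = 0")
    case True
    then show ?thesis by (simp add: heat_semigroup_def)
  next
    case False
    define r where "r = b * sqrt (2 * t)"
    have t: "0 < t" using t False by simp
    then have r: "0 < r" using b by (simp add: r_def)
    have r2: "r\<^sup>2 = 2 * b\<^sup>2 * t" using t by (simp add: r_def power_mult_distrib)
    have eq: "r * (exp (- (x - (x + - r * u))\<^sup>2 / (4 * b\<^sup>2 * t)) / (2 * b * sqrt (pi * t))) = std_normal_density u" for u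
    proof -
      have "(x - (x + - r * u))\<^sup>2 = (2 * b\<^sup>2 * t) * u\<^sup>2" by (simp add: power_mult_distrib r2)
      then have 1: "- (x - (x + - r * u))\<^sup>2 / (4 * b\<^sup>2 * t) = - u\<^sup>2 / 2" using b t by (simp add: field_simps)
      have 2: "r / (2 * b * sqrt (pi * t)) = 1 / sqrt (2 * pi)"
        using b t real_sqrt_mult_self[of 2] by (simp add: r_def real_sqrt_mult field_simps)
      have "r * (exp (- u\<^sup>2 / 2) / (2 * b * sqrt (pi * t))) = (r / (2 * b * sqrt (pi * t))) * exp (- u\<^sup>2 / 2)" by simp
      then show ?thesis unfolding 1 2 std_normal_density_def .
    qed
    have "heat_semigroup b t f x = of_real r * (\<integral>u. f (x + - r * u) * of_real (exp (- (x - (x + - r * u))\<^sup>2 / (4 * b\<^sup>2 * t)) / (2 * b * sqrt (pi * t))) \<partial>lborel)"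
      using t r unfolding heat_semigroup_def
      by (subst lborel_integral_real_affine[of "- r" _ x]) (simp_all add: scaleR_conv_of_real)
    also have "\<dots> = (\<integral>u. of_real r * (f (x + - r * u) * of_real (exp (- (x - (x + - r * u))\<^sup>2 / (4 * b\<^sup>2 * t)) / (2 * b * sqrt (pi * t)))) \<partial>lborel)"
      by (rule integral_mult_right_zero[symmetric])
    also have "\<dots> = (\<integral>u. std_normal_density u *\<^sub>R f (x - r * u) \<partial>lborel)"
    proof (intro Bochner_Integration.integral_cong refl)
      fix u
      have "a1 * (a2 * a3) = a1 * a3 * a2" for a1 a2 a3 :: complex by (simp add: mult_ac)
      note this[of "of_real r" "f _"]
      then show "of_real r * (f (x + - r * u) * of_real (exp (- (x - (x + - r * u))\<^sup>2 / (4 * b\<^sup>2 * t)) / (2 * b * sqrt (pi * t))))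
        = std_normal_density u *\<^sub>R f (x - r * u)"
        unfolding eq[of u, symmetric] scaleR_conv_of_real of_real_mult by simp
    qed
    also have "\<dots> = gauss.conv r f x" unfolding gauss.conv_def by (subst integral_density) auto
    finally show ?thesis by (simp only: r_def)
  qed
next
  fix u :: real
  have "1 / sqrt (2 * pi) * exp (- u\<^sup>2 / 2) \<le> 1 * 1"
    using pi_gt3 by (intro mult_mono) (auto simp: real_le_rsqrt)
  then show "std_normal_density u \<le> 1" by (simp add: std_normal_density_def)
next
  fix a :: real assume a: "0 < a"
  have "1 / (b * sqrt (2 * t)) \<le> (sqrt a / b) / t" if t: "0 < t" "t \<le> a" for t
  proof -
    have "t = sqrt t * sqrt t" using t by simp
    also have "\<dots> \<le> sqrt a * sqrt (2 * t)" using t by (intro mult_mono) auto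
    finally show ?thesis using b t by (simp add: field_simps)
  qed
  then show "\<exists>D\<ge>0. \<forall>t>0. t \<le> a \<longrightarrow> 1 / (b * sqrt (2 * t)) \<le> D / t"
    using a b by (intro exI[of _ "sqrt a / b"]) auto
next
  have "norm (char std_normal_distribution z) \<le> 1 / 2" if "2 \<le> \<bar>z\<bar>" for z
  proof -
    have "2\<^sup>2 \<le> \<bar>z\<bar>\<^sup>2" using that by (intro power_mono) auto
    then have "1 + z\<^sup>2 / 2 \<ge> 2" by simp
    then have "2 \<le> exp (z\<^sup>2 / 2)" using exp_ge_add_one_self[of "z\<^sup>2 / 2"] by linarith
    then have "exp (- (z\<^sup>2 / 2)) \<le> 1 / 2" by (simp add: exp_minus field_simps)
    then show ?thesis by (simp add: char_std_normal_distribution)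
  qed
  then show "\<exists>Z. \<forall>z. Z \<le> \<bar>z\<bar> \<longrightarrow> norm (char std_normal_distribution z) \<le> 1 / 2" by blast
qed (use b in \<open>auto simp: std_normal_density_def intro!: continuous_intros\<close>)

section \<open>The Poisson kernel and the cosine transform\<close>

abbreviation cauchy_density :: "real \<Rightarrow> real" where
  "cauchy_density u \<equiv> 1 / (pi * (1 + u\<^sup>2))"

lemma one_plus_square_pos: "0 < 1 + (u::real)\<^sup>2"
  by (simp add: add_pos_nonneg)

lemma cauchy_density_integral:
  "integrable lborel cauchy_density" "(\<integral>u. cauchy_density u \<partial>lborel) = 1"
proof -
  have i: "integrable lborel (\<lambda>u. inverse (1 + u\<^sup>2) :: real)"
    using integrable_inverse_1_plus_square by (simp add: set_integrable_def)
  have "(\<integral>u. inverse (1 + u\<^sup>2) \<partial>lborel) = pi"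
    using LBINT_inverse_1_plus_square by (simp add: interval_lebesgue_integral_def set_lebesgue_integral_def)
  moreover have "cauchy_density = (\<lambda>u. (1 / pi) * inverse (1 + u\<^sup>2))"
    by (auto simp: field_simps)
  ultimately show "integrable lborel cauchy_density" "(\<integral>u. cauchy_density u \<partial>lborel) = 1"
    using i by auto
qed

interpretation cauchy: density_kernel cauchy_density
proof
  show "(\<integral>\<^sup>+u. ennreal (cauchy_density u) \<partial>lborel) = 1"
    using cauchy_density_integral one_plus_square_pos
    by (subst nn_integral_eq_integral) (auto simp: less_imp_le)
qed (use one_plus_square_pos in \<open>auto simp: less_imp_le\<close>)

(* Shifting by a half period pi/z flips the sign of the phase, so only the increments of the density matter. *)
lemma char_cauchy_decay:
  assumes z: "pi \<le> \<bar>z\<bar>"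
  shows "norm (char cauchy.P z) \<le> 1 / 2"
proof -
  have z0: "z \<noteq> 0" using z pi_gt3 by auto
  \<comment> \<open>The hypothesis on z makes this half period at most 1 in modulus.\<close>
  define a where "a = pi / z"
  have a: "\<bar>a\<bar> \<le> 1" using z z0 by (simp add: a_def divide_le_eq)
  let ?k = cauchy_density
  have ki: "integrable lborel (\<lambda>u. ?k (a + 1 * u))"
    by (rule lborel_integrable_real_affine[OF cauchy_density_integral(1)]) simp
  have kI: "(\<integral>u. ?k (a + 1 * u) \<partial>lborel) = 1"
    using lborel_integral_real_affine[of 1 ?k a] cauchy_density_integral(2) by simp
  have e: "norm (iexp (z * u)) = 1" for u by (simp add: norm_exp_eq_Re)
  have i1: "integrable lborel (\<lambda>u. ?k u *\<^sub>R iexp (z * u))"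
    by (rule Bochner_Integration.integrable_bound[OF cauchy_density_integral(1)]) (auto simp: e)
  have i2: "integrable lborel (\<lambda>u. ?k (a + 1 * u) *\<^sub>R iexp (z * u))"
    by (rule Bochner_Integration.integrable_bound[OF ki]) (auto simp: e)
  have c1: "char cauchy.P z = (\<integral>u. ?k u *\<^sub>R iexp (z * u) \<partial>lborel)"
    unfolding char_def using one_plus_square_pos by (subst integral_density) (auto simp: less_imp_le)
  also have "\<dots> = (\<integral>u. ?k (a + 1 * u) *\<^sub>R iexp (z * (a + 1 * u)) \<partial>lborel)"
    by (subst lborel_integral_real_affine[of 1 _ a]) auto
  also have "\<dots> = (\<integral>u. - (?k (a + 1 * u) *\<^sub>R iexp (z * u)) \<partial>lborel)"
  proof (intro Bochner_Integration.integral_cong refl)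
    fix u
    have "z * (a + 1 * u) = pi + z * u" using z0 by (simp add: a_def field_simps)
    then have "iexp (z * (a + 1 * u)) = exp (\<i> * pi) * iexp (z * u)"
      by (simp only: of_real_add distrib_left exp_add)
    also have "exp (\<i> * pi) = -1" using exp_pi_i by (simp add: mult.commute)
    finally show "?k (a + 1 * u) *\<^sub>R iexp (z * (a + 1 * u)) = - (?k (a + 1 * u) *\<^sub>R iexp (z * u))" by simp
  qed
  finally have c2: "char cauchy.P z = - (\<integral>u. ?k (a + 1 * u) *\<^sub>R iexp (z * u) \<partial>lborel)"
    by simp
  then have c2': "(\<integral>u. ?k (a + 1 * u) *\<^sub>R iexp (z * u) \<partial>lborel) = - char cauchy.P z"
    by (simp only: minus_minus)
  have "2 * char cauchy.P z = (\<integral>u. ?k u *\<^sub>R iexp (z * u) \<partial>lborel) - (\<integral>u. ?k (a + 1 * u) *\<^sub>R iexp (z * u) \<partial>lborel)"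
    unfolding c1[symmetric] c2' by simp
  also have "\<dots> = (\<integral>u. (?k u - ?k (a + 1 * u)) *\<^sub>R iexp (z * u) \<partial>lborel)"
    unfolding scaleR_diff_left by (rule Bochner_Integration.integral_diff[OF i1 i2, symmetric])
  finally have "norm (2 * char cauchy.P z) \<le> (\<integral>u. norm ((?k u - ?k (a + 1 * u)) *\<^sub>R iexp (z * u)) \<partial>lborel)"
    by (simp only: integral_norm_bound)
  also have "\<dots> \<le> (\<integral>u. (1 / 2) * (?k u + ?k (a + 1 * u)) \<partial>lborel)"
  proof (rule integral_mono)
    show "integrable lborel (\<lambda>u. norm ((?k u - ?k (a + 1 * u)) *\<^sub>R iexp (z * u)))"
      unfolding scaleR_diff_left by (intro integrable_norm Bochner_Integration.integrable_diff i1 i2)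
    show "integrable lborel (\<lambda>u. (1 / 2) * (?k u + ?k (a + 1 * u)))"
      by (intro integrable_mult_right Bochner_Integration.integrable_add cauchy_density_integral ki)
    fix u
    define v where "v = a + 1 * u"
    \<comment> \<open>With |a| \<le> 1, the numerator |v^2 - u^2| is at most |u| + |v|, hence at
      most half of (1 + u^2) + (1 + v^2). Dividing by both factors bounds the increment by the mean
      of the two densities, whose integral is 1.\<close>
    have h: "\<bar>w\<bar> \<le> (1 + w\<^sup>2) / 2" for w :: real
      using sum_squares_bound[of 1 "\<bar>w\<bar>"] by simp
    have frac: "1 / (pi * X) - 1 / (pi * Y) = (Y - X) / (pi * (X * Y))" if "0 < X" "0 < Y" for X Y :: real
      using that by (simp add: field_simps)
    have "\<bar>?k u - ?k v\<bar> = \<bar>(v\<^sup>2 - u\<^sup>2) / (pi * ((1 + u\<^sup>2) * (1 + v\<^sup>2)))\<bar>"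
      unfolding frac[OF one_plus_square_pos one_plus_square_pos] by simp
    also have "v\<^sup>2 - u\<^sup>2 = a * (u + v)" by (simp add: v_def power2_eq_square algebra_simps)
    also have "\<bar>a * (u + v) / (pi * ((1 + u\<^sup>2) * (1 + v\<^sup>2)))\<bar> = \<bar>a\<bar> * \<bar>u + v\<bar> / (pi * ((1 + u\<^sup>2) * (1 + v\<^sup>2)))"
      using one_plus_square_pos[of u] one_plus_square_pos[of v] by (simp add: abs_mult)
    also have "\<dots> \<le> ((1 + u\<^sup>2) / 2 + (1 + v\<^sup>2) / 2) / (pi * ((1 + u\<^sup>2) * (1 + v\<^sup>2)))"
    proof (rule divide_right_mono)
      have "\<bar>a\<bar> * \<bar>u + v\<bar> \<le> 1 * (\<bar>u\<bar> + \<bar>v\<bar>)" using a by (intro mult_mono) auto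
      also have "\<dots> \<le> (1 + u\<^sup>2) / 2 + (1 + v\<^sup>2) / 2" unfolding mult_1 by (intro add_mono h)
      finally show "\<bar>a\<bar> * \<bar>u + v\<bar> \<le> (1 + u\<^sup>2) / 2 + (1 + v\<^sup>2) / 2" .
    qed (use one_plus_square_pos[of u] one_plus_square_pos[of v] in simp)
    also have "\<dots> = (1 / 2) * (?k u + ?k v)"
    proof -
      have "(X / 2 + Y / 2) / (pi * (X * Y)) = (1 / 2) * (1 / (pi * X) + 1 / (pi * Y))" if "0 < X" "0 < Y" for X Y :: real
        using that by (simp add: field_simps)
      from this[OF one_plus_square_pos one_plus_square_pos] show ?thesis .
    qed
    finally show "norm ((?k u - ?k (a + 1 * u)) *\<^sub>R iexp (z * u)) \<le> (1 / 2) * (?k u + ?k (a + 1 * u))"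
      unfolding v_def[symmetric] norm_scaleR e by simp
  qed
  also have "\<dots> = (1 / 2) * (1 + 1)"
    unfolding integral_mult_right_zero Bochner_Integration.integral_add[OF cauchy_density_integral(1) ki]
      kI cauchy_density_integral(2) ..
  finally show ?thesis by (simp add: norm_mult)
qed

lemma poisson_setting:
  "convolution_setting {0..} abs cauchy_density (\<lambda>t. t) poisson_semigroup 1"
proof
  fix f :: "real \<Rightarrow> complex" and x t :: real
  assume t: "0 \<le> t" and x: "x \<in> {0..}" and f [measurable]: "(\<lambda>x. f \<bar>x\<bar>) \<in> borel_measurable borel"
  show "poisson_semigroup t f x = cauchy.conv t (\<lambda>x. f \<bar>x\<bar>) x"
  proof (cases "t = 0")
    case True
    then show ?thesis using x by (simp add: poisson_semigroup_def)
  next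
    case False
    then have t: "0 < t" using t by simp
    have eq: "1 / pi * (t * (t / ((x + - t * u - x)\<^sup>2 + t\<^sup>2))) = cauchy_density u" for u
    proof -
      have "(x + - t * u - x)\<^sup>2 + t\<^sup>2 = t * (t * (1 + u\<^sup>2))" by (simp add: power2_eq_square algebra_simps)
      then show ?thesis using t by simp
    qed
    have "poisson_semigroup t f x = of_real (1 / pi) * (of_real t * (\<integral>u. f \<bar>x + - t * u\<bar> * of_real (t / ((x + - t * u - x)\<^sup>2 + t\<^sup>2)) \<partial>lborel))"
      using t unfolding poisson_semigroup_def
      by (subst lborel_integral_real_affine[of "- t" _ x]) (simp_all add: scaleR_conv_of_real)
    also have "\<dots> = (\<integral>u. of_real (1 / pi) * (of_real t * (f \<bar>x + - t * u\<bar> * of_real (t / ((x + - t * u - x)\<^sup>2 + t\<^sup>2)))) \<partial>lborel)"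
      by (simp only: integral_mult_right_zero)
    also have "\<dots> = (\<integral>u. cauchy_density u *\<^sub>R f \<bar>x - t * u\<bar> \<partial>lborel)"
    proof (intro Bochner_Integration.integral_cong refl)
      fix u
      have "a0 * (a1 * (a2 * a3)) = a0 * (a1 * a3) * a2" for a0 a1 a2 a3 :: complex by (simp add: mult_ac)
      note this[of "of_real (1 / pi)" "of_real t" "f _"]
      then show "of_real (1 / pi) * (of_real t * (f \<bar>x + - t * u\<bar> * of_real (t / ((x + - t * u - x)\<^sup>2 + t\<^sup>2))))
        = cauchy_density u *\<^sub>R f \<bar>x - t * u\<bar>"
        unfolding eq[of u, symmetric] scaleR_conv_of_real of_real_mult by simp
    qed
    also have "\<dots> = cauchy.conv t (\<lambda>x. f \<bar>x\<bar>) x"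
      unfolding cauchy.conv_def using one_plus_square_pos by (subst integral_density) (auto simp: less_imp_le)
    finally show ?thesis .
  qed
next
  fix u :: real
  have "1 * 1 \<le> pi * (1 + u\<^sup>2)" using pi_gt3 by (intro mult_mono) auto
  then show "cauchy_density u \<le> 1" by simp
next
  show "\<exists>Z. \<forall>z. Z \<le> \<bar>z\<bar> \<longrightarrow> norm (char cauchy.P z) \<le> 1 / 2" using char_cauchy_decay by blast
next
  show "\<exists>D\<ge>0. \<forall>t>0. t \<le> a \<longrightarrow> 1 / t \<le> D / t" for a :: real by (rule exI[of _ 1]) simp
qed (auto intro!: continuous_intros)

text \<open>The cosine integral is the average of the Fourier integrals at z and -z, which coincide
  because the extended function is even. Integrability justifies splitting the average into two
  integrals.\<close>

lemma cosine_integral_eq_fourier: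
  assumes f: "integrable lborel (\<lambda>x. f \<bar>x\<bar>)"
  shows "cosine_integral f z = fourier_integral (\<lambda>x. f \<bar>x\<bar>) z"
proof -
  have i: "integrable lborel (\<lambda>x. f \<bar>x\<bar> * exp (- \<i> * of_real x * of_real w))" for w
    by (rule fourier_integrand[OF f])
  have "fourier_integral (\<lambda>x. f \<bar>x\<bar>) (- z) = (\<integral>x. f \<bar>0 + - 1 * x\<bar> * exp (- \<i> * of_real (0 + - 1 * x) * of_real (- z)) \<partial>lborel)"
    unfolding fourier_integral_def by (subst lborel_integral_real_affine[of "-1" _ 0]) auto
  also have "\<dots> = fourier_integral (\<lambda>x. f \<bar>x\<bar>) z" by (simp add: fourier_integral_def)
  finally have even: "fourier_integral (\<lambda>x. f \<bar>x\<bar>) (- z) = fourier_integral (\<lambda>x. f \<bar>x\<bar>) z" .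
  have "2 * cosine_integral f z = (\<integral>x. 2 * (f \<bar>x\<bar> * of_real (cos (x * z))) \<partial>lborel)"
    unfolding cosine_integral_def by (rule integral_mult_right_zero[symmetric])
  also have "\<dots> = (\<integral>x. f \<bar>x\<bar> * exp (- \<i> * of_real x * of_real z) + f \<bar>x\<bar> * exp (- \<i> * of_real x * of_real (- z)) \<partial>lborel)"
  proof (intro Bochner_Integration.integral_cong refl)
    fix x
    have "2 * complex_of_real (cos (x * z)) = exp (- \<i> * of_real x * of_real z) + exp (- \<i> * of_real x * of_real (- z))"
      by (simp add: cos_of_real[symmetric] cos_exp_eq mult.assoc add.commute del: cos_of_real)
    then show "2 * (f \<bar>x\<bar> * of_real (cos (x * z))) = f \<bar>x\<bar> * exp (- \<i> * of_real x * of_real z) + f \<bar>x\<bar> * exp (- \<i> * of_real x * of_real (- z))"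
      by (simp only: distrib_left[symmetric] mult.left_commute[of 2])
  qed
  also have "\<dots> = fourier_integral (\<lambda>x. f \<bar>x\<bar>) z + fourier_integral (\<lambda>x. f \<bar>x\<bar>) (- z)"
    unfolding fourier_integral_def by (rule Bochner_Integration.integral_add[OF i i])
  finally show ?thesis unfolding even by simp
qed

theorem theorem2:
  fixes p p' :: ennreal and b :: real
    and I :: "real set"
    and T :: "real \<Rightarrow> (real \<Rightarrow> complex) \<Rightarrow> real \<Rightarrow> complex"
    and F :: "(real \<Rightarrow> complex) \<Rightarrow> real \<Rightarrow> complex"
    and K Khat :: "(real \<Rightarrow> complex) set"
  assumes "1 \<le> p" and "p \<le> 2" and "1 / p + 1 / p' = 1"
    and "b > 0"
    and setting:
      "(I = {0..} \<and> T = poisson_semigroup \<and> F = cosine_integral) \<or>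
       (I = UNIV \<and> T = heat_semigroup b \<and> F = fourier_integral)"
    and "K \<subseteq> Lq_space p I" and "Lq_bounded p I K"
    and "Khat = extended_transform p p' I F ` K"
  shows "Khat \<subseteq> Lq_space p' I \<and>
    (property_Pa p I K \<longrightarrow> property_Pb1 p' I T Khat \<and> property_Pb2 I T Khat) \<and>
    (property_Pb1 p I T K \<longrightarrow> property_Pa p' I Khat)"
  using setting
proof (elim disjE conjE)
  assume I: "I = {0..}" and T: "T = poisson_semigroup" and F: "F = cosine_integral"
  interpret convolution_setting "{0..}" abs cauchy_density "\<lambda>t. t" poisson_semigroup 1
    by (rule poisson_setting)
  have "F f z = transform f z" if fS: "f \<in> Lq_space 1 {0..}" for f z
  proof -
    obtain c where "Lq_le 1 (restrict_space lborel {0..}) f c" using Lq_spaceE[OF order_refl fS] by blast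
    then have f: "Lq_le 1 lborel (\<lambda>x. f \<bar>x\<bar>) (4 * c)" by (intro Lq_le_foldI) auto
    have "(\<integral>\<^sup>+x. ennreal (norm (f \<bar>x\<bar>)) \<partial>lborel) \<le> ennreal (4 * c)"
      using f Lq_le_nonneg[OF f] by (simp add: Lq_le_def)
    from le_less_trans[OF this ennreal_less_top] have "integrable lborel (\<lambda>x. f \<bar>x\<bar>)"
      using Lq_le_measurable[OF f] by (intro integrableI_bounded) simp_all
    then show ?thesis by (simp add: F transform_def cosine_integral_eq_fourier)
  qed
  then show ?thesis unfolding I T
    using assms by (intro compactness_transfer) (auto simp: I)
next
  assume I: "I = UNIV" and T: "T = heat_semigroup b" and F: "F = fourier_integral"
  interpret convolution_setting UNIV "\<lambda>x. x" std_normal_density "\<lambda>t. b * sqrt (2 * t)" "heat_semigroup b" 1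
    by (rule heat_setting) fact
  show ?thesis unfolding I T
    using assms by (intro compactness_transfer) (auto simp: I F transform_def)
qed

end
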